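(* Let $(\Omega,\mathcal F,\mathbb P)$, $\{\tau_x\}_{x\in\mathbb R^d}$, $A$, $a$, $\mathcal I$ be as described in the context, with $\mathbb P$ stationary but not assumed ergodic. Let $\{\mathbb P_\xi\}_{\xi\in\Omega_0}$, $(\Omega_0,\mathcal I_0,\tilde{\mathbb P})$ and $\Pi:\Omega\to\Omega_0$ be the ergodic decomposition of $\mathbb P$, let $A_{\mathsf h}$ be the random homogenized matrix, and let $a_{\mathrm h,\xi}$ be the homogenized matrix associated with $\mathbb P_\xi$, all as defined in the context. Then, for $\tilde{\mathbb P}$-almost every $\xi\in\Omega_0$ and all $\omega\in\Pi^{-1}(\xi)$, $$A_{\mathsf h}(\omega)=a_{\mathrm h,\xi}.$$ Therefore, for every Borel set $B\subseteq\mathcal M_{d,\mathrm{sym}}$, $$\mathbb P(\{\omega: A_{\mathsf h}(\omega)\in B\})=\tilde{\mathbb P}(\{\xi: a_{\mathrm h,\xi}\in B\}).$$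
   Context: Let $d\ge 2$, let $e_1,\dots,e_d$ be the standard basis of $\mathbb R^d$, and let $\mathcal M_{d,\mathrm{sym}}$ be the space of real symmetric $d\times d$ matrices. $(\Omega,\mathcal F,\mathbb P)$ is a probability space with a group of transformations $\{\tau_x:\Omega\to\Omega\}_{x\in\mathbb R^d}$ (so $\tau_{x+y}=\tau_x\circ\tau_y$, $\tau_0=\mathrm{id}$). Assumptions: - (stationarity) $\mathbb P\circ\tau_x=\mathbb P$ for all $x\in\mathbb R^d$; - $\mathcal F$ is countably generated; - (stochastic continuity) for all $B\in\mathcal F$, $\lim_{|x|\downarrow 0}\int_\Omega|\mathbf 1_B(\tau_x\omega)-\mathbf 1_B(\omega)|\,\mathbb P(d\omega)=0$; - the joint map $(x,\omega)\mapsto\tau_x\omega$ is measurable with respect to the product of the $\sigma$-algebra of Lebesgue measurable sets of $\mathbb R^d$ and $\mathcal F$. Let $\langle F\rangle=\int_\Omega F\,d\mathbb P$, let $\mathcal I\subseteq\mathcal F$ be the $\sigma$-algebra of sets $B\in\mathcal F$ with $\tau_xB=B$ for all $x\in\mathbb R^d$, and let $\langle F\,|\,\mathcal I\rangle$ be the conditional expectation under $\mathbb P$ of $F$ given $\mathcal I$. A stationary probability measure $\mathbb Q$ on $(\Omega,\mathcal F)$ is ergodic if $\mathbb Q(I)\in\{0,1\}$ for all $I\in\mathcal I$. Let $A:\Omega\to\mathcal M_{d,\mathrm{sym}}$ be measurable and such that, for constants $0<\lambda\le\Lambda$ and $\mathbb P$-almost every $\omega\in\Omega$, $\lambda|\zeta|^2\le\zeta\cdot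 A(\omega)\zeta\le\Lambda|\zeta|^2$ for all $\zeta\in\mathbb R^d$. Set $a(\omega,x)=A(\tau_x\omega)$. Correctors. For a stationary probability measure $\mathbb Q$ on $(\Omega,\mathcal F)$, the first-order correctors with respect to $(\Omega,\mathcal F,\mathbb Q)$ are random fields $\phi_i(\omega,\cdot)\in H^1_{loc}(\mathbb R^d)$, $i=1,\dots,d$, such that for $\mathbb Q$-almost every $\omega$ $$-\nabla\cdot a(\omega,x)\nabla(\phi_i(\omega,x)+x_i)=0\ \text{ in }\mathbb R^d,\qquad \lim_{R\uparrow+\infty}R^{-2}\frac{1}{|B_R|}\int_{|x|<R}\Big|\phi_i(\omega,x)-\frac{1}{|B_R|}\int_{|y|<R}\phi_i(\omega,y)\,dy\Big|^2dx=0 ,$$ with stationary gradient $\nabla\phi_i(\omega,x)=\chi_i(\tau_x\omega)$ for some $\chi_i\in L^2(\Omega,\mathcal F,\mathbb Q)^d$; $\nabla\phi_i(0)$, also written $\nabla\phi_i(0,\omega)$, denotes $\chi_i(\omega)$. Here $B_R=\{|x|<R\}$. Ergodic decomposition. $\{\mathbb P_\xi\}_{\xi\in\Omega_0}$ is a family of ergodic and stationary probability measures on $(\Omega,\mathcal F)$, $(\Omega_0,\mathcal I_0,\tilde{\mathbb P})$ is a probability space, and $\Pi:(\Omega,\mathcal I)\to(\Omega_0,\mathcal I_0)$ is a measurable map with $\tilde{\mathbb P}=\mathbb P\circ\Pi^{-1}$ (with $\xi\mapsto\mathbb P_\xi(B)$ $\mathcal I_0$-measurable for each $B\in\mathcal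 F$) such that for every $F\in L^1(\Omega,\mathcal F,\mathbb P)$ $$\langle F\rangle=\int_{\Omega_0}\Big(\int_\Omega F(\omega)\,\mathbb P_\xi(d\omega)\Big)\tilde{\mathbb P}(d\xi),\qquad \langle F\,|\,\mathcal I\rangle(\omega)=\int_\Omega F(\tilde\omega)\,\mathbb P_{\Pi(\omega)}(d\tilde\omega)\ \text{ for }\mathbb P\text{-a.e. }\omega .$$ Through the last relation conditional expectations given $\mathcal I$ are identified with random variables on $(\Omega_0,\mathcal I_0,\tilde{\mathbb P})$, i.e. one uses the version given by the right-hand side, which depends on $\omega$ only through $\Pi(\omega)$. Homogenized matrices. With $\phi_i$ the correctors with respect to $(\Omega,\mathcal F,\mathbb P)$, the random homogenized matrix $A_{\mathsf h}:\Omega\to\mathcal M_{d,\mathrm{sym}}$ is $$e_i\cdot A_{\mathsf h}(\omega)e_j=\big\langle(e_i+\nabla\phi_i(0))\cdot A(e_j+\nabla\phi_j(0))\,\big|\,\mathcal I\big\rangle(\omega),$$ with the version of the conditional expectation fixed by the identification above. It is the matrix such that, for any bounded open $D\subseteq\mathbb R^d$, $f\in H^{-1}(D)$ and $\mathbb P$-a.e. $\omega$, the solutions $u_\varepsilon\in H^1_0(D)$ of $-\nabla\cdot a(\omega,\frac{\cdot}{\varepsilon})\nabla u_\varepsilon=f$ converge weakly in $H^1_0(D)$ to the solution $u_{\mathsf h}\in H^1_0(D)$ of $-\nabla\cdot A_{\mathsf h}(\omega)\nabla u_{\mathsf h}=f$. For $\xi\in\Omega_0$, with $\phi_{\xi,i}$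 the correctors with respect to $(\Omega,\mathcal F,\mathbb P_\xi)$, the deterministic matrix $a_{\mathrm h,\xi}$ is $$e_i\cdot a_{\mathrm h,\xi}e_j=\int_\Omega(e_i+\nabla\phi_{\xi,i}(0,\omega))\cdot A(\omega)(e_j+\nabla\phi_{\xi,j}(0,\omega))\,\mathbb P_\xi(d\omega)$$ (defined for $\tilde{\mathbb P}$-almost every $\xi$). *)

theory Defs
  imports "HOL-Probability.Probability"
begin

section \<open>Stationary random environments\<close>

definition measure_action :: "'w measure \<Rightarrow> (real^'d \<Rightarrow> 'w \<Rightarrow> 'w) \<Rightarrow> bool" where
  "measure_action M \<tau> \<longleftrightarrow>
     (\<forall>x. \<forall>\<omega>\<in>space M. \<tau> x \<omega> \<in> space M) \<and>
     (\<forall>\<omega>\<in>space M. \<tau> 0 \<omega> = \<omega>) \<and>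
     (\<forall>x y. \<forall>\<omega>\<in>space M. \<tau> (x + y) \<omega> = \<tau> x (\<tau> y \<omega>)) \<and>
     (\<lambda>(x, \<omega>). \<tau> x \<omega>) \<in> measurable (lebesgue \<Otimes>\<^sub>M M) M"

definition stationary :: "(real^'d \<Rightarrow> 'w \<Rightarrow> 'w) \<Rightarrow> 'w measure \<Rightarrow> bool" where
  "stationary \<tau> Q \<longleftrightarrow> (\<forall>x. \<forall>B\<in>sets Q. emeasure Q (\<tau> x ` B) = emeasure Q B)"

definition countably_generated :: "'w measure \<Rightarrow> bool" where
  "countably_generated M \<longleftrightarrow>
     (\<exists>C. countable C \<and> C \<subseteq> Pow (space M) \<and> sets M = sigma_sets (space M) C)"

definition stochastically_continuous :: "(real^'d \<Rightarrow> 'w \<Rightarrow> 'w) \<Rightarrow> 'w measure \<Rightarrow> bool" where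
  "stochastically_continuous \<tau> M \<longleftrightarrow>
     (\<forall>B\<in>sets M.
        ((\<lambda>x. \<integral>\<omega>. \<bar>indicator B (\<tau> x \<omega>) - indicator B \<omega> :: real\<bar> \<partial>M) \<longlongrightarrow> 0) (at 0))"

definition invariant_sets :: "(real^'d \<Rightarrow> 'w \<Rightarrow> 'w) \<Rightarrow> 'w measure \<Rightarrow> 'w set set" where
  "invariant_sets \<tau> M = {B \<in> sets M. \<forall>x. \<tau> x ` B = B}"

text \<open>
  For a group action the invariant sets already form a \<open>\<sigma>\<close>-algebra; \<^const>\<open>sigma\<close> only packages
  them as a measure space, as \<^const>\<open>real_cond_exp\<close> expects.
\<close>

definition invariant_algebra :: "(real^'d \<Rightarrow> 'w \<Rightarrow> 'w) \<Rightarrow> 'w measure \<Rightarrow> 'w measure" where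
  "invariant_algebra \<tau> M = sigma (space M) (invariant_sets \<tau> M)"

definition ergodic :: "(real^'d \<Rightarrow> 'w \<Rightarrow> 'w) \<Rightarrow> 'w measure \<Rightarrow> bool" where
  "ergodic \<tau> Q \<longleftrightarrow> (\<forall>B\<in>invariant_sets \<tau> Q. measure Q B \<in> {0, 1})"

text \<open>
  \<open>K \<xi>\<close> is the ergodic component with index \<open>\<xi>\<close>, \<open>P\<^sub>0\<close> is the probability space of
  indices and \<open>p\<close> is the projection \<open>\<Pi>\<close> onto it.
\<close>

definition ergodic_decomposition ::
    "(real^'d \<Rightarrow> 'w \<Rightarrow> 'w) \<Rightarrow> 'w measure \<Rightarrow> 'x measure \<Rightarrow> ('x \<Rightarrow> 'w measure) \<Rightarrow> ('w \<Rightarrow> 'x) \<Rightarrow> bool" where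
  "ergodic_decomposition \<tau> P P\<^sub>0 K p \<longleftrightarrow>
     prob_space P\<^sub>0 \<and>
     (\<forall>\<xi>\<in>space P\<^sub>0. prob_space (K \<xi>) \<and> sets (K \<xi>) = sets P \<and> stationary \<tau> (K \<xi>) \<and> ergodic \<tau> (K \<xi>)) \<and>
     (\<forall>B\<in>sets P. (\<lambda>\<xi>. measure (K \<xi>) B) \<in> borel_measurable P\<^sub>0) \<and>
     p \<in> measurable (invariant_algebra \<tau> P) P\<^sub>0 \<and>
     distr P P\<^sub>0 p = P\<^sub>0 \<and>
     (\<forall>F :: 'w \<Rightarrow> real. integrable P F \<longrightarrow>
        (\<integral>\<omega>. F \<omega> \<partial>P) = (\<integral>\<xi>. (\<integral>\<omega>. F \<omega> \<partial>K \<xi>) \<partial>P\<^sub>0) \<and>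
        (AE \<omega> in P. real_cond_exp P (invariant_algebra \<tau> P) F \<omega> = (\<integral>\<omega>'. F \<omega>' \<partial>K (p \<omega>))))"


section \<open>Weak derivatives\<close>

definition partial_deriv :: "'d \<Rightarrow> (real^'d \<Rightarrow> real) \<Rightarrow> real^'d \<Rightarrow> real" where
  "partial_deriv k f x = frechet_derivative f (at x) (axis k 1)"

definition grad :: "(real^'d \<Rightarrow> real) \<Rightarrow> real^'d \<Rightarrow> real^'d" where
  "grad f x = (\<chi> k. partial_deriv k f x)"

primrec times_cont_diff :: "nat \<Rightarrow> (real^'d \<Rightarrow> real) \<Rightarrow> bool" where
  "times_cont_diff 0 f \<longleftrightarrow> continuous_on UNIV f"
| "times_cont_diff (Suc n) f \<longleftrightarrow>
     (\<forall>x. f differentiable (at x)) \<and> (\<forall>k. times_cont_diff n (partial_deriv k f))"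

definition test_function :: "(real^'d \<Rightarrow> real) \<Rightarrow> bool" where
  "test_function \<eta> \<longleftrightarrow> (\<forall>n. times_cont_diff n \<eta>) \<and> compact (closure {x. \<eta> x \<noteq> 0})"

definition L2_loc :: "(real^'d \<Rightarrow> 'b::euclidean_space) \<Rightarrow> bool" where
  "L2_loc f \<longleftrightarrow> f \<in> borel_measurable lebesgue \<and>
     (\<forall>C. compact C \<longrightarrow> set_integrable lebesgue C (\<lambda>x. (norm (f x))\<^sup>2))"

text \<open>\<open>u \<in> H\<^sup>1\<^sub>l\<^sub>o\<^sub>c\<close> with weak gradient \<open>v\<close>.\<close>

definition H1_loc_with_grad :: "(real^'d \<Rightarrow> real) \<Rightarrow> (real^'d \<Rightarrow> real^'d) \<Rightarrow> bool" where
  "H1_loc_with_grad u v \<longleftrightarrow> L2_loc u \<and> L2_loc v \<and>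
     (\<forall>\<eta>. test_function \<eta> \<longrightarrow>
        (\<forall>k. (\<integral>x. u x * partial_deriv k \<eta> x \<partial>lebesgue) = - (\<integral>x. v x $ k * \<eta> x \<partial>lebesgue)))"

text \<open>The equation \<open>-\<nabla>\<cdot>v = 0\<close> in the sense of distributions.\<close>

definition weakly_div_free :: "(real^'d \<Rightarrow> real^'d) \<Rightarrow> bool" where
  "weakly_div_free v \<longleftrightarrow>
     (\<forall>\<eta>. test_function \<eta> \<longrightarrow> (\<integral>x. grad \<eta> x \<bullet> v x \<partial>lebesgue) = 0)"

definition ball_avg :: "real \<Rightarrow> (real^'d \<Rightarrow> real) \<Rightarrow> real" where
  "ball_avg R f = (LINT x:ball 0 R|lebesgue. f x) / measure lebesgue (ball 0 R :: (real^'d) set)"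


section \<open>Correctors and homogenized matrices\<close>

text \<open>
  \<open>\<phi> i\<close> is the \<open>i\<close>-th corrector and \<open>g i\<close> its gradient at the origin, so that
  \<open>\<nabla>\<phi>\<^sub>i(\<omega>, x) = g i (\<tau> x \<omega>)\<close> and \<open>\<nabla>(\<phi>\<^sub>i(\<omega>, x) + x\<^sub>i) = g i (\<tau> x \<omega>) + e\<^sub>i\<close>.
  The coefficient field is \<open>a(\<omega>, x) = A (\<tau> x \<omega>)\<close>.
\<close>

definition correctors ::
    "(real^'d \<Rightarrow> 'w \<Rightarrow> 'w) \<Rightarrow> ('w \<Rightarrow> real^'d^'d) \<Rightarrow> 'w measure \<Rightarrow>
     ('d \<Rightarrow> 'w \<Rightarrow> real^'d \<Rightarrow> real) \<Rightarrow> ('d \<Rightarrow> 'w \<Rightarrow> real^'d) \<Rightarrow> bool" where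
  "correctors \<tau> A Q \<phi> g \<longleftrightarrow>
     (\<forall>i. (\<lambda>(\<omega>, x). \<phi> i \<omega> x) \<in> borel_measurable (Q \<Otimes>\<^sub>M lebesgue) \<and>
          g i \<in> borel_measurable Q \<and>
          integrable Q (\<lambda>\<omega>. (norm (g i \<omega>))\<^sup>2) \<and>
          (AE \<omega> in Q.
             H1_loc_with_grad (\<phi> i \<omega>) (\<lambda>x. g i (\<tau> x \<omega>)) \<and>
             weakly_div_free (\<lambda>x. A (\<tau> x \<omega>) *v (g i (\<tau> x \<omega>) + axis i 1)) \<and>
             ((\<lambda>R. ball_avg R (\<lambda>x. (\<phi> i \<omega> x - ball_avg R (\<phi> i \<omega>))\<^sup>2) / R\<^sup>2) \<longlongrightarrow> 0) at_top))"

definition energy_density ::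
    "('w \<Rightarrow> real^'d^'d) \<Rightarrow> ('d \<Rightarrow> 'w \<Rightarrow> real^'d) \<Rightarrow> 'd \<Rightarrow> 'd \<Rightarrow> 'w \<Rightarrow> real" where
  "energy_density A g i j \<omega> = (axis i 1 + g i \<omega>) \<bullet> (A \<omega> *v (axis j 1 + g j \<omega>))"

text \<open>
  The homogenized matrix of \<open>Q\<close>. The description does not depend on the correctors, since their
  gradients are unique up to \<open>Q\<close>-null sets. Along an ergodic decomposition the matrix of \<open>K \<xi>\<close> is
  determined for almost every \<open>\<xi>\<close> only, so that \<open>\<xi> \<mapsto> homogenized_matrix \<tau> A (K \<xi>)\<close> is measurable
  just for the completion of \<open>P\<^sub>0\<close>; its law has to be taken there.
\<close>

definition homogenized_matrix ::
    "(real^'d \<Rightarrow> 'w \<Rightarrow> 'w) \<Rightarrow> ('w \<Rightarrow> real^'d^'d) \<Rightarrow> 'w measure \<Rightarrow> real^'d^'d" where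
  "homogenized_matrix \<tau> A Q =
     (THE a. \<exists>\<phi> g. correctors \<tau> A Q \<phi> g \<and> a = (\<chi> i j. \<integral>\<omega>. energy_density A g i j \<omega> \<partial>Q))"

text \<open>
  The version of the conditional expectation given the invariant \<open>\<sigma>\<close>-algebra that
  the ergodic decomposition provides; it depends on \<open>\<omega>\<close> only through \<open>p \<omega>\<close>.
\<close>

definition inv_cond_exp ::
    "('x \<Rightarrow> 'w measure) \<Rightarrow> ('w \<Rightarrow> 'x) \<Rightarrow> ('w \<Rightarrow> real) \<Rightarrow> 'w \<Rightarrow> real" where
  "inv_cond_exp K p F \<omega> = (\<integral>\<omega>'. F \<omega>' \<partial>K (p \<omega>))"

lemma inv_cond_exp_AE:
  assumes "ergodic_decomposition \<tau> P P\<^sub>0 K p" and "integrable P F"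
  shows "AE \<omega> in P. inv_cond_exp K p F \<omega> = real_cond_exp P (invariant_algebra \<tau> P) F \<omega>"
  using assms unfolding ergodic_decomposition_def inv_cond_exp_def by (simp add: eq_commute)

definition random_homogenized_matrix ::
    "('x \<Rightarrow> 'w measure) \<Rightarrow> ('w \<Rightarrow> 'x) \<Rightarrow> ('w \<Rightarrow> real^'d^'d) \<Rightarrow> ('d \<Rightarrow> 'w \<Rightarrow> real^'d) \<Rightarrow>
     'w \<Rightarrow> real^'d^'d" where
  "random_homogenized_matrix K p A g \<omega> = (\<chi> i j. inv_cond_exp K p (energy_density A g i j) \<omega>)"

end

theory Submission imports Defs begin

text \<open>
  Since \<open>P\<close> is the mixture of its components, the correctors of \<open>P\<close> are correctors of almost
  every \<open>K \<xi>\<close>, and the random homogenized matrix at \<open>\<omega>\<close> is the energy matrix of these restricted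
  correctors. It remains to see that the matrix of a component does not depend on the choice of
  correctors, that is, that corrector gradients are unique. Let \<open>h\<close> be the difference of two of
  them. Testing \<open>\<nabla>\<cdot>A h = 0\<close> with a cut-off multiple of the difference of the correctors gives the
  Caccioppoli inequality, by which sublinearity forces the average of \<open>\<bar>h (\<tau>\<^sub>x \<omega>)\<bar>\<^sup>2\<close> over \<open>\<bar>x\<bar> < R\<close>
  to vanish as \<open>R \<rightarrow> \<infinity>\<close>. By stationarity the average of \<open>min 1 \<bar>h\<bar>\<^sup>2\<close> has an expectation independent
  of \<open>R\<close>, so \<open>h = 0\<close> almost surely by dominated convergence; no ergodic theorem is needed.
\<close>

section \<open>Smooth functions of compact support\<close>

text \<open>The obstacle is the test function. \<open>weakly_div_free\<close> admits only smooth
  functions, while the cut-off multiple of a difference of correctors is merely in H^1. Smoothing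
  makes it admissible, and no convergence of mollifications in L^2 has to be shown for that: the
  pairing of the flux with the gradient translated by z is a function of z that is continuous at 0,
  and its integral against every smooth kernel supported in the unit ball vanishes, so its value at
  0 vanishes too. Hence the space given to smooth kernels and to translations.

  The truncation by 1 supplies a constant as dominating function: averages of the full square tend
  to 0 along almost every orbit, but no common integrable bound for them is at hand.

  Uniqueness of gradients is needed inside each component because \<open>homogenized_matrix\<close>
  selects its value by \<open>THE\<close>. That value is controlled only for indices outside a null
  set, so the measurable object behind the equality of laws is the energy matrix of the one
  restricted family \<open>g\<close>.\<close>

lemma times_cont_diff_Suc_imp: "times_cont_diff (Suc n) f \<Longrightarrow> times_cont_diff n f"
proof (induction n arbitrary: f)
  case 0
  then show ?case
    by (auto intro!: continuous_at_imp_continuous_on differentiable_imp_continuous_within)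
next
  case (Suc n)
  then show ?case
    by (metis times_cont_diff.simps(2))
qed

lemma times_cont_diff_const: "times_cont_diff n (\<lambda>x::real^'d. c)"
proof (induction n arbitrary: c)
  case (Suc n)
  have "partial_deriv k (\<lambda>x::real^'d. c) = (\<lambda>x. 0)" for k
    by (simp add: partial_deriv_def fun_eq_iff frechet_derivative_const)
  then show ?case
    using Suc by simp
qed simp

lemma times_cont_diff_add:
  "times_cont_diff n f \<Longrightarrow> times_cont_diff n g \<Longrightarrow> times_cont_diff n (\<lambda>x. f x + g x)"
proof (induction n arbitrary: f g)
  case (Suc n)
  have "partial_deriv k (\<lambda>x. f x + g x) = (\<lambda>x. partial_deriv k f x + partial_deriv k g x)" for k
  proof
    fix x
    have "((\<lambda>x. f x + g x) has_derivative
        (\<lambda>h. frechet_derivative f (at x) h + frechet_derivative g (at x) h)) (at x)"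
      using Suc.prems by (intro has_derivative_add) (simp_all add: frechet_derivative_works[symmetric])
    from frechet_derivative_at[OF this, symmetric]
    show "partial_deriv k (\<lambda>x. f x + g x) x = partial_deriv k f x + partial_deriv k g x"
      by (simp add: partial_deriv_def)
  qed
  then show ?case
    using Suc by (auto simp: differentiable_add)
qed (auto intro: continuous_intros)

lemma partial_deriv_mult:
  assumes "f differentiable at x" "g differentiable at x"
  shows "partial_deriv k (\<lambda>x. f x * g x) x = f x * partial_deriv k g x + partial_deriv k f x * g x"
proof -
  have "((\<lambda>x. f x * g x) has_derivative
      (\<lambda>h. f x * frechet_derivative g (at x) h + frechet_derivative f (at x) h * g x)) (at x)"
    using assms by (intro has_derivative_mult) (simp_all add: frechet_derivative_works[symmetric])
  from frechet_derivative_at[OF this, symmetric] show ?thesis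
    by (simp add: partial_deriv_def)
qed

lemma times_cont_diff_mult:
  "times_cont_diff n f \<Longrightarrow> times_cont_diff n g \<Longrightarrow> times_cont_diff n (\<lambda>x. f x * g x)"
proof (induction n arbitrary: f g)
  case (Suc n)
  have "partial_deriv k (\<lambda>x. f x * g x) = (\<lambda>x. f x * partial_deriv k g x + partial_deriv k f x * g x)" for k
    using Suc.prems by (simp add: fun_eq_iff partial_deriv_mult)
  moreover have "times_cont_diff n f" "times_cont_diff n g"
    using Suc.prems times_cont_diff_Suc_imp by blast+
  ultimately show ?case
    using Suc by (auto intro!: times_cont_diff_add)
qed (auto intro: continuous_intros)

lemma partial_deriv_affine:
  fixes a :: "real^'d"
  assumes "f differentiable at (a + c *\<^sub>R x)"
  shows "partial_deriv k (\<lambda>x. f (a + c *\<^sub>R x)) x = c * partial_deriv k f (a + c *\<^sub>R x)"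
proof -
  let ?f' = "frechet_derivative f (at (a + c *\<^sub>R x))"
  have f': "(f has_derivative ?f') (at (a + c *\<^sub>R x))"
    using assms by (simp add: frechet_derivative_works[symmetric])
  have "((\<lambda>x. f (a + c *\<^sub>R x)) has_derivative (\<lambda>h. ?f' (c *\<^sub>R h))) (at x)"
    by (rule has_derivative_compose[where f="\<lambda>x. a + c *\<^sub>R x", OF _ f'])
       (auto intro!: derivative_eq_intros)
  from frechet_derivative_at[OF this, symmetric] show ?thesis
    using linear_scale[OF has_derivative_linear[OF f']] by (simp add: partial_deriv_def)
qed

lemma times_cont_diff_affine:
  fixes a :: "real^'d"
  shows "times_cont_diff n f \<Longrightarrow> times_cont_diff n (\<lambda>x. f (a + c *\<^sub>R x))"
proof (induction n arbitrary: f)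
  case 0
  then show ?case
    by (auto intro!: continuous_intros intro: continuous_on_compose2[where s=UNIV and t=UNIV])
next
  case (Suc n)
  have "(\<lambda>x. f (a + c *\<^sub>R x)) differentiable at x" for x
    using Suc.prems by (intro differentiable_compose[where f=f and g="\<lambda>x. a + c *\<^sub>R x"]) auto
  moreover have "partial_deriv k (\<lambda>x. f (a + c *\<^sub>R x)) =
      (\<lambda>x. c * partial_deriv k f (a + c *\<^sub>R x))" for k
    using Suc.prems by (simp add: fun_eq_iff partial_deriv_affine)
  ultimately show ?case
    using Suc by (auto intro!: times_cont_diff_mult times_cont_diff_const)
qed

lemma times_cont_diff_coord: "times_cont_diff n (\<lambda>x::real^'d. x $ k)"
proof (cases n)
  case (Suc m)
  have "((\<lambda>x::real^'d. x $ k) has_derivative (\<lambda>h. h $ k)) (at x)" for x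
    by (rule bounded_linear.has_derivative[OF bounded_linear_vec_nth has_derivative_ident])
  note * = this this[THEN frechet_derivative_at, symmetric]
  have "(\<lambda>x::real^'d. x $ k) differentiable at x"
      "partial_deriv j (\<lambda>x::real^'d. x $ k) x = axis j 1 $ k" for x j
    using * by (auto simp: partial_deriv_def differentiable_def)
  then show ?thesis
    using Suc by (simp add: times_cont_diff_const cong: if_cong) (simp add: partial_deriv_def[abs_def] times_cont_diff_const)
qed (auto intro!: continuous_intros)

lemma has_derivative_grad:
  assumes "f differentiable at x"
  shows "(f has_derivative (\<lambda>h. grad f x \<bullet> h)) (at x)"
proof -
  let ?f' = "frechet_derivative f (at x)"
  have f': "(f has_derivative ?f') (at x)"
    using assms by (simp add: frechet_derivative_works[symmetric])
  have "?f' h = grad f x \<bullet> h" for h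
  proof -
    have "?f' h = ?f' (\<Sum>k\<in>UNIV. (h $ k) *\<^sub>R axis k 1)"
      by (metis basis_expansion scalar_mult_eq_scaleR)
    also have "\<dots> = (\<Sum>k\<in>UNIV. h $ k * ?f' (axis k 1))"
      using has_derivative_linear[OF f'] by (simp add: linear_sum linear_scale)
    finally show ?thesis
      by (simp add: grad_def partial_deriv_def inner_vec_def mult.commute)
  qed
  then show ?thesis
    using f' by presburger
qed

lemma partial_deriv_eqI:
  assumes "(f has_derivative (\<lambda>h. v \<bullet> h)) (at x)"
  shows "partial_deriv k f x = v $ k"
  using frechet_derivative_at[OF assms, symmetric] by (simp add: partial_deriv_def inner_axis)

section \<open>Test functions: support, bounds and closure properties\<close>

lemma test_functionD:
  assumes "test_function \<eta>"
  shows "\<eta> differentiable at x" "times_cont_diff n \<eta>" "continuous_on UNIV \<eta>"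
    "times_cont_diff n (partial_deriv k \<eta>)"
  using assms times_cont_diff.simps(2)[of 0 \<eta>] times_cont_diff.simps(2)[of n \<eta>]
    times_cont_diff.simps(1)[of \<eta>]
  unfolding test_function_def by blast+

lemma test_functionI:
  assumes "\<And>n. times_cont_diff n \<eta>" and "\<And>x. R < norm x \<Longrightarrow> \<eta> x = 0"
  shows "test_function \<eta>"
proof -
  have "{x. \<eta> x \<noteq> 0} \<subseteq> cball 0 R"
    using assms(2) by (force simp: not_less[symmetric])
  then have "bounded {x. \<eta> x \<noteq> 0}"
    using bounded_subset bounded_cball by blast
  then show ?thesis
    using assms(1) by (simp add: test_function_def)
qed

lemma partial_deriv_eq_0_outside:
  fixes f :: "real^'d \<Rightarrow> real"
  assumes "\<And>x. R < norm x \<Longrightarrow> f x = 0" "R < norm x"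
  shows "partial_deriv k f x = 0"
proof -
  have "((\<lambda>x. 0) has_derivative (\<lambda>h. 0 \<bullet> h)) (at x)" by simp
  moreover have "open {x::real^'d. R < norm x}"
    by (intro open_Collect_less continuous_intros)
  ultimately have "(f has_derivative (\<lambda>h. 0 \<bullet> h)) (at x)"
    by (rule has_derivative_transform_within_open) (use assms in auto)
  from partial_deriv_eqI[OF this] show ?thesis by simp
qed

lemma test_function_support:
  assumes "test_function \<eta>"
  obtains R where "0 < R" "\<And>x. R < norm x \<Longrightarrow> \<eta> x = 0" "\<And>x k. R < norm x \<Longrightarrow> partial_deriv k \<eta> x = 0"
proof -
  have "bounded (closure {x. \<eta> x \<noteq> 0})"
    using assms compact_imp_bounded unfolding test_function_def by blast
  then obtain R where R: "0 < R" "\<And>x. x \<in> closure {x. \<eta> x \<noteq> 0} \<Longrightarrow> norm x \<le> R"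
    unfolding bounded_pos by blast
  have 0: "\<eta> x = 0" if "R < norm x" for x
    using R(2)[of x] that closure_subset[of "{x. \<eta> x \<noteq> 0}"] by force
  then show thesis using that R(1) partial_deriv_eq_0_outside by blast
qed

lemma test_function_partial_deriv:
  assumes "test_function \<eta>"
  shows "test_function (partial_deriv k \<eta>)"
  using test_function_support[OF assms] test_functionD(4)[OF assms] test_functionI by metis

lemma test_function_bounded:
  assumes "test_function \<eta>"
  obtains C where "0 < C" "\<And>x. \<bar>\<eta> x\<bar> \<le> C"
proof -
  obtain R where R: "0 < R" "\<And>x. R < norm x \<Longrightarrow> \<eta> x = 0"
    using test_function_support[OF assms] by metis
  have "compact (\<eta> ` cball 0 R)"
    by (intro compact_continuous_image continuous_on_subset[OF test_functionD(3)[OF assms]]) auto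
  then obtain C where C: "0 < C" "\<And>x. x \<in> cball 0 R \<Longrightarrow> \<bar>\<eta> x\<bar> \<le> C"
    using compact_imp_bounded[THEN bounded_pos[THEN iffD1]] by (metis imageI real_norm_def)
  then have "\<bar>\<eta> x\<bar> \<le> C" for x
    using R(2)[of x] C by (cases "R < norm x") auto
  then show thesis using that C(1) by blast
qed

lemma test_function_mult:
  assumes "test_function \<eta>" "test_function \<zeta>"
  shows "test_function (\<lambda>x. \<eta> x * \<zeta> x)"
proof -
  obtain R where "\<And>x. R < norm x \<Longrightarrow> \<eta> x = 0"
    using test_function_support[OF assms(1)] by metis
  then show ?thesis
    using test_functionD(2)[OF assms(1)] test_functionD(2)[OF assms(2)]
    by (intro test_functionI[of _ R] times_cont_diff_mult) auto
qed

lemma test_function_affine: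
  fixes a :: "real^'d"
  assumes "test_function \<eta>" "c \<noteq> 0"
  shows "test_function (\<lambda>x. \<eta> (a + c *\<^sub>R x))"
proof -
  obtain R where R: "\<And>x. R < norm x \<Longrightarrow> \<eta> x = 0"
    using test_function_support[OF assms(1)] by metis
  have "R < norm (a + c *\<^sub>R x)" if "(R + norm a) / \<bar>c\<bar> < norm x" for x
  proof -
    have "R + norm a < \<bar>c\<bar> * norm x"
      using that assms(2) by (simp add: field_simps)
    also have "\<dots> \<le> norm (a + c *\<^sub>R x) + norm a"
      using norm_triangle_ineq4[of "a + c *\<^sub>R x" a] by simp
    finally show ?thesis by simp
  qed
  then show ?thesis
    using test_functionD(2)[OF assms(1)] R
    by (intro test_functionI[of _ "(R + norm a) / \<bar>c\<bar>"] times_cont_diff_affine) auto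
qed

section \<open>A smooth bump function built from exp(-1/t)\<close>

text \<open>The polynomial factor in 1/t makes the family closed under differentiation, so
  smoothness of all its members follows by one induction.\<close>

definition flat_exp :: "real poly \<Rightarrow> real \<Rightarrow> real" where
  "flat_exp q t = (if 0 < t then poly q (1 / t) * exp (- (1 / t)) else 0)"

lemma poly_exp_decay: "((\<lambda>x::real. poly q x * exp (- x)) \<longlongrightarrow> 0) at_top"
proof -
  have "((\<lambda>x. \<Sum>i\<le>degree q. coeff q i * (x ^ i / exp x)) \<longlongrightarrow> (\<Sum>i\<le>degree q. coeff q i * 0)) at_top"
    by (intro tendsto_intros tendsto_power_div_exp_0)
  then show ?thesis
    by (simp add: poly_altdef sum_distrib_right exp_minus field_simps sum_divide_distrib)
qed

text \<open>In the variable s = 1/t, with ds/dt = - s^2, the derivative of q(s) exp(-s) is s^2 (q(s)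
  - q'(s)) exp(-s); \<open>[:0, 0, 1:]\<close> is the polynomial s^2. Only t = 0 needs a limit, and
  there the exponential beats every polynomial.\<close>

lemma has_field_derivative_flat_exp:
  "(flat_exp q has_field_derivative flat_exp ([:0, 0, 1:] * (q - pderiv q)) t) (at t)"
proof -
  consider "0 < t" | "t < 0" | "t = 0" by linarith
  then show ?thesis
  proof cases
    case 1
    have "((\<lambda>t. poly q (1 / t) * exp (- (1 / t))) has_field_derivative
        flat_exp ([:0, 0, 1:] * (q - pderiv q)) t) (at t)"
      using 1 by (auto intro!: derivative_eq_intros DERIV_chain2[OF poly_DERIV]
          simp: flat_exp_def field_simps power2_eq_square)
    then show ?thesis
      by (rule has_field_derivative_transform_within_open[where S="{0<..}"])
         (use 1 in \<open>auto simp: flat_exp_def\<close>)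
  next
    case 2
    have "((\<lambda>t. 0) has_field_derivative flat_exp ([:0, 0, 1:] * (q - pderiv q)) t) (at t)"
      using 2 by (simp add: flat_exp_def)
    then show ?thesis
      by (rule has_field_derivative_transform_within_open[where S="{..<0}"])
         (use 2 in \<open>auto simp: flat_exp_def\<close>)
  next
    case 3
    have "((\<lambda>t. flat_exp q t / t) \<longlongrightarrow> 0) (at_right 0)"
    proof -
      \<comment> \<open>The difference quotient at 0 carries an extra factor s = 1/t, which
        \<open>pCons 0 q\<close> absorbs as the polynomial s q(s).\<close>
      have "((\<lambda>t. poly (pCons 0 q) (inverse t) * exp (- inverse t)) \<longlongrightarrow> 0) (at_right 0)"
        by (rule filterlim_compose[OF poly_exp_decay filterlim_inverse_at_top_right])
      then show ?thesis
        by (rule Lim_transform_eventually)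
           (auto simp: eventually_at_right_field flat_exp_def field_simps intro!: exI[of _ 1])
    qed
    moreover have "((\<lambda>t. flat_exp q t / t) \<longlongrightarrow> 0) (at_left 0)"
      by (rule Lim_transform_eventually[OF tendsto_const])
         (auto simp: eventually_at_left_field flat_exp_def intro!: exI[of _ "-1"])
    ultimately have "((\<lambda>t. flat_exp q t / t) \<longlongrightarrow> 0) (at 0)"
      by (simp add: filterlim_split_at)
    then show ?thesis
      using 3 by (simp add: DERIV_def flat_exp_def)
  qed
qed

lemma has_derivative_flat_exp_ball:
  "((\<lambda>x::real^'d. flat_exp q (1 - x \<bullet> x)) has_derivative
    (\<lambda>h. (- 2 * flat_exp ([:0, 0, 1:] * (q - pderiv q)) (1 - x \<bullet> x)) *\<^sub>R x \<bullet> h)) (at x)"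
proof -
  have "((\<lambda>x::real^'d. 1 - x \<bullet> x) has_derivative (\<lambda>h. - 2 * (x \<bullet> h))) (at x)"
    by (auto intro!: derivative_eq_intros simp: inner_commute)
  from has_derivative_compose[OF this, OF has_field_derivative_flat_exp[unfolded has_field_derivative_def]]
  show ?thesis
    by (simp add: mult_ac)
qed

text \<open>A partial derivative changes the polynomial and brings in a coordinate factor, so the
  induction runs over all \<open>q\<close> at once.\<close>

lemma times_cont_diff_flat_exp_ball: "times_cont_diff n (\<lambda>x::real^'d. flat_exp q (1 - x \<bullet> x))"
proof (induction n arbitrary: q)
  case 0
  have "continuous (at x) (\<lambda>x::real^'d. flat_exp q (1 - x \<bullet> x))" for x
    using has_derivative_flat_exp_ball has_derivative_continuous by blast
  then show ?case
    by (simp add: continuous_at_imp_continuous_on)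
next
  case (Suc n)
  have partial: "partial_deriv k (\<lambda>x::real^'d. flat_exp q (1 - x \<bullet> x)) =
      (\<lambda>x. - 2 * flat_exp ([:0, 0, 1:] * (q - pderiv q)) (1 - x \<bullet> x) * x $ k)" for k
    by (subst fun_eq_iff, subst partial_deriv_eqI[OF has_derivative_flat_exp_ball]) simp
  have "(\<lambda>x::real^'d. flat_exp q (1 - x \<bullet> x)) differentiable at x" for x
    using has_derivative_flat_exp_ball unfolding differentiable_def by blast
  then show ?case
    unfolding times_cont_diff.simps partial
    by (intro conjI allI times_cont_diff_mult times_cont_diff_const times_cont_diff_coord Suc.IH)
qed

text \<open>The argument is the polynomial 1 - x \<bullet> x rather than 1 - norm x, which keeps the
  function smooth at the origin.\<close>

definition bump :: "real^'d \<Rightarrow> real" where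
  "bump x = flat_exp 1 (1 - x \<bullet> x)"

lemma bump_nonneg: "0 \<le> bump x"
  by (simp add: bump_def flat_exp_def)

lemma bump_eq_0: "1 \<le> norm x \<Longrightarrow> bump x = 0"
  using one_le_power[of "norm x" 2] by (simp add: bump_def flat_exp_def power2_norm_eq_inner)

text \<open>On the half ball the exponent is at least -4/3; -2 is a convenient smaller value, as any
  positive lower bound serves.\<close>

lemma bump_ge:
  assumes "norm x \<le> 1 / 2"
  shows "exp (- 2) \<le> bump x"
proof -
  have x: "x \<bullet> x \<le> 1 / 4"
    using power_mono[OF assms, of 2] by (simp add: power2_norm_eq_inner power_divide)
  then have "1 / (1 - x \<bullet> x) \<le> 2"
    by (simp add: field_simps)
  with x show ?thesis
    by (simp add: bump_def flat_exp_def)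
qed

lemma test_function_bump: "test_function bump"
proof (rule test_functionI)
  show "times_cont_diff n bump" for n
    using times_cont_diff_flat_exp_ball[of n 1] by (simp add: bump_def[abs_def])
  show "bump x = 0" if "1 < norm x" for x :: "real^'a"
    using that bump_eq_0[of x] by simp
qed

section \<open>Global Lipschitz and Taylor bounds for test functions\<close>

lemma test_function_grad_bounded:
  assumes "test_function \<eta>"
  obtains C where "0 < C" "\<And>x. norm (grad \<eta> x) \<le> C"
proof -
  have "\<forall>k. \<exists>C>0. \<forall>x. \<bar>partial_deriv k \<eta> x\<bar> \<le> C"
    using test_function_bounded[OF test_function_partial_deriv[OF assms]] by metis
  then obtain C where C: "\<And>k. 0 < C k" "\<And>k x. \<bar>partial_deriv k \<eta> x\<bar> \<le> C k" by metis
  have "norm (grad \<eta> x) \<le> (\<Sum>k\<in>UNIV. C k)" for x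
    using norm_le_l1_cart[of "grad \<eta> x"] sum_mono[of UNIV "\<lambda>k. \<bar>grad \<eta> x $ k\<bar>" C] C(2)
    by (force simp: grad_def)
  moreover have "0 < (\<Sum>k\<in>UNIV. C k)"
    using C(1) by (intro sum_pos) auto
  ultimately show thesis using that by blast
qed

lemma onorm_inner_le: "onorm (\<lambda>h. v \<bullet> h) \<le> norm v"
  by (rule onorm_bound) (auto simp: Cauchy_Schwarz_ineq2)

lemma test_function_lipschitz:
  assumes "test_function \<eta>"
  obtains L where "0 < L" "\<And>x y. \<bar>\<eta> x - \<eta> y\<bar> \<le> L * norm (x - y)"
proof -
  obtain C where C: "0 < C" "\<And>x. norm (grad \<eta> x) \<le> C"
    using test_function_grad_bounded[OF assms] by metis
  have "norm (\<eta> x - \<eta> y) \<le> C * norm (x - y)" for x y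
  proof (rule differentiable_bound[OF convex_UNIV])
    show "(\<eta> has_derivative (\<lambda>h. grad \<eta> x \<bullet> h)) (at x within UNIV)" for x
      using has_derivative_grad[OF test_functionD(1)[OF assms]] by simp
    show "onorm (\<lambda>h. grad \<eta> x \<bullet> h) \<le> C" for x
      using onorm_inner_le C(2) order_trans by blast
  qed auto
  then show thesis using that C(1) by simp
qed

text \<open>The gradient is globally Lipschitz, since its components are test functions; on the ball
  of radius \<open>norm h\<close> around x it thus varies by at most C times \<open>norm h\<close>.
  One constant for all x is what allows the remainder to be integrated over x, so that difference
  quotients pass to the limit under an integral.\<close>

lemma test_function_taylor:
  assumes "test_function \<eta>"
  obtains C where "0 < C" "\<And>x h. \<bar>\<eta> (x + h) - \<eta> x - grad \<eta> x \<bullet> h\<bar> \<le> C * (norm h)\<^sup>2"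
proof -
  have "\<forall>k. \<exists>L>0. \<forall>x y. \<bar>partial_deriv k \<eta> x - partial_deriv k \<eta> y\<bar> \<le> L * norm (x - y)"
    using test_function_lipschitz[OF test_function_partial_deriv[OF assms]] by metis
  then obtain L where L: "\<And>k. 0 < L k"
      "\<And>k x y. \<bar>partial_deriv k \<eta> x - partial_deriv k \<eta> y\<bar> \<le> L k * norm (x - y)" by metis
  define C where "C = (\<Sum>k\<in>UNIV. L k)"
  have "0 < C"
    unfolding C_def using L(1) by (intro sum_pos) auto
  have lip: "norm (grad \<eta> x - grad \<eta> y) \<le> C * norm (x - y)" for x y
    using norm_le_l1_cart[of "grad \<eta> x - grad \<eta> y"]
      sum_mono[of UNIV "\<lambda>k. \<bar>(grad \<eta> x - grad \<eta> y) $ k\<bar>" "\<lambda>k. L k * norm (x - y)"] L(2)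
    by (force simp: grad_def C_def sum_distrib_right)
  have "\<bar>\<eta> (x + h) - \<eta> x - grad \<eta> x \<bullet> h\<bar> \<le> C * (norm h)\<^sup>2" for x h
  proof -
    have "norm (\<eta> (x + h) - \<eta> x - grad \<eta> x \<bullet> (x + h - x)) \<le> norm (x + h - x) * (C * norm h)"
    proof (rule differentiable_bound_linearization[where S="cball x (norm h)" and f' = "\<lambda>x h. grad \<eta> x \<bullet> h"])
      show "x + t *\<^sub>R (x + h - x) \<in> cball x (norm h)" if "t \<in> {0..1}" for t
        using that by (auto simp: dist_norm mult_left_le_one_le)
      show "(\<eta> has_derivative (\<lambda>h. grad \<eta> y \<bullet> h)) (at y within cball x (norm h))" for y
        using has_derivative_grad[OF test_functionD(1)[OF assms]] has_derivative_at_withinI by blast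
      show "onorm ((\<lambda>h. grad \<eta> y \<bullet> h) - (\<lambda>h. grad \<eta> x \<bullet> h)) \<le> C * norm h"
        if "y \<in> cball x (norm h)" for y
      proof -
        have "onorm (\<lambda>h. (grad \<eta> y - grad \<eta> x) \<bullet> h) \<le> C * norm (y - x)"
          using onorm_inner_le lip order_trans by blast
        also have "\<dots> \<le> C * norm h"
          using that \<open>0 < C\<close> by (simp add: dist_norm norm_minus_commute)
        finally show ?thesis
          by (simp add: fun_diff_def inner_diff_left)
      qed
    qed simp
    then show ?thesis
      by (simp add: power2_eq_square mult_ac)
  qed
  then show thesis using that \<open>0 < C\<close> by blast
qed

section \<open>Mollification by smooth kernels\<close>

lemma borel_measurable_test_function:
  "test_function \<eta> \<Longrightarrow> \<eta> \<in> borel_measurable borel"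
  using borel_measurable_continuous_onI test_functionD(3) by blast

lemma integrable_mult_bounded:
  fixes w b :: "'a \<Rightarrow> real"
  assumes "integrable M w" "b \<in> borel_measurable M" "\<And>x. \<bar>b x\<bar> \<le> C"
  shows "integrable M (\<lambda>x. w x * b x)"
proof (rule Bochner_Integration.integrable_bound)
  show "integrable M (\<lambda>x. C * \<bar>w x\<bar>)"
    using assms(1) by simp
  show "(\<lambda>x. w x * b x) \<in> borel_measurable M"
    using assms borel_measurable_integrable by measurable
  have "\<bar>w x * b x\<bar> \<le> C * \<bar>w x\<bar>" for x
    using mult_left_mono[OF assms(3)[of x], of "\<bar>w x\<bar>"] by (simp add: abs_mult mult.commute)
  then show "AE x in M. norm (w x * b x) \<le> norm (C * \<bar>w x\<bar>)"
    using order_trans[OF _ abs_ge_self] by auto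
qed

lemma integrable_mult_test_function:
  fixes w :: "real^'d \<Rightarrow> real"
  assumes "integrable lebesgue w" "test_function \<eta>"
  shows "integrable lebesgue (\<lambda>y. w y * \<eta> (x - y))"
proof -
  obtain C where "\<And>x. \<bar>\<eta> x\<bar> \<le> C"
    using test_function_bounded[OF assms(2)] by metis
  moreover have "(\<lambda>y. \<eta> (x - y)) \<in> borel_measurable lebesgue"
  proof (rule measurable_completion)
    have "continuous_on UNIV (\<lambda>y. \<eta> (x - y))"
      by (intro continuous_on_compose2[OF test_functionD(3)[OF assms(2)]] continuous_intros) auto
    then show "(\<lambda>y. \<eta> (x - y)) \<in> borel_measurable lborel"
      by (simp add: borel_measurable_continuous_onI)
  qed
  ultimately show ?thesis
    using assms(1) integrable_mult_bounded by blast
qed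

text \<open>Convolution with a kernel that is neither normalized nor required to be nonnegative, so
  that partial derivatives of a kernel are admissible kernels as well.\<close>

definition mollify :: "(real^'d \<Rightarrow> real) \<Rightarrow> (real^'d \<Rightarrow> real) \<Rightarrow> real^'d \<Rightarrow> real" where
  "mollify w \<rho> x = (\<integral>y. w y * \<rho> (x - y) \<partial>lebesgue)"

text \<open>Integrating the uniform Taylor remainder of the kernel against \<bar>w\<bar> bounds the
  error by C times the L^1 norm of w times the square of \<open>norm h\<close>.\<close>

lemma has_derivative_mollify:
  assumes w: "integrable lebesgue w" and \<rho>: "test_function \<rho>"
  shows "(mollify w \<rho> has_derivative (\<lambda>h. (\<chi> k. mollify w (partial_deriv k \<rho>) x) \<bullet> h)) (at x)"
proof -
  let ?D = "\<lambda>h. (\<chi> k. mollify w (partial_deriv k \<rho>) x) \<bullet> h"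
  obtain C where C: "0 < C" "\<And>x h. \<bar>\<rho> (x + h) - \<rho> x - grad \<rho> x \<bullet> h\<bar> \<le> C * (norm h)\<^sup>2"
    using test_function_taylor[OF \<rho>] by metis
  define I where "I = (\<integral>y. \<bar>w y\<bar> \<partial>lebesgue)"
  have bound: "\<bar>mollify w \<rho> (x + h) - mollify w \<rho> x - ?D h\<bar> \<le> C * I * (norm h)\<^sup>2" for h
  proof -
    note int = integrable_mult_test_function[OF w \<rho>]
      integrable_mult_test_function[OF w test_function_partial_deriv[OF \<rho>]]
    have D: "?D h = (\<integral>y. w y * (grad \<rho> (x - y) \<bullet> h) \<partial>lebesgue)"
    proof -
      have "?D h = (\<Sum>k\<in>UNIV. (\<integral>y. w y * partial_deriv k \<rho> (x - y) * h $ k \<partial>lebesgue))"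
        by (simp add: inner_vec_def mollify_def)
      also have "\<dots> = (\<integral>y. (\<Sum>k\<in>UNIV. w y * partial_deriv k \<rho> (x - y) * h $ k) \<partial>lebesgue)"
        by (rule Bochner_Integration.integral_sum[symmetric]) (simp add: int)
      finally show ?thesis
        by (simp add: inner_vec_def grad_def sum_distrib_left mult_ac)
    qed
    have int_grad: "integrable lebesgue (\<lambda>y. w y * (grad \<rho> (x - y) \<bullet> h))"
    proof -
      have "integrable lebesgue (\<lambda>y. \<Sum>k\<in>UNIV. w y * partial_deriv k \<rho> (x - y) * h $ k)"
        by (intro Bochner_Integration.integrable_sum) (simp add: int)
      then show ?thesis
        by (simp add: inner_vec_def grad_def sum_distrib_left mult_ac)
    qed
    have "mollify w \<rho> (x + h) - mollify w \<rho> x - ?D h =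
        (\<integral>y. w y * (\<rho> (x - y + h) - \<rho> (x - y) - grad \<rho> (x - y) \<bullet> h) \<partial>lebesgue)"
      using int(1)[of x] int(1)[of "x + h"] int_grad unfolding D unfolding mollify_def
      by (simp add: right_diff_distrib diff_add_eq)
    also have "\<bar>\<dots>\<bar> \<le> (\<integral>y. \<bar>w y\<bar> * (C * (norm h)\<^sup>2) \<partial>lebesgue)"
    proof (rule order_trans[OF integral_abs_bound], rule integral_mono)
      have "integrable lebesgue (\<lambda>y. w y * (\<rho> (x - y + h) - \<rho> (x - y) - grad \<rho> (x - y) \<bullet> h))"
        using int(1)[of x] int(1)[of "x + h"] int_grad
        by (simp add: right_diff_distrib diff_add_eq)
      then show "integrable lebesgue (\<lambda>y. \<bar>w y * (\<rho> (x - y + h) - \<rho> (x - y) - grad \<rho> (x - y) \<bullet> h)\<bar>)"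
        by simp
      show "\<bar>w y * (\<rho> (x - y + h) - \<rho> (x - y) - grad \<rho> (x - y) \<bullet> h)\<bar> \<le> \<bar>w y\<bar> * (C * (norm h)\<^sup>2)" for y
        using C(2)[of "x - y" h] by (simp add: abs_mult mult_left_mono)
    qed (use w in auto)
    finally show ?thesis
      by (simp add: I_def mult_ac)
  qed
  have "0 \<le> I"
    by (simp add: I_def)
  show ?thesis
    unfolding has_derivative_at
  proof (intro conjI bounded_linear_inner_right)
    have "((\<lambda>h::real^'d. C * I * norm h) \<longlongrightarrow> 0) (at 0)"
      by (intro tendsto_mult_right_zero tendsto_norm_zero tendsto_ident_at)
    then show "(\<lambda>h. norm (mollify w \<rho> (x + h) - mollify w \<rho> x - ?D h) / norm h) \<midarrow>0\<rightarrow> 0"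
    proof (rule tendsto_0_le[where K=1])
      show "\<forall>\<^sub>F h in at 0. norm (norm (mollify w \<rho> (x + h) - mollify w \<rho> x - ?D h) / norm h)
          \<le> norm (C * I * norm h) * 1"
        using bound C(1) \<open>0 \<le> I\<close>
        by (intro eventuallyI) (simp add: divide_simps power2_eq_square mult_ac)
    qed
  qed
qed

lemma partial_deriv_mollify:
  assumes "integrable lebesgue w" and "test_function \<rho>"
  shows "partial_deriv k (mollify w \<rho>) = mollify w (partial_deriv k \<rho>)"
  using partial_deriv_eqI[OF has_derivative_mollify[OF assms]] by (simp add: fun_eq_iff)

lemma times_cont_diff_mollify:
  assumes w: "integrable lebesgue w"
  shows "test_function \<rho> \<Longrightarrow> times_cont_diff n (mollify w \<rho>)"
proof (induction n arbitrary: \<rho>)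
  case 0
  show ?case
    using has_derivative_continuous[OF has_derivative_mollify[OF w 0]]
    by (simp add: continuous_at_imp_continuous_on)
next
  case (Suc n)
  have "mollify w \<rho> differentiable at x" for x
    using has_derivative_mollify[OF w Suc.prems] unfolding differentiable_def by blast
  with Suc show ?case
    by (simp add: partial_deriv_mollify[OF w] test_function_partial_deriv)
qed

lemma mollify_eq_0:
  assumes "\<And>x. R < norm x \<Longrightarrow> w x = 0" "\<And>x. r < norm x \<Longrightarrow> \<rho> x = 0" "R + r < norm x"
  shows "mollify w \<rho> x = 0"
proof -
  have "(\<lambda>y. w y * \<rho> (x - y)) = (\<lambda>y. 0)"
  proof
    fix y
    show "w y * \<rho> (x - y) = 0"
    proof (cases "R < norm y")
    case False
    then have "r < norm (x - y)"
      using assms(3) norm_triangle_ineq2[of x y] by linarith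
    then show ?thesis
      using assms(2) by simp
    qed (simp add: assms(1))
  qed
  then show ?thesis
    by (simp only: mollify_def) simp
qed

lemma test_function_mollify:
  assumes "integrable lebesgue w" "\<And>x. R < norm x \<Longrightarrow> w x = 0" "test_function \<rho>"
  shows "test_function (mollify w \<rho>)"
proof -
  obtain r where "\<And>x. r < norm x \<Longrightarrow> \<rho> x = 0"
    using test_function_support[OF assms(3)] by metis
  then show ?thesis
    using mollify_eq_0[of R w r \<rho>] assms(2) times_cont_diff_mollify[OF assms(1,3)]
    by (intro test_functionI[of _ "R + r"]) auto
qed

text \<open>The reflected kernel y \<mapsto> \<rho>(x - y) is itself a test function; inserting it
  in the weak formulation moves the derivative from the kernel to w. The sign from the reflection
  cancels the sign from integration by parts.\<close>

lemma mollify_weak_deriv: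
  assumes "test_function \<rho>"
    and "\<And>\<zeta>. test_function \<zeta> \<Longrightarrow> (\<integral>x. w x * partial_deriv k \<zeta> x \<partial>lebesgue) = - (\<integral>x. G x * \<zeta> x \<partial>lebesgue)"
  shows "mollify w (partial_deriv k \<rho>) = mollify G \<rho>"
proof
  fix x
  have \<zeta>: "test_function (\<lambda>y. \<rho> (x + (- 1) *\<^sub>R y))"
    by (rule test_function_affine[OF assms(1)]) simp
  have "partial_deriv k (\<lambda>y. \<rho> (x + (- 1) *\<^sub>R y)) y = - partial_deriv k \<rho> (x - y)" for y
    using test_functionD(1)[OF assms(1)] by (subst partial_deriv_affine) auto
  with assms(2)[OF \<zeta>] show "mollify w (partial_deriv k \<rho>) x = mollify G \<rho> x"
    by (simp add: mollify_def)
qed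

section \<open>Continuity of translations in the square-integrable functions\<close>

lemma nn_integral_tendsto_0:
  assumes "\<And>n. (\<lambda>x. F n x :: real) \<in> borel_measurable M" "w \<in> borel_measurable M"
    and "\<And>n. AE x in M. F n x \<le> w x" "(\<integral>\<^sup>+x. ennreal (w x) \<partial>M) < \<infinity>"
    and "AE x in M. (\<lambda>n. F n x) \<longlonglongrightarrow> 0"
  shows "(\<lambda>n. \<integral>\<^sup>+x. ennreal (F n x) \<partial>M) \<longlonglongrightarrow> 0"
proof -
  have "(\<lambda>n. \<integral>\<^sup>+x. ennreal (F n x) \<partial>M) \<longlonglongrightarrow> (\<integral>\<^sup>+x. 0 \<partial>M)"
  proof (rule nn_integral_dominated_convergence[where w="\<lambda>x. ennreal (w x)"])
    show "AE x in M. (\<lambda>n. ennreal (F n x)) \<longlonglongrightarrow> 0"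
      using assms(5) by (auto elim!: eventually_mono dest: tendsto_ennrealI)
    show "AE x in M. ennreal (F n x) \<le> ennreal (w x)" for n
      using assms(3)[of n] by (auto elim!: eventually_mono intro: ennreal_leI)
  qed (use assms in auto)
  then show ?thesis by simp
qed

lemma square_add_le: "(a + b)\<^sup>2 \<le> 2 * a\<^sup>2 + 2 * (b::real)\<^sup>2"
  using sum_squares_bound[of a b] by (simp add: power2_sum)

lemma nn_integral_square_add_le:
  fixes a b :: "'a \<Rightarrow> real"
  assumes [measurable]: "a \<in> borel_measurable M" "b \<in> borel_measurable M"
    and "\<And>x. c x = a x + b x"
  shows "(\<integral>\<^sup>+x. ennreal ((c x)\<^sup>2) \<partial>M) \<le>
    2 * (\<integral>\<^sup>+x. ennreal ((a x)\<^sup>2) \<partial>M) + 2 * (\<integral>\<^sup>+x. ennreal ((b x)\<^sup>2) \<partial>M)"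
proof -
  have "(\<integral>\<^sup>+x. ennreal ((c x)\<^sup>2) \<partial>M) \<le> (\<integral>\<^sup>+x. 2 * ennreal ((a x)\<^sup>2) + 2 * ennreal ((b x)\<^sup>2) \<partial>M)"
  proof (rule nn_integral_mono)
    fix x
    have "ennreal ((c x)\<^sup>2) \<le> ennreal (2 * (a x)\<^sup>2 + 2 * (b x)\<^sup>2)"
      using ennreal_leI[OF square_add_le[of "a x" "b x"]] by (simp add: assms(3))
    then show "ennreal ((c x)\<^sup>2) \<le> 2 * ennreal ((a x)\<^sup>2) + 2 * ennreal ((b x)\<^sup>2)"
      by (simp add: ennreal_plus ennreal_mult)
  qed
  then show ?thesis
    by (simp add: nn_integral_add nn_integral_cmult)
qed

lemma borel_measurable_cball[measurable]: "cball (a::'a::metric_space) r \<in> sets borel"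
  by (simp add: borel_closed)

text \<open>Two dominated convergences: first clip the values of g at level m, then replace g by
  continuous functions converging to it almost everywhere. Clipping these at the same level provides
  the bound 2m for the difference, whose square is integrable over a ball. Each stage may cost e/4,
  as the square of a sum at most doubles both contributions.\<close>

lemma L2_approx_continuous:
  fixes g :: "real^'d \<Rightarrow> real"
  assumes g[measurable]: "g \<in> borel_measurable borel"
    and fin: "(\<integral>\<^sup>+x. ennreal ((g x)\<^sup>2) \<partial>lborel) < \<infinity>" and "0 < e"
  obtains u where "continuous_on UNIV u"
    "(\<integral>\<^sup>+x. ennreal ((indicator (cball 0 R) x * (g x - u x))\<^sup>2) \<partial>lborel) < ennreal e"
proof -
  define cl where "cl m x = max (- real m) (min (real m) x)" for m x
  have cl_lim: "(\<lambda>m. cl m x) \<longlonglongrightarrow> x" for x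
  proof (rule tendsto_eventually)
    obtain N where "\<bar>x\<bar> \<le> real N" using real_arch_simple by blast
    then show "\<forall>\<^sub>F m in sequentially. cl m x = x"
      by (intro eventually_sequentiallyI[of N]) (auto simp: cl_def)
  qed
  have cl_le: "\<bar>x - cl m x\<bar> \<le> \<bar>x\<bar>" "\<bar>cl m x\<bar> \<le> real m" for m x
    by (auto simp: cl_def)
  have [measurable]: "cl m \<in> borel_measurable borel" for m
    unfolding cl_def by measurable
  have cl_cont: "continuous_on UNIV (cl m)" for m
    unfolding cl_def by (intro continuous_intros)
  have "(\<lambda>m. \<integral>\<^sup>+x. ennreal ((g x - cl m (g x))\<^sup>2) \<partial>lborel) \<longlonglongrightarrow> 0"
  proof (rule nn_integral_tendsto_0[OF _ _ _ fin])
    show "AE x in lborel. (g x - cl m (g x))\<^sup>2 \<le> (g x)\<^sup>2" for m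
      using cl_le(1) abs_le_square_iff by blast
    have "(\<lambda>m. (g x - cl m (g x))\<^sup>2) \<longlonglongrightarrow> (g x - g x)\<^sup>2" for x
      by (intro tendsto_intros cl_lim)
    then show "AE x in lborel. (\<lambda>m. (g x - cl m (g x))\<^sup>2) \<longlonglongrightarrow> 0" by simp
  qed measurable
  then have "\<forall>\<^sub>F m in sequentially. (\<integral>\<^sup>+x. ennreal ((g x - cl m (g x))\<^sup>2) \<partial>lborel) < ennreal (e / 4)"
    using \<open>0 < e\<close> by (intro order_tendstoD(2)) auto
  then obtain m where m: "(\<integral>\<^sup>+x. ennreal ((g x - cl m (g x))\<^sup>2) \<partial>lborel) < ennreal (e / 4)"
    using eventually_happens'[OF sequentially_bot] by blast
  \<comment> \<open>This notion of measurability provides the continuous approximants, with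
    convergence off a negligible set.\<close>
  have "g measurable_on UNIV"
    using g by (intro lebesgue_measurable_imp_measurable_on_real measurable_completion) auto
  then obtain N c where N: "negligible N" and c: "\<And>n. continuous_on UNIV (c n)"
    and lim: "\<And>x. x \<notin> N \<Longrightarrow> (\<lambda>n. c n x) \<longlonglongrightarrow> g x"
    unfolding measurable_on_def by auto
  have [measurable]: "c n \<in> borel_measurable borel" for n
    using c borel_measurable_continuous_onI by blast
  have "AE x in lborel. x \<notin> N"
    using N AE_not_in[of N lebesgue] by (simp add: negligible_iff_null_sets AE_completion_iff)
  then have AE: "AE x in lborel. (\<lambda>n. c n x) \<longlonglongrightarrow> g x"
    using lim by (auto elim!: eventually_mono)
  have cl_isCont: "isCont (cl m) y" for y
    using cl_cont continuous_on_eq_continuous_at open_UNIV by blast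
  have "(\<lambda>n. \<integral>\<^sup>+x. ennreal ((indicator (cball 0 R) x * (cl m (g x) - cl m (c n x)))\<^sup>2) \<partial>lborel) \<longlonglongrightarrow> 0"
  proof (rule nn_integral_tendsto_0[where w="\<lambda>x. indicator (cball 0 R) x * (2 * real m)\<^sup>2"])
    have "\<bar>cl m (g x) - cl m (c n x)\<bar> \<le> 2 * real m" for x n
      using cl_le(2)[of m "g x"] cl_le(2)[of m "c n x"] by linarith
    then have "(cl m (g x) - cl m (c n x))\<^sup>2 \<le> (2 * real m)\<^sup>2" for x n
      by (metis abs_ge_zero power2_abs power_mono)
    then show "AE x in lborel. (indicator (cball 0 R) x * (cl m (g x) - cl m (c n x)))\<^sup>2
        \<le> indicator (cball 0 R) x * (2 * real m)\<^sup>2" for n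
      by (auto simp: indicator_def)
    have "(\<integral>\<^sup>+x. ennreal (indicator (cball (0::real^'d) R) x * (2 * real m)\<^sup>2) \<partial>lborel) =
        (\<integral>\<^sup>+x. ennreal ((2 * real m)\<^sup>2) * indicator (cball (0::real^'d) R) x \<partial>lborel)"
      by (rule nn_integral_cong) (simp split: split_indicator)
    also have "\<dots> = ennreal ((2 * real m)\<^sup>2) * emeasure lborel (cball (0::real^'d) R)"
      by (rule nn_integral_cmult_indicator) simp
    also have "\<dots> < \<infinity>"
      using emeasure_lborel_cball_finite[of "0::real^'d" R] by (simp add: ennreal_mult_less_top)
    finally show "(\<integral>\<^sup>+x. ennreal (indicator (cball (0::real^'d) R) x * (2 * real m)\<^sup>2) \<partial>lborel) < \<infinity>" .
    show "AE x in lborel. (\<lambda>n. (indicator (cball 0 R) x * (cl m (g x) - cl m (c n x)))\<^sup>2) \<longlonglongrightarrow> 0"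
      using AE
    proof eventually_elim
      case (elim x)
      have "(\<lambda>n. (indicator (cball 0 R) x * (cl m (g x) - cl m (c n x)))\<^sup>2)
          \<longlonglongrightarrow> (indicator (cball 0 R) x * (cl m (g x) - cl m (g x)))\<^sup>2"
        by (intro tendsto_intros isCont_tendsto_compose[OF cl_isCont elim])
      then show ?case by simp
    qed
  qed measurable
  then have "\<forall>\<^sub>F n in sequentially.
      (\<integral>\<^sup>+x. ennreal ((indicator (cball 0 R) x * (cl m (g x) - cl m (c n x)))\<^sup>2) \<partial>lborel) < ennreal (e / 4)"
    using \<open>0 < e\<close> by (intro order_tendstoD(2)) auto
  then obtain n where n:
      "(\<integral>\<^sup>+x. ennreal ((indicator (cball 0 R) x * (cl m (g x) - cl m (c n x)))\<^sup>2) \<partial>lborel) < ennreal (e / 4)"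
    using eventually_happens'[OF sequentially_bot] by blast
  show thesis
  proof
    show "continuous_on UNIV (\<lambda>x. cl m (c n x))"
      using continuous_on_compose2[OF cl_cont c] by blast
    have "(\<integral>\<^sup>+x. ennreal ((indicator (cball 0 R) x * (g x - cl m (c n x)))\<^sup>2) \<partial>lborel) \<le>
      2 * (\<integral>\<^sup>+x. ennreal ((indicator (cball 0 R) x * (g x - cl m (g x)))\<^sup>2) \<partial>lborel) +
      2 * (\<integral>\<^sup>+x. ennreal ((indicator (cball 0 R) x * (cl m (g x) - cl m (c n x)))\<^sup>2) \<partial>lborel)"
      by (rule nn_integral_square_add_le) (measurable, simp add: algebra_simps)
    also have "(\<integral>\<^sup>+x. ennreal ((indicator (cball 0 R) x * (g x - cl m (g x)))\<^sup>2) \<partial>lborel) \<le>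
        (\<integral>\<^sup>+x. ennreal ((g x - cl m (g x))\<^sup>2) \<partial>lborel)"
      by (intro nn_integral_mono) (auto simp: indicator_def)
    also have "2 * (\<integral>\<^sup>+x. ennreal ((g x - cl m (g x))\<^sup>2) \<partial>lborel) +
       2 * (\<integral>\<^sup>+x. ennreal ((indicator (cball 0 R) x * (cl m (g x) - cl m (c n x)))\<^sup>2) \<partial>lborel)
       < 2 * ennreal (e / 4) + 2 * ennreal (e / 4)"
      using m n by (intro add_strict_mono ennreal_mult_strict_left_mono) auto
    also have "2 * ennreal (e / 4) + 2 * ennreal (e / 4) = ennreal e"
      using \<open>0 < e\<close> by (simp flip: ennreal_mult ennreal_plus ennreal_numeral)
    finally show "(\<integral>\<^sup>+x. ennreal ((indicator (cball 0 R) x * (g x - cl m (c n x)))\<^sup>2) \<partial>lborel) < ennreal e"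
      by (simp add: add_mono mult_left_mono)
  qed
qed

section \<open>Shifts and reflections of Lebesgue measure, and continuity of translations\<close>

lemma lborel_distr_reflect: "distr lborel borel (\<lambda>z. x - z) = (lborel :: 'a::euclidean_space measure)"
  using lborel_affine[of "- 1" x] by (simp add: density_1)

lemma lborel_distr_shift: "distr lborel borel (\<lambda>x. x - z) = (lborel :: 'a::euclidean_space measure)"
  using lborel_affine[of 1 "- z"] by (simp add: density_1)

lemma nn_integral_lborel_shift:
  "f \<in> borel_measurable borel \<Longrightarrow> (\<integral>\<^sup>+x. f (x - z) \<partial>lborel) = (\<integral>\<^sup>+x. f x \<partial>(lborel :: 'a::euclidean_space measure))"
  by (subst (2) lborel_distr_shift[of z, symmetric]) (simp add: nn_integral_distr)

lemma integral_lborel_reflect: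
  fixes f :: "'a::euclidean_space \<Rightarrow> real"
  shows "f \<in> borel_measurable borel \<Longrightarrow> (\<integral>z. f (x - z) \<partial>lborel) = (\<integral>x. f x \<partial>lborel)"
  by (subst (2) lborel_distr_reflect[of x, symmetric]) (simp add: integral_distr)

lemma integrable_lborel_shift:
  fixes f :: "'a::euclidean_space \<Rightarrow> real"
  shows "integrable lborel f \<Longrightarrow> integrable lborel (\<lambda>x. f (x - z))"
  by (rule integrable_distr[of _ lborel borel]) (simp_all add: lborel_distr_shift)

lemma integrable_lborel_reflect:
  fixes f :: "'a::euclidean_space \<Rightarrow> real"
  shows "integrable lborel f \<Longrightarrow> integrable lborel (\<lambda>z. f (x - z))"
  by (rule integrable_distr[of _ lborel borel]) (simp_all add: lborel_distr_reflect)

text \<open>The difference g(x - z) - g(x) is split through a continuous approximant u: two terms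
  are small by approximation, one of them after a shift of the variable, and u(x - z) - u(x) is
  small by uniform continuity on a compact ball.\<close>

lemma L2_translation_continuous:
  fixes g :: "real^'d \<Rightarrow> real"
  assumes g[measurable]: "g \<in> borel_measurable borel"
    and fin: "(\<integral>\<^sup>+x. ennreal ((g x)\<^sup>2) \<partial>lborel) < \<infinity>" and "0 < e"
  obtains r where "0 < r" "\<And>z. norm z < r \<Longrightarrow>
    (\<integral>\<^sup>+x. ennreal ((indicator (cball 0 R) x * (g (x - z) - g x))\<^sup>2) \<partial>lborel) \<le> ennreal e"
proof -
  \<comment> \<open>The radius R + 1 leaves room for shifts shorter than 1. The tolerance e/16
    accounts for two nested uses of the bound for the square of a sum: two terms e/16 give e/4, and
    two terms e/4 give e.\<close>
  obtain u where u: "continuous_on UNIV u" and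
    u_le: "(\<integral>\<^sup>+x. ennreal ((indicator (cball 0 (R + 1)) x * (g x - u x))\<^sup>2) \<partial>lborel) < ennreal (e / 16)"
    using L2_approx_continuous[OF g fin, of "e / 16"] \<open>0 < e\<close> by auto
  have [measurable]: "u \<in> borel_measurable borel"
    using u borel_measurable_continuous_onI by blast
  define V where "V = measure lborel (cball (0::real^'d) R)"
  have V: "emeasure lborel (cball (0::real^'d) R) = ennreal V" "0 \<le> V"
    using emeasure_lborel_cball_finite[of "0::real^'d" R]
    by (auto simp: V_def emeasure_eq_ennreal_measure)
  \<comment> \<open>A pointwise error \<delta> costs at most \<delta>^2 V over the ball, here at
    most e/8; adding 1 to V covers the case V = 0.\<close>
  define \<delta> where "\<delta> = sqrt (e / (8 * (V + 1)))"
  have \<delta>: "0 < \<delta>" "\<delta>\<^sup>2 * V < e / 4"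
    using \<open>0 < e\<close> V(2) by (auto simp: \<delta>_def field_simps add_pos_nonneg)
  have "uniformly_continuous_on (cball 0 (R + 1)) u"
    by (rule compact_uniformly_continuous[OF continuous_on_subset[OF u]]) auto
  then obtain r where r: "0 < r"
      "\<And>x y. x \<in> cball 0 (R + 1) \<Longrightarrow> y \<in> cball 0 (R + 1) \<Longrightarrow> dist y x < r \<Longrightarrow> dist (u y) (u x) < \<delta>"
    using \<delta>(1) unfolding uniformly_continuous_on_def by metis
  show thesis
  proof (rule that[of "min r 1"])
    show "0 < min r 1" using r(1) by simp
    fix z :: "real^'d" assume z: "norm z < min r 1"
    let ?i = "\<lambda>x::real^'d. indicator (cball 0 R) x :: real"
    let ?j = "\<lambda>x::real^'d. indicator (cball 0 (R + 1)) x :: real"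
    have near: "x - z \<in> cball 0 (R + 1)" "x \<in> cball 0 (R + 1)" if "x \<in> cball 0 R" for x
      using that z norm_triangle_ineq4[of x z] by auto
    have 1: "(\<integral>\<^sup>+x. ennreal ((?i x * (g (x - z) - u (x - z)))\<^sup>2) \<partial>lborel) < ennreal (e / 16)"
    proof -
      have "(\<integral>\<^sup>+x. ennreal ((?i x * (g (x - z) - u (x - z)))\<^sup>2) \<partial>lborel)
          \<le> (\<integral>\<^sup>+x. ennreal ((?j (x - z) * (g (x - z) - u (x - z)))\<^sup>2) \<partial>lborel)"
        using near by (intro nn_integral_mono ennreal_leI) (auto simp: indicator_def split: if_splits)
      also have "\<dots> = (\<integral>\<^sup>+x. ennreal ((?j x * (g x - u x))\<^sup>2) \<partial>lborel)"
        by (rule nn_integral_lborel_shift[where f="\<lambda>x. ennreal ((?j x * (g x - u x))\<^sup>2)"]) measurable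
      finally show ?thesis using u_le by simp
    qed
    have 2: "(\<integral>\<^sup>+x. ennreal ((?i x * (u x - g x))\<^sup>2) \<partial>lborel) < ennreal (e / 16)"
    proof -
      have "(\<integral>\<^sup>+x. ennreal ((?i x * (u x - g x))\<^sup>2) \<partial>lborel)
          \<le> (\<integral>\<^sup>+x. ennreal ((?j x * (g x - u x))\<^sup>2) \<partial>lborel)"
        using near by (intro nn_integral_mono ennreal_leI)
          (auto simp: indicator_def power2_commute split: if_splits)
      then show ?thesis using u_le by simp
    qed
    have 3: "(\<integral>\<^sup>+x. ennreal ((?i x * (u (x - z) - u x))\<^sup>2) \<partial>lborel) \<le> ennreal (e / 4)"
    proof -
      have "(?i x * (u (x - z) - u x))\<^sup>2 \<le> \<delta>\<^sup>2 * ?i x" for x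
      proof (cases "x \<in> cball 0 R")
        case True
        have "\<bar>u (x - z) - u x\<bar> \<le> \<delta>"
          using r(2)[OF near(2,1)[OF True]] z by (simp add: dist_norm)
        then have "(u (x - z) - u x)\<^sup>2 \<le> \<delta>\<^sup>2"
          by (metis abs_ge_zero power2_abs power_mono)
        then show ?thesis using True by simp
      qed simp
      then have "ennreal ((?i x * (u (x - z) - u x))\<^sup>2) \<le> ennreal (\<delta>\<^sup>2) * indicator (cball 0 R) x" for x
        using ennreal_leI[of _ "\<delta>\<^sup>2 * ?i x"] by (metis ennreal_indicator ennreal_mult zero_le_power2 indicator_pos_le)
      then have "(\<integral>\<^sup>+x. ennreal ((?i x * (u (x - z) - u x))\<^sup>2) \<partial>lborel)
          \<le> (\<integral>\<^sup>+x. ennreal (\<delta>\<^sup>2) * indicator (cball 0 R) x \<partial>(lborel :: (real^'d) measure))"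
        by (rule nn_integral_mono)
      also have "\<dots> = ennreal (\<delta>\<^sup>2 * V)"
        by (subst nn_integral_cmult_indicator) (auto simp: V ennreal_mult)
      finally show ?thesis
        using \<delta>(2) by (meson ennreal_leI less_imp_le order_trans)
    qed
    have quarter: "2 * ennreal (c / 4) + 2 * ennreal (c / 4) = ennreal c" if "0 < c" for c
      using that by (simp flip: ennreal_mult ennreal_plus ennreal_numeral)
    have 4: "(\<integral>\<^sup>+x. ennreal ((?i x * (g (x - z) - u (x - z)) + ?i x * (u x - g x))\<^sup>2) \<partial>lborel)
        \<le> ennreal (e / 4)" (is "?I4 \<le> _")
    proof -
      have "?I4 \<le> 2 * (\<integral>\<^sup>+x. ennreal ((?i x * (g (x - z) - u (x - z)))\<^sup>2) \<partial>lborel) +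
        2 * (\<integral>\<^sup>+x. ennreal ((?i x * (u x - g x))\<^sup>2) \<partial>lborel)"
        by (rule nn_integral_square_add_le[OF _ _ refl]) measurable
      also have "\<dots> \<le> 2 * ennreal (e / 4 / 4) + 2 * ennreal (e / 4 / 4)"
        using 1 2 by (intro add_mono mult_left_mono less_imp_le) auto
      finally show ?thesis
        using quarter[of "e / 4"] \<open>0 < e\<close> by simp
    qed
    have "(\<integral>\<^sup>+x. ennreal ((?i x * (g (x - z) - g x))\<^sup>2) \<partial>lborel) \<le>
       2 * ?I4 + 2 * (\<integral>\<^sup>+x. ennreal ((?i x * (u (x - z) - u x))\<^sup>2) \<partial>lborel)"
      by (rule nn_integral_square_add_le) (measurable, simp add: algebra_simps)
    also have "\<dots> \<le> 2 * ennreal (e / 4) + 2 * ennreal (e / 4)"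
      using 3 4 by (intro add_mono mult_left_mono) auto
    finally show "(\<integral>\<^sup>+x. ennreal ((?i x * (g (x - z) - g x))\<^sup>2) \<partial>lborel) \<le> ennreal e"
      using quarter[OF \<open>0 < e\<close>] by simp
  qed
qed

section \<open>Pairings with translates and with mollifications\<close>

lemma integrable_mult_L2:
  fixes f g :: "'a \<Rightarrow> real"
  assumes [measurable]: "f \<in> borel_measurable M" "g \<in> borel_measurable M"
    and "integrable M (\<lambda>x. (f x)\<^sup>2)" "integrable M (\<lambda>x. (g x)\<^sup>2)"
  shows "integrable M (\<lambda>x. f x * g x)"
proof (rule Bochner_Integration.integrable_bound)
  show "integrable M (\<lambda>x. (f x)\<^sup>2 + (g x)\<^sup>2)"
    using assms by simp
  have "\<bar>f x * g x\<bar> \<le> (f x)\<^sup>2 + (g x)\<^sup>2" for x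
    using sum_squares_bound[of "\<bar>f x\<bar>" "\<bar>g x\<bar>"] mult_nonneg_nonneg[of "\<bar>f x\<bar>" "\<bar>g x\<bar>"]
    unfolding abs_mult power2_abs by linarith
  then show "AE x in M. norm (f x * g x) \<le> norm ((f x)\<^sup>2 + (g x)\<^sup>2)"
    by simp
qed measurable

lemma integrable_L2_ball:
  fixes f :: "real^'d \<Rightarrow> real"
  assumes f: "f \<in> borel_measurable lebesgue" "integrable lebesgue (\<lambda>x. (f x)\<^sup>2)"
    and "\<And>x. R < norm x \<Longrightarrow> f x = 0"
  shows "integrable lebesgue f"
proof -
  have "cball (0::real^'d) R \<in> lmeasurable" by simp
  then have "integrable lebesgue (\<lambda>x. (indicator (cball (0::real^'d) R) x :: real)\<^sup>2)"
    by (simp add: fmeasurable_def less_top power2_eq_square indicator_inter_arith[symmetric])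
  from integrable_mult_L2[OF f(1) _ f(2) this]
  have "integrable lebesgue (\<lambda>x. f x * indicator (cball 0 R) x)"
    by (simp add: borel_measurable_indicator)
  moreover have "(\<lambda>x. f x * indicator (cball 0 R) x) = f"
    using assms(3) by (auto simp: fun_eq_iff indicator_def not_le)
  ultimately show ?thesis by simp
qed

text \<open>Since f lives on a ball, only the local continuity of translations of g enters. A
  weighted Young inequality plays the role of Cauchy-Schwarz.\<close>

lemma pairing_tendsto:
  fixes f g :: "real^'d \<Rightarrow> real"
  assumes [measurable]: "f \<in> borel_measurable borel" "g \<in> borel_measurable borel"
    and f2: "integrable lborel (\<lambda>x. (f x)\<^sup>2)" and g2: "integrable lborel (\<lambda>x. (g x)\<^sup>2)"
    and f0: "\<And>x. R < norm x \<Longrightarrow> f x = 0"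
  shows "((\<lambda>z. \<integral>x. f x * g (x - z) \<partial>lborel) \<longlongrightarrow> (\<integral>x. f x * g x \<partial>lborel)) (at 0)"
proof -
  have prod: "integrable lborel (\<lambda>x. f x * g (x - z))" for z
    using f2 integrable_lborel_shift[OF g2] by (intro integrable_mult_L2) auto
  define F where "F = (\<integral>x. (f x)\<^sup>2 \<partial>lborel)"
  have "0 \<le> F" by (simp add: F_def)
  have "\<exists>r>0. \<forall>z. z \<noteq> 0 \<and> dist z 0 < r \<longrightarrow>
      dist (\<integral>x. f x * g (x - z) \<partial>lborel) (\<integral>x. f x * g x \<partial>lborel) < e" if "0 < e" for e
  proof -
    \<comment> \<open>The weight makes \<kappa> F < e; with \<kappa> e as bound for the squared L^2
      error of the shift, the estimate becomes (\<kappa> F + e) / 2 < e.\<close>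
    define \<kappa> where "\<kappa> = e / (F + 1)"
    have \<kappa>: "0 < \<kappa>" "\<kappa> * F < e"
      using \<open>0 < e\<close> \<open>0 \<le> F\<close> by (auto simp: \<kappa>_def field_simps)
    have "(\<integral>\<^sup>+x. ennreal ((g x)\<^sup>2) \<partial>lborel) < \<infinity>"
      using g2 by (simp add: nn_integral_eq_integral)
    from L2_translation_continuous[OF assms(2) this mult_pos_pos[OF \<kappa>(1) \<open>0 < e\<close>], of R]
    obtain r where "0 < r" and r: "\<And>z. norm z < r \<Longrightarrow>
        (\<integral>\<^sup>+x. ennreal ((indicator (cball 0 R) x * (g (x - z) - g x))\<^sup>2) \<partial>lborel) \<le> ennreal (\<kappa> * e)"
      by blast
    have "\<bar>(\<integral>x. f x * g (x - z) \<partial>lborel) - (\<integral>x. f x * g x \<partial>lborel)\<bar> < e" if z: "norm z < r" for z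
    proof -
      define b where "b x = indicator (cball 0 R) x * (g (x - z) - g x)" for x
      have [measurable]: "b \<in> borel_measurable borel"
        unfolding b_def by measurable
      have "integrable lborel (\<lambda>x. (b x)\<^sup>2)" and B: "(\<integral>x. (b x)\<^sup>2 \<partial>lborel) \<le> \<kappa> * e"
        using r[OF z] \<kappa>(1) \<open>0 < e\<close> unfolding b_def[symmetric]
        by (auto intro!: integrableI_nonneg integral_real_bounded elim: le_less_trans)
      have "(\<integral>x. f x * g (x - z) \<partial>lborel) - (\<integral>x. f x * g x \<partial>lborel) = (\<integral>x. f x * g (x - z) - f x * g x \<partial>lborel)"
        using prod prod[of 0] by simp
      also have "\<dots> = (\<integral>x. f x * b x \<partial>lborel)"
        using f0 by (intro Bochner_Integration.integral_cong) (auto simp: b_def indicator_def algebra_simps not_le)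
      also have "\<bar>\<dots>\<bar> \<le> (\<integral>x. (\<kappa> * (f x)\<^sup>2 + (b x)\<^sup>2 / \<kappa>) / 2 \<partial>lborel)"
      proof (rule order_trans[OF integral_abs_bound], rule integral_mono)
        show "integrable lborel (\<lambda>x. \<bar>f x * b x\<bar>)"
          using f2 \<open>integrable lborel (\<lambda>x. (b x)\<^sup>2)\<close> by (intro integrable_abs integrable_mult_L2) auto
        show "integrable lborel (\<lambda>x. (\<kappa> * (f x)\<^sup>2 + (b x)\<^sup>2 / \<kappa>) / 2)"
          using f2 \<open>integrable lborel (\<lambda>x. (b x)\<^sup>2)\<close> by simp
        show "\<bar>f x * b x\<bar> \<le> (\<kappa> * (f x)\<^sup>2 + (b x)\<^sup>2 / \<kappa>) / 2" for x
        proof -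
          have "0 \<le> (\<kappa> * \<bar>f x\<bar> - \<bar>b x\<bar>)\<^sup>2" by simp
          then show ?thesis
            using \<kappa>(1) by (simp add: abs_mult power2_diff field_simps power2_eq_square)
        qed
      qed
      also have "\<dots> = (\<kappa> * F + (\<integral>x. (b x)\<^sup>2 \<partial>lborel) / \<kappa>) / 2"
        using f2 \<open>integrable lborel (\<lambda>x. (b x)\<^sup>2)\<close> by (simp add: F_def)
      also have "\<dots> \<le> (\<kappa> * F + \<kappa> * e / \<kappa>) / 2"
        using B \<kappa>(1) by (intro divide_right_mono add_mono) auto
      also have "\<dots> < e"
        using \<kappa> by simp
      finally show ?thesis .
    qed
    then show ?thesis
      using \<open>0 < r\<close> by (auto simp: dist_norm)
  qed
  then show ?thesis
    by (auto simp: tendsto_iff eventually_at)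
qed

lemma integrable_test_function:
  assumes "test_function \<rho>"
  shows "integrable lborel \<rho>"
proof -
  obtain C R where C: "\<And>x. \<bar>\<rho> x\<bar> \<le> C" and R: "\<And>x. R < norm x \<Longrightarrow> \<rho> x = 0"
    using test_function_bounded[OF assms] test_function_support[OF assms] by metis
  have "integrable lborel (indicator (cball (0::real^'a) R) :: _ \<Rightarrow> real)"
    using emeasure_lborel_cball_finite[of "0::real^'a" R] by (simp add: less_top)
  then have "integrable lborel (\<lambda>x. indicator (cball 0 R) x * \<rho> x)"
    using C borel_measurable_test_function[OF assms] by (intro integrable_mult_bounded) auto
  moreover have "(\<lambda>x. indicator (cball 0 R) x * \<rho> x) = \<rho>"
    using R by (auto simp: fun_eq_iff indicator_def not_le)
  ultimately show ?thesis by simp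
qed

text \<open>The substitution y = x - z followed by Fubini turns the pairing with a mollification
  into an average of pairings with translates. The bound C on the kernel and the L^1 norms of f and
  g dominate the double integral.\<close>

lemma mollify_pairing:
  fixes f g :: "real^'d \<Rightarrow> real"
  assumes f: "integrable lborel f" and g: "integrable lborel g" and \<rho>: "test_function \<rho>"
  shows "(\<integral>x. f x * (\<integral>y. g y * \<rho> (x - y) \<partial>lborel) \<partial>lborel) =
      (\<integral>z. \<rho> z * (\<integral>x. f x * g (x - z) \<partial>lborel) \<partial>lborel)"
    and "integrable lborel (\<lambda>z. \<rho> z * (\<integral>x. f x * g (x - z) \<partial>lborel))"
proof -
  have [measurable]: "f \<in> borel_measurable borel" "g \<in> borel_measurable borel" "\<rho> \<in> borel_measurable borel"
    using f g borel_measurable_test_function[OF \<rho>] by auto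
  obtain C where C: "0 < C" "\<And>x. \<bar>\<rho> x\<bar> \<le> C"
    using test_function_bounded[OF \<rho>] by metis
  have inner: "integrable lborel (\<lambda>z. g (x - z) * \<rho> z)" for x
    using C(2) by (intro integrable_mult_bounded integrable_lborel_reflect g) auto
  have int: "integrable (lborel \<Otimes>\<^sub>M lborel) (\<lambda>(x, z). f x * (g (x - z) * \<rho> z))"
  proof (rule lborel_pair.Fubini_integrable)
    show "integrable lborel (\<lambda>x. \<integral>z. norm (case (x, z) of (x, z) \<Rightarrow> f x * (g (x - z) * \<rho> z)) \<partial>lborel)"
    proof (rule Bochner_Integration.integrable_bound)
      show "integrable lborel (\<lambda>x. f x * (C * (\<integral>y. \<bar>g y\<bar> \<partial>lborel)))"
        using f by simp
      have "(\<integral>z. \<bar>g (x - z) * \<rho> z\<bar> \<partial>lborel) \<le> C * (\<integral>y. \<bar>g y\<bar> \<partial>lborel)" for x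
      proof -
        have "(\<integral>z. \<bar>g (x - z) * \<rho> z\<bar> \<partial>lborel) \<le> (\<integral>z. C * \<bar>g (x - z)\<bar> \<partial>lborel)"
        proof (rule integral_mono)
          show "integrable lborel (\<lambda>z. C * \<bar>g (x - z)\<bar>)"
            using integrable_lborel_reflect[OF g] by simp
          show "\<bar>g (x - z) * \<rho> z\<bar> \<le> C * \<bar>g (x - z)\<bar>" for z
            using mult_left_mono[OF C(2)[of z], of "\<bar>g (x - z)\<bar>"] by (simp add: abs_mult mult.commute)
        qed (use inner in auto)
        also have "\<dots> = C * (\<integral>y. \<bar>g y\<bar> \<partial>lborel)"
          using integral_lborel_reflect[of "\<lambda>y. \<bar>g y\<bar>" x] by simp
        finally show ?thesis .
      qed
      then show "AE x in lborel. norm (\<integral>z. norm (case (x, z) of (x, z) \<Rightarrow> f x * (g (x - z) * \<rho> z)) \<partial>lborel)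
          \<le> norm (f x * (C * (\<integral>y. \<bar>g y\<bar> \<partial>lborel)))"
        using C(1) by (auto simp: abs_mult mult_left_mono)
    qed measurable
  qed (use inner in auto)
  have pull: "(\<integral>x. f x * (g (x - z) * \<rho> z) \<partial>lborel) = \<rho> z * (\<integral>x. f x * g (x - z) \<partial>lborel)" for z
    by (subst integral_mult_right_zero[symmetric]) (simp add: mult_ac)
  have "(\<integral>y. g y * \<rho> (x - y) \<partial>lborel) = (\<integral>z. g (x - z) * \<rho> z \<partial>lborel)" for x
    using integral_lborel_reflect[of "\<lambda>y. g y * \<rho> (x - y)" x] by simp
  then have "(\<integral>x. f x * (\<integral>y. g y * \<rho> (x - y) \<partial>lborel) \<partial>lborel) =
      (\<integral>x. (\<integral>z. f x * (g (x - z) * \<rho> z) \<partial>lborel) \<partial>lborel)"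
    by simp
  also have "\<dots> = (\<integral>z. (\<integral>x. f x * (g (x - z) * \<rho> z) \<partial>lborel) \<partial>lborel)"
    by (rule lborel_pair.Fubini_integral[symmetric]) (use int in simp)
  also have "\<dots> = (\<integral>z. \<rho> z * (\<integral>x. f x * g (x - z) \<partial>lborel) \<partial>lborel)"
    by (simp add: pull)
  finally show "(\<integral>x. f x * (\<integral>y. g y * \<rho> (x - y) \<partial>lborel) \<partial>lborel) =
      (\<integral>z. \<rho> z * (\<integral>x. f x * g (x - z) \<partial>lborel) \<partial>lborel)" .
  have "integrable lborel (\<lambda>z. \<integral>x. f x * (g (x - z) * \<rho> z) \<partial>lborel)"
    using lborel_pair.integrable_snd[OF int] by simp
  then show "integrable lborel (\<lambda>z. \<rho> z * (\<integral>x. f x * g (x - z) \<partial>lborel))"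
    by (simp add: pull)
qed

text \<open>
  Fubini's theorem for \<open>f x * g (x - z)\<close> needs a Borel \<open>g\<close>: for a merely Lebesgue measurable \<open>g\<close>
  this function of \<open>(x, z)\<close> need not be measurable for the product of the Lebesgue \<open>\<sigma>\<close>-algebras.
\<close>

lemma lebesgue_borel_representative:
  fixes f :: "real^'d \<Rightarrow> real"
  assumes "f \<in> borel_measurable lebesgue" and "\<And>x. R < norm x \<Longrightarrow> f x = 0"
  obtains f' where "f' \<in> borel_measurable borel" "AE x in lebesgue. f x = f' x" "\<And>x. R < norm x \<Longrightarrow> f' x = 0"
proof -
  obtain h where [measurable]: "h \<in> borel_measurable borel" and h: "AE x in lborel. f x = h x"
    using completion_ex_borel_measurable_real[OF assms(1)] by auto
  show thesis
  proof (rule that[of "\<lambda>x. indicator (cball 0 R) x * h x"])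
    show "AE x in lebesgue. f x = indicator (cball 0 R) x * h x"
      using AE_completion[OF h] assms(2) by (auto elim!: eventually_mono simp: indicator_def)
  qed auto
qed

lemma integral_lebesgue_representative:
  fixes f h :: "real^'d \<Rightarrow> real"
  assumes "AE x in lebesgue. f x = h x" "f \<in> borel_measurable lebesgue" "h \<in> borel_measurable borel"
  shows "(\<integral>x. f x \<partial>lebesgue) = (\<integral>x. h x \<partial>lborel)"
proof -
  have "(\<integral>x. f x \<partial>lebesgue) = (\<integral>x. h x \<partial>lebesgue)"
    by (rule integral_cong_AE[OF assms(2) _ assms(1)]) (rule measurable_completion, simp add: assms(3))
  also have "\<dots> = (\<integral>x. h x \<partial>lborel)"
    using assms(3) by (intro integral_completion) simp
  finally show ?thesis .
qed

text \<open>Let \<Phi>(z) be the sum over k of the pairings of f k with g k shifted by z. The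
  hypothesis says that \<Phi> integrates to 0 against every kernel supported in the unit ball; as
  \<Phi> is continuous at 0, concentrating kernels give \<Phi>(0) = 0. The sum over k stays
  together, since in the application only the full inner product vanishes, not its
  components.\<close>

lemma orthogonal_of_mollify:
  fixes f g :: "'k::finite \<Rightarrow> real^'d \<Rightarrow> real"
  assumes fm: "\<And>k. f k \<in> borel_measurable lebesgue" and gm: "\<And>k. g k \<in> borel_measurable lebesgue"
    and f2: "\<And>k. integrable lebesgue (\<lambda>x. (f k x)\<^sup>2)" and g2: "\<And>k. integrable lebesgue (\<lambda>x. (g k x)\<^sup>2)"
    and f0: "\<And>k x. R < norm x \<Longrightarrow> f k x = 0" and g0: "\<And>k x. R < norm x \<Longrightarrow> g k x = 0"
    and conv: "\<And>\<rho>. test_function \<rho> \<Longrightarrow> (\<And>x. 1 < norm x \<Longrightarrow> \<rho> x = 0) \<Longrightarrow>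
      (\<Sum>k\<in>UNIV. \<integral>x. f k x * mollify (g k) \<rho> x \<partial>lebesgue) = 0"
  shows "(\<Sum>k\<in>UNIV. \<integral>x. f k x * g k x \<partial>lebesgue) = 0"
proof -
  have "\<exists>f'. f' \<in> borel_measurable borel \<and> (AE x in lebesgue. f k x = f' x) \<and> (\<forall>x. R < norm x \<longrightarrow> f' x = 0)" for k
    using lebesgue_borel_representative[OF fm[of k] f0] by blast
  then obtain F where F[measurable]: "\<And>k. F k \<in> borel_measurable borel"
    and F_AE: "\<And>k. AE x in lebesgue. f k x = F k x" and F0: "\<And>k x. R < norm x \<Longrightarrow> F k x = 0"
    by metis
  have "\<exists>g'. g' \<in> borel_measurable borel \<and> (AE x in lebesgue. g k x = g' x) \<and> (\<forall>x. R < norm x \<longrightarrow> g' x = 0)" for k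
    using lebesgue_borel_representative[OF gm[of k] g0] by blast
  then obtain H where H[measurable]: "\<And>k. H k \<in> borel_measurable borel"
    and H_AE: "\<And>k. AE x in lebesgue. g k x = H k x" and H0: "\<And>k x. R < norm x \<Longrightarrow> H k x = 0"
    by metis
  have rep: "integrable lborel h" if "integrable lebesgue h'" "AE x in lebesgue. h' x = h x" "h \<in> borel_measurable borel"
    for h h' :: "real^'d \<Rightarrow> real"
  proof -
    have "integrable lebesgue h"
      using that by (subst integrable_cong_AE[symmetric, OF _ _ that(2)]) (auto intro!: measurable_completion)
    then show ?thesis
      using that(3) by (subst (asm) integrable_completion) auto
  qed
  have F2: "integrable lborel (\<lambda>x. (F k x)\<^sup>2)" for k
    by (rule rep[OF f2[of k]]) (use F_AE[of k] in \<open>auto elim!: eventually_mono\<close>)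
  have H2: "integrable lborel (\<lambda>x. (H k x)\<^sup>2)" for k
    by (rule rep[OF g2[of k]]) (use H_AE[of k] in \<open>auto elim!: eventually_mono\<close>)
  have F1: "integrable lborel (F k)" for k
    by (rule rep[OF integrable_L2_ball[OF fm f2 f0] F_AE F])
  have H1: "integrable lborel (H k)" for k
    by (rule rep[OF integrable_L2_ball[OF gm g2 g0] H_AE H])
  define \<Phi> where "\<Phi> z = (\<Sum>k\<in>UNIV. \<integral>x. F k x * H k (x - z) \<partial>lborel)" for z
  have \<Phi>0: "(\<Sum>k\<in>UNIV. \<integral>x. f k x * g k x \<partial>lebesgue) = \<Phi> 0"
  proof -
    have "(\<integral>x. f k x * g k x \<partial>lebesgue) = (\<integral>x. F k x * H k (x - 0) \<partial>lborel)" for k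
    proof (rule integral_lebesgue_representative)
      show "AE x in lebesgue. f k x * g k x = F k x * H k (x - 0)"
        using F_AE[of k] H_AE[of k] by eventually_elim simp
    qed (use fm gm in auto)
    then show ?thesis
      by (simp add: \<Phi>_def)
  qed
  have pairing: "(\<integral>z. \<rho> z * \<Phi> z \<partial>lborel) = 0" "integrable lborel (\<lambda>z. \<rho> z * \<Phi> z)"
    if \<rho>: "test_function \<rho>" "\<And>x. 1 < norm x \<Longrightarrow> \<rho> x = 0" for \<rho>
  proof -
    note [measurable] = borel_measurable_test_function[OF \<rho>(1)]
    note cp = mollify_pairing[OF F1 H1 \<rho>(1)]
    have "(\<integral>x. f k x * mollify (g k) \<rho> x \<partial>lebesgue) =
        (\<integral>x. F k x * (\<integral>y. H k y * \<rho> (x - y) \<partial>lborel) \<partial>lborel)" for k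
    proof (rule integral_lebesgue_representative)
      have \<rho>x: "(\<lambda>y. \<rho> (x - y)) \<in> borel_measurable lebesgue" for x
        by (rule measurable_completion) simp
      have "mollify (g k) \<rho> x = (\<integral>y. H k y * \<rho> (x - y) \<partial>lborel)" for x
        unfolding mollify_def
      proof (rule integral_lebesgue_representative)
        show "AE y in lebesgue. g k y * \<rho> (x - y) = H k y * \<rho> (x - y)"
          using H_AE[of k] by eventually_elim simp
      qed (use gm \<rho>x in auto)
      then show "AE x in lebesgue. f k x * mollify (g k) \<rho> x = F k x * (\<integral>y. H k y * \<rho> (x - y) \<partial>lborel)"
        using F_AE[of k] by (auto elim!: eventually_mono)
      have "test_function (mollify (g k) \<rho>)"
        by (rule test_function_mollify[OF integrable_L2_ball[OF gm g2 g0] g0 \<rho>(1)])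
      then have "mollify (g k) \<rho> \<in> borel_measurable lebesgue"
        by (intro measurable_completion) (simp add: borel_measurable_test_function)
      then show "(\<lambda>x. f k x * mollify (g k) \<rho> x) \<in> borel_measurable lebesgue"
        using fm[of k] by measurable
    qed measurable
    then have "0 = (\<Sum>k\<in>UNIV. \<integral>z. \<rho> z * (\<integral>x. F k x * H k (x - z) \<partial>lborel) \<partial>lborel)"
      using conv[OF \<rho>] cp(1) by simp
    also have "\<dots> = (\<integral>z. (\<Sum>k\<in>UNIV. \<rho> z * (\<integral>x. F k x * H k (x - z) \<partial>lborel)) \<partial>lborel)"
      using cp(2) by (intro Bochner_Integration.integral_sum[symmetric])
    finally show "(\<integral>z. \<rho> z * \<Phi> z \<partial>lborel) = 0"
      by (simp add: \<Phi>_def sum_distrib_left)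
    have "integrable lborel (\<lambda>z. \<Sum>k\<in>UNIV. \<rho> z * (\<integral>x. F k x * H k (x - z) \<partial>lborel))"
      using cp(2) by (intro Bochner_Integration.integrable_sum)
    then show "integrable lborel (\<lambda>z. \<rho> z * \<Phi> z)"
      by (simp add: \<Phi>_def sum_distrib_left)
  qed
  have lim: "(\<Phi> \<longlongrightarrow> \<Phi> 0) (at 0)"
  proof -
    have "((\<lambda>z. \<Sum>k\<in>UNIV. \<integral>x. F k x * H k (x - z) \<partial>lborel) \<longlongrightarrow>
        (\<Sum>k\<in>UNIV. \<integral>x. F k x * H k x \<partial>lborel)) (at 0)"
      by (intro tendsto_sum pairing_tendsto[where R=R] F H F2 H2 F0)
    then show ?thesis
      by (simp add: \<Phi>_def[abs_def])
  qed
  have "\<bar>\<Phi> 0\<bar> \<le> e" if "0 < e" for e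
  proof -
    obtain r where "0 < r" and r: "\<And>z. z \<noteq> 0 \<Longrightarrow> norm z < r \<Longrightarrow> \<bar>\<Phi> z - \<Phi> 0\<bar> < e"
      using lim \<open>0 < e\<close> unfolding tendsto_iff eventually_at by (auto simp: dist_norm)
    define s where "s = min r 1"
    have s: "0 < s" "s \<le> 1" "s \<le> r"
      using \<open>0 < r\<close> by (auto simp: s_def)
    \<comment> \<open>The bump shrunk to radius s, within which \<Phi> is e-close to \<Phi>(0); s
      \<le> 1 makes it a kernel allowed in \<open>conv\<close>. The summand 0 matches the form of
      \<open>test_function_affine\<close>.\<close>
    define \<rho> :: "real^'d \<Rightarrow> real" where "\<rho> x = bump (0 + (1 / s) *\<^sub>R x)" for x
    have \<rho>: "test_function \<rho>"
      unfolding \<rho>_def[abs_def] using s by (intro test_function_affine test_function_bump) simp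
    have \<rho>0: "\<rho> x = 0" if "s \<le> norm x" for x
      unfolding \<rho>_def using that s by (intro bump_eq_0) (simp add: divide_simps)
    have "0 \<le> \<rho> x" for x
      by (simp add: \<rho>_def bump_nonneg)
    note int = integrable_test_function[OF \<rho>] pairing(2)[OF \<rho>]
    have [simp]: "\<rho> x = 0" if "1 < norm x" for x
      using that s by (intro \<rho>0) simp
    define I where "I = (\<integral>x. \<rho> x \<partial>lborel)"
    \<comment> \<open>The kernel is not normalized, so its mass has to be positive before it can be
      divided out; the lower bound of the bump on the half ball gives this.\<close>
    have "0 < I"
    proof -
      let ?B = "ball (0::real^'d) (s / 2)"
      have "exp (- 2) * measure lborel ?B = (\<integral>x. exp (- 2) * indicator ?B x \<partial>lborel)"
        by simp
      also have "\<dots> \<le> I"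
        unfolding I_def
      proof (rule integral_mono)
        show "integrable lborel (\<lambda>x. exp (- 2) * indicat_real ?B x)"
          using emeasure_lborel_ball_finite[of "0::real^'d" "s / 2"] by (simp add: less_top)
        have "exp (- 2) \<le> \<rho> x" if "x \<in> ?B" for x
          unfolding \<rho>_def using that s by (intro bump_ge) (simp add: field_simps)
        then show "exp (- 2) * indicat_real ?B x \<le> \<rho> x" for x
          using \<open>0 \<le> \<rho> x\<close> by (simp add: indicator_def)
      qed (rule int(1))
      finally have "exp (- 2) * measure lborel ?B \<le> I" .
      moreover have "0 < measure lborel ?B"
        using content_ball_pos[of "s / 2" "0::real^'d"] s by simp
      ultimately show ?thesis
        by (smt (verit) exp_gt_zero mult_pos_pos)
    qed
    \<comment> \<open>The second integral is zero by \<open>pairing\<close>; subtracting it leaves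
      the deviation of \<Phi> from its value at 0, weighted by the kernel.\<close>
    have "\<Phi> 0 * I = (\<integral>x. \<rho> x * \<Phi> 0 \<partial>lborel) - (\<integral>x. \<rho> x * \<Phi> x \<partial>lborel)"
      using pairing(1)[OF \<rho>] by (simp add: I_def)
    also have "\<dots> = (\<integral>x. \<rho> x * \<Phi> 0 - \<rho> x * \<Phi> x \<partial>lborel)"
      using int by simp
    also have "\<bar>\<dots>\<bar> \<le> (\<integral>x. \<rho> x * e \<partial>lborel)"
    proof (rule order_trans[OF integral_abs_bound], rule integral_mono)
      show "integrable lborel (\<lambda>x. \<bar>\<rho> x * \<Phi> 0 - \<rho> x * \<Phi> x\<bar>)"
        using int by (intro integrable_abs Bochner_Integration.integrable_diff) simp_all
      show "\<bar>\<rho> x * \<Phi> 0 - \<rho> x * \<Phi> x\<bar> \<le> \<rho> x * e" for x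
      proof (cases "norm x < s")
        case True
        then have "\<bar>\<Phi> 0 - \<Phi> x\<bar> \<le> e"
          using r[of x] s \<open>0 < e\<close> by (cases "x = 0") auto
        then have "\<rho> x * \<bar>\<Phi> 0 - \<Phi> x\<bar> \<le> \<rho> x * e"
          using \<open>0 \<le> \<rho> x\<close> by (rule mult_left_mono)
        then show ?thesis
          using \<open>0 \<le> \<rho> x\<close> by (simp add: abs_mult flip: right_diff_distrib)
      qed (simp add: \<rho>0)
    qed (use int in simp)
    finally have "\<bar>\<Phi> 0\<bar> * I \<le> e * I"
      using \<open>0 < I\<close> by (simp add: I_def abs_mult mult.commute)
    then show ?thesis
      using \<open>0 < I\<close> by simp
  qed
  then have "\<Phi> 0 = 0"
    by (metis abs_le_zero_iff field_le_epsilon add_0)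
  then show ?thesis
    using \<Phi>0 by simp
qed

section \<open>Locally square-integrable fields and the Caccioppoli inequality\<close>

lemma L2_loc_bounded_weight:
  assumes f: "L2_loc f" and b: "b \<in> borel_measurable borel" "\<And>x. \<bar>b x\<bar> \<le> C" "\<And>x. R < norm x \<Longrightarrow> b x = 0"
  shows "integrable lebesgue (\<lambda>x. b x * (norm (f x))\<^sup>2)"
proof -
  have "integrable lebesgue (\<lambda>x. indicator (cball 0 R) x * (norm (f x))\<^sup>2)"
    using f by (auto simp: L2_loc_def set_integrable_def)
  moreover have "b \<in> borel_measurable lebesgue"
    using b(1) by (intro measurable_completion) simp
  ultimately have "integrable lebesgue (\<lambda>x. indicator (cball 0 R) x * (norm (f x))\<^sup>2 * b x)"
    using b(2) by (rule integrable_mult_bounded)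
  moreover have "(\<lambda>x. indicator (cball 0 R) x * (norm (f x))\<^sup>2 * b x) = (\<lambda>x. b x * (norm (f x))\<^sup>2)"
    using b(3) by (auto simp: fun_eq_iff indicator_def not_le)
  ultimately show ?thesis by simp
qed

lemma L2_loc_I:
  fixes f :: "real^'d \<Rightarrow> 'b::euclidean_space"
  assumes "f \<in> borel_measurable lebesgue"
    and "\<And>R. integrable lebesgue (\<lambda>x. indicator (cball 0 R) x * (norm (f x))\<^sup>2)"
  shows "L2_loc f"
  unfolding L2_loc_def
proof (intro conjI allI impI assms(1))
  fix C :: "(real^'d) set" assume C: "compact C"
  then obtain R where "C \<subseteq> cball 0 R"
    using compact_imp_bounded[OF C] unfolding bounded_iff by (auto simp: subset_iff)
  moreover have "set_integrable lebesgue (cball 0 R) (\<lambda>x. (norm (f x))\<^sup>2)"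
    using assms(2) by (simp add: set_integrable_def)
  moreover have "C \<in> sets lebesgue"
    using C by (simp add: compact_imp_closed)
  ultimately show "set_integrable lebesgue C (\<lambda>x. (norm (f x))\<^sup>2)"
    using set_integrable_subset by blast
qed

lemma L2_loc_bound:
  fixes f :: "real^'d \<Rightarrow> 'b::euclidean_space" and h :: "real^'d \<Rightarrow> 'c::euclidean_space"
  assumes h: "L2_loc h" and f: "f \<in> borel_measurable lebesgue"
    and "0 \<le> C" "AE x in lebesgue. norm (f x) \<le> C * norm (h x)"
  shows "L2_loc f"
proof (rule L2_loc_I[OF f])
  fix R
  show "integrable lebesgue (\<lambda>x. indicator (cball 0 R) x * (norm (f x))\<^sup>2)"
  proof (rule Bochner_Integration.integrable_bound)
    show "integrable lebesgue (\<lambda>x. C\<^sup>2 * (indicator (cball 0 R) x * (norm (h x))\<^sup>2))"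
      using h by (auto simp: L2_loc_def set_integrable_def)
    show "(\<lambda>x. indicator (cball 0 R) x * (norm (f x))\<^sup>2) \<in> borel_measurable lebesgue"
      using f by (intro borel_measurable_times borel_measurable_indicator borel_measurable_power) auto
    show "AE x in lebesgue. norm (indicator (cball 0 R) x * (norm (f x))\<^sup>2)
        \<le> norm (C\<^sup>2 * (indicator (cball 0 R) x * (norm (h x))\<^sup>2))"
      using assms(4)
    proof eventually_elim
      case (elim x)
      then show ?case
        using power_mono[OF elim norm_ge_zero, of 2] by (simp add: power_mult_distrib indicator_def)
    qed
  qed
qed

lemma L2_loc_add:
  fixes f h :: "real^'d \<Rightarrow> 'b::euclidean_space"
  assumes f: "L2_loc f" and h: "L2_loc h"
  shows "L2_loc (\<lambda>x. f x + h x)"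
proof (rule L2_loc_I)
  have [measurable]: "f \<in> borel_measurable lebesgue" "h \<in> borel_measurable lebesgue"
    using f h by (auto simp: L2_loc_def)
  show "(\<lambda>x. f x + h x) \<in> borel_measurable lebesgue" by measurable
  fix R
  show "integrable lebesgue (\<lambda>x. indicator (cball 0 R) x * (norm (f x + h x))\<^sup>2)"
  proof (rule Bochner_Integration.integrable_bound)
    show "integrable lebesgue (\<lambda>x. 2 * (indicator (cball 0 R) x * (norm (f x))\<^sup>2) +
        2 * (indicator (cball 0 R) x * (norm (h x))\<^sup>2))"
      using f h by (auto simp: L2_loc_def set_integrable_def)
    show "(\<lambda>x. indicator (cball 0 R) x * (norm (f x + h x))\<^sup>2) \<in> borel_measurable lebesgue"
      by (intro borel_measurable_times borel_measurable_indicator borel_measurable_power) auto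
    have "(norm (f x + h x))\<^sup>2 \<le> 2 * (norm (f x))\<^sup>2 + 2 * (norm (h x))\<^sup>2" for x
      by (rule order_trans[OF power_mono[OF norm_triangle_ineq norm_ge_zero] square_add_le])
    then show "AE x in lebesgue. norm (indicator (cball 0 R) x * (norm (f x + h x))\<^sup>2) \<le>
        norm (2 * (indicator (cball 0 R) x * (norm (f x))\<^sup>2) + 2 * (indicator (cball 0 R) x * (norm (h x))\<^sup>2))"
      by (intro AE_I2) (simp add: indicator_def)
  qed
qed

lemma L2_loc_const: "L2_loc (\<lambda>x::real^'d. c::'b::euclidean_space)"
proof (rule L2_loc_I)
  fix R
  have "cball (0::real^'d) R \<in> lmeasurable" by simp
  then show "integrable lebesgue (\<lambda>x::real^'d. indicator (cball 0 R) x * (norm c)\<^sup>2)"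
    by (intro integrable_mult_left) (simp add: fmeasurable_def less_top)
qed simp

lemma L2_loc_uminus: "L2_loc f \<Longrightarrow> L2_loc (\<lambda>x. - f x)"
  by (rule L2_loc_bound[where C=1]) (auto simp: L2_loc_def)

lemma L2_loc_diff: "L2_loc f \<Longrightarrow> L2_loc h \<Longrightarrow> L2_loc (\<lambda>x. f x - h x)"
  using L2_loc_add[of f "\<lambda>x. - h x"] L2_loc_uminus[of h] by simp

lemma L2_loc_nth:
  fixes f :: "real^'d \<Rightarrow> real^'n"
  assumes "L2_loc f"
  shows "L2_loc (\<lambda>x. f x $ k)"
proof (rule L2_loc_bound[OF assms, where C=1])
  show "(\<lambda>x. f x $ k) \<in> borel_measurable lebesgue"
    using assms unfolding L2_loc_def
    by (intro borel_measurable_continuous_on[where f="\<lambda>v. v $ k"] continuous_intros) auto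
qed (use component_le_norm_cart in auto)

lemma integrable_L2_loc_test:
  fixes u :: "real^'d \<Rightarrow> real"
  assumes u: "L2_loc u" and \<eta>: "test_function \<eta>"
  shows "integrable lebesgue (\<lambda>x. u x * \<eta> x)" "integrable lebesgue (\<lambda>x. (u x * \<eta> x)\<^sup>2)"
proof -
  obtain C R where C: "\<And>x. \<bar>\<eta> x\<bar> \<le> C" and R: "\<And>x. R < norm x \<Longrightarrow> \<eta> x = 0"
    using test_function_bounded[OF \<eta>] test_function_support[OF \<eta>] by metis
  have m: "\<eta> \<in> borel_measurable lebesgue" "u \<in> borel_measurable lebesgue"
    using u by (auto simp: L2_loc_def intro!: measurable_completion borel_measurable_test_function[OF \<eta>])
  have "integrable lebesgue (\<lambda>x. (\<eta> x)\<^sup>2 * (norm (u x))\<^sup>2)"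
  proof (rule L2_loc_bounded_weight[OF u])
    show "\<bar>(\<eta> x)\<^sup>2\<bar> \<le> C\<^sup>2" for x
      using power_mono[OF C abs_ge_zero, of x 2] by simp
  qed (use R borel_measurable_test_function[OF \<eta>] in auto)
  then show 2: "integrable lebesgue (\<lambda>x. (u x * \<eta> x)\<^sup>2)"
    by (simp add: power_mult_distrib mult.commute)
  show "integrable lebesgue (\<lambda>x. u x * \<eta> x)"
    by (rule integrable_L2_ball[OF _ 2]) (use m R in auto)
qed

section \<open>Enlarging the class of test functions from smooth to weakly differentiable\<close>

text \<open>The mollification of w is a smooth test function whose gradient is the mollification of
  G, because derivatives on the kernel pass to G. So v is orthogonal to every mollified G, and
  \<open>orthogonal_of_mollify\<close> removes the mollification.\<close>

lemma weak_grad_orthogonal: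
  fixes v G :: "real^'d \<Rightarrow> real^'d"
  assumes w: "integrable lebesgue w" "\<And>x. R < norm x \<Longrightarrow> w x = 0"
    and G: "\<And>k. (\<lambda>x. G x $ k) \<in> borel_measurable lebesgue" "\<And>k. integrable lebesgue (\<lambda>x. (G x $ k)\<^sup>2)"
      "\<And>x. R < norm x \<Longrightarrow> G x = 0"
    and weak: "\<And>\<zeta> k. test_function \<zeta> \<Longrightarrow>
      (\<integral>x. w x * partial_deriv k \<zeta> x \<partial>lebesgue) = - (\<integral>x. G x $ k * \<zeta> x \<partial>lebesgue)"
    and v: "L2_loc v" "weakly_div_free v"
  shows "(\<integral>x. G x \<bullet> v x \<partial>lebesgue) = 0" "integrable lebesgue (\<lambda>x. G x \<bullet> v x)"
proof -
  \<comment> \<open>The flux is only locally square-integrable and must be cut off. Kernels of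
    radius 1 enlarge the support of G to the ball of radius R + 1 at most, so the cut-off changes
    none of the pairings.\<close>
  define f where "f k x = indicator (cball 0 (R + 1)) x * v x $ k" for k x
  have vk: "(\<lambda>x. v x $ k) \<in> borel_measurable lebesgue" for k
    using L2_loc_nth[OF v(1), of k] by (simp add: L2_loc_def)
  have fm: "f k \<in> borel_measurable lebesgue" for k
    unfolding f_def[abs_def] by (intro borel_measurable_times borel_measurable_indicator vk) simp
  have "integrable lebesgue (\<lambda>x. indicator (cball 0 (R + 1)) x * (norm (v x $ k))\<^sup>2)" for k
    using L2_loc_nth[OF v(1), of k] by (auto simp: L2_loc_def set_integrable_def)
  moreover have "(\<lambda>x. indicator (cball 0 (R + 1)) x * (norm (v x $ k))\<^sup>2) = (\<lambda>x. (f k x)\<^sup>2)" for k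
    by (auto simp: f_def fun_eq_iff indicator_def)
  ultimately have f2: "integrable lebesgue (\<lambda>x. (f k x)\<^sup>2)" for k
    by metis
  have f0: "f k x = 0" if "R + 1 < norm x" for k x
    using that by (simp add: f_def)
  have fG: "f k x * G x $ k = G x $ k * v x $ k" for k x
    using G(3)[of x] by (cases "R < norm x") (auto simp: f_def indicator_def)
  have "(\<Sum>k\<in>UNIV. \<integral>x. f k x * G x $ k \<partial>lebesgue) = 0"
  proof (rule orthogonal_of_mollify[OF fm G(1) f2 G(2) f0, where R="R + 1"])
    show "G x $ k = 0" if "R + 1 < norm x" for k x
      using G(3)[of x] that by simp
    fix \<rho> :: "real^'d \<Rightarrow> real" assume \<rho>: "test_function \<rho>" "\<And>x. 1 < norm x \<Longrightarrow> \<rho> x = 0"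
    have conv: "test_function (mollify w \<rho>)"
      by (rule test_function_mollify[OF w \<rho>(1)])
    have pd: "partial_deriv k (mollify w \<rho>) = mollify (\<lambda>x. G x $ k) \<rho>" for k
      using partial_deriv_mollify[OF w(1) \<rho>(1)] mollify_weak_deriv[OF \<rho>(1) weak] by simp
    have conv0: "mollify (\<lambda>x. G x $ k) \<rho> x = 0" if "R + 1 < norm x" for k x
      using mollify_eq_0[of R "\<lambda>x. G x $ k" 1 \<rho> x] G(3) \<rho>(2) that by simp
    have "integrable lebesgue (\<lambda>x. f k x * mollify (\<lambda>x. G x $ k) \<rho> x)" for k
    proof -
      have t: "test_function (mollify (\<lambda>x. G x $ k) \<rho>)"
        using test_function_partial_deriv[OF conv, of k] by (simp add: pd)
      then obtain C where "\<And>x. \<bar>mollify (\<lambda>x. G x $ k) \<rho> x\<bar> \<le> C"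
        using test_function_bounded by metis
      then show ?thesis
        by (intro integrable_mult_bounded integrable_L2_ball[OF fm f2 f0])
           (auto intro!: measurable_completion borel_measurable_test_function[OF t])
    qed
    then have "(\<Sum>k\<in>UNIV. \<integral>x. f k x * mollify (\<lambda>x. G x $ k) \<rho> x \<partial>lebesgue) =
        (\<integral>x. (\<Sum>k\<in>UNIV. f k x * mollify (\<lambda>x. G x $ k) \<rho> x) \<partial>lebesgue)"
      by (intro Bochner_Integration.integral_sum[symmetric])
    also have "\<dots> = (\<integral>x. grad (mollify w \<rho>) x \<bullet> v x \<partial>lebesgue)"
    proof (rule Bochner_Integration.integral_cong[OF refl])
      fix x
      have "f k x * mollify (\<lambda>x. G x $ k) \<rho> x = mollify (\<lambda>x. G x $ k) \<rho> x * v x $ k" for k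
        using conv0[of x k] by (auto simp: f_def indicator_def not_le)
      then show "(\<Sum>k\<in>UNIV. f k x * mollify (\<lambda>x. G x $ k) \<rho> x) = grad (mollify w \<rho>) x \<bullet> v x"
        by (simp only: inner_vec_def grad_def pd) simp
    qed
    also have "\<dots> = 0"
      using v(2) conv by (simp add: weakly_div_free_def)
    finally show "(\<Sum>k\<in>UNIV. \<integral>x. f k x * mollify (\<lambda>x. G x $ k) \<rho> x \<partial>lebesgue) = 0" .
  qed
  moreover have int: "integrable lebesgue (\<lambda>x. G x $ k * v x $ k)" for k
    using integrable_mult_L2[OF fm G(1) f2 G(2), of k k] by (simp add: fG)
  ultimately show "(\<integral>x. G x \<bullet> v x \<partial>lebesgue) = 0"
    by (simp add: fG inner_vec_def Bochner_Integration.integral_sum)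
  show "integrable lebesgue (\<lambda>x. G x \<bullet> v x)"
    using int by (simp add: inner_vec_def)
qed

text \<open>By translation invariance a difference of \<eta> along a coordinate direction integrates
  to zero. The Taylor remainder is of order t^2 on a fixed ball, so dividing by t and letting t tend
  to 0 gives the claim. It expresses that constants have weak gradient zero, which permits
  subtracting averages from the correctors.\<close>

lemma integral_partial_deriv_test:
  fixes \<eta> :: "real^'d \<Rightarrow> real"
  assumes \<eta>: "test_function \<eta>"
  shows "(\<integral>x. partial_deriv k \<eta> x \<partial>lebesgue) = 0"
proof -
  note \<eta>' = test_function_partial_deriv[OF \<eta>, of k]
  obtain C where C: "0 < C" "\<And>x h. \<bar>\<eta> (x + h) - \<eta> x - grad \<eta> x \<bullet> h\<bar> \<le> C * (norm h)\<^sup>2"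
    using test_function_taylor[OF \<eta>] by metis
  obtain R where R: "\<And>x. R < norm x \<Longrightarrow> \<eta> x = 0" "\<And>x k. R < norm x \<Longrightarrow> partial_deriv k \<eta> x = 0"
    using test_function_support[OF \<eta>] by metis
  define J where "J = (\<integral>x. partial_deriv k \<eta> x \<partial>lborel)"
  \<comment> \<open>Shifts have length t \<le> 1, so outside the ball of radius R + 1 both \<eta>
    and its translate vanish.\<close>
  define V where "V = measure lborel (cball (0::real^'d) (R + 1))"
  have "0 \<le> V" by (simp add: V_def)
  have bound: "\<bar>J\<bar> \<le> C * V * t" if t: "0 < t" "t \<le> 1" for t
  proof -
    let ?h = "t *\<^sub>R axis k 1 :: real^'d"
    let ?r = "\<lambda>x. \<eta> (x + ?h) - \<eta> x - t * partial_deriv k \<eta> x"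
    have shift: "integrable lborel (\<lambda>x. \<eta> (x + ?h))"
      using integrable_lborel_shift[OF integrable_test_function[OF \<eta>], of "- ?h"] by simp
    have "(\<integral>x. \<eta> (x + ?h) \<partial>lborel) = (\<integral>x. \<eta> x \<partial>lborel)"
      by (subst (2) lborel_distr_shift[of "- ?h", symmetric])
         (simp add: integral_distr borel_measurable_test_function[OF \<eta>])
    then have "- (t * J) = (\<integral>x. ?r x \<partial>lborel)"
      using shift integrable_test_function[OF \<eta>] integrable_test_function[OF \<eta>'] by (simp add: J_def)
    moreover have "\<bar>\<integral>x. ?r x \<partial>lborel\<bar> \<le> (\<integral>x. C * t\<^sup>2 * indicator (cball (0::real^'d) (R + 1)) x \<partial>lborel)"
    proof (rule order_trans[OF integral_abs_bound], rule integral_mono)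
      show "integrable lborel (\<lambda>x. \<bar>?r x\<bar>)"
        using shift integrable_test_function[OF \<eta>] integrable_test_function[OF \<eta>']
        by (intro integrable_abs Bochner_Integration.integrable_diff) simp_all
      show "integrable lborel (\<lambda>x::real^'d. C * t\<^sup>2 * indicator (cball 0 (R + 1)) x)"
        using emeasure_lborel_cball_finite[of "0::real^'d" "R + 1"] by (simp add: less_top)
      show "\<bar>?r x\<bar> \<le> C * t\<^sup>2 * indicator (cball 0 (R + 1)) x" for x
      proof (cases "norm x \<le> R + 1")
        case True
        then show ?thesis
          using C(2)[of x ?h] t by (simp add: inner_axis grad_def power_mult_distrib)
      next
        case False
        then have "R < norm (x + ?h)" "R < norm x"
          using norm_triangle_ineq4[of "x + ?h" ?h] t by auto
        then show ?thesis
          using R C(1) by simp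
      qed
    qed
    ultimately have "t * \<bar>J\<bar> \<le> C * t\<^sup>2 * V"
      using t by (simp add: V_def abs_mult)
    then have "t * \<bar>J\<bar> \<le> t * (C * V * t)"
      by (simp add: power2_eq_square mult_ac)
    then show ?thesis
      using t by simp
  qed
  have "((\<lambda>t. C * V * t) \<longlongrightarrow> C * V * 0) (at_right 0)"
    by (intro tendsto_intros)
  moreover have "\<forall>\<^sub>F t in at_right 0. \<bar>J\<bar> \<le> C * V * t"
    using bound by (auto simp: eventually_at_right_field intro!: exI[of _ 1])
  ultimately have "\<bar>J\<bar> \<le> C * V * 0"
    using tendsto_lowerbound trivial_limit_at_right_real by blast
  moreover have "(\<integral>x. partial_deriv k \<eta> x \<partial>lebesgue) = J"
    unfolding J_def using borel_measurable_test_function[OF \<eta>'] by (intro integral_completion) simp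
  ultimately show ?thesis by simp
qed

lemma H1_loc_with_grad_diff_const:
  assumes "H1_loc_with_grad u h"
  shows "H1_loc_with_grad (\<lambda>x. u x - c) h"
  unfolding H1_loc_with_grad_def
proof (intro conjI allI impI)
  have u: "L2_loc u" using assms by (simp add: H1_loc_with_grad_def)
  show "L2_loc h" using assms by (simp add: H1_loc_with_grad_def)
  show "L2_loc (\<lambda>x. u x - c)" by (intro L2_loc_diff u L2_loc_const)
  fix \<eta> :: "real^'a \<Rightarrow> real" and k assume \<eta>: "test_function \<eta>"
  note \<eta>' = test_function_partial_deriv[OF \<eta>, of k]
  have "integrable lebesgue (\<lambda>x. c * partial_deriv k \<eta> x)"
    by (rule integrable_L2_loc_test(1)[OF L2_loc_const \<eta>'])
  then have "(\<integral>x. (u x - c) * partial_deriv k \<eta> x \<partial>lebesgue) =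
      (\<integral>x. u x * partial_deriv k \<eta> x \<partial>lebesgue) - (\<integral>x. c * partial_deriv k \<eta> x \<partial>lebesgue)"
    using integrable_L2_loc_test(1)[OF u \<eta>'] by (simp add: left_diff_distrib)
  then show "(\<integral>x. (u x - c) * partial_deriv k \<eta> x \<partial>lebesgue) = - (\<integral>x. h x $ k * \<eta> x \<partial>lebesgue)"
    using assms \<eta> integral_partial_deriv_test[OF \<eta>, of k] by (simp add: H1_loc_with_grad_def)
qed

lemma H1_loc_with_grad_diff:
  assumes "H1_loc_with_grad u h" "H1_loc_with_grad u' h'"
  shows "H1_loc_with_grad (\<lambda>x. u x - u' x) (\<lambda>x. h x - h' x)"
  unfolding H1_loc_with_grad_def
proof (intro conjI allI impI)
  have L: "L2_loc u" "L2_loc u'" "L2_loc h" "L2_loc h'"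
    using assms by (auto simp: H1_loc_with_grad_def)
  then show "L2_loc (\<lambda>x. u x - u' x)" "L2_loc (\<lambda>x. h x - h' x)"
    by (auto intro: L2_loc_diff)
  fix \<eta> :: "real^'a \<Rightarrow> real" and k assume \<eta>: "test_function \<eta>"
  note \<eta>' = test_function_partial_deriv[OF \<eta>, of k]
  show "(\<integral>x. (u x - u' x) * partial_deriv k \<eta> x \<partial>lebesgue) = - (\<integral>x. (h x - h' x) $ k * \<eta> x \<partial>lebesgue)"
    using assms \<eta> integrable_L2_loc_test(1)[OF L(1) \<eta>'] integrable_L2_loc_test(1)[OF L(2) \<eta>']
      integrable_L2_loc_test(1)[OF L2_loc_nth[OF L(3)] \<eta>] integrable_L2_loc_test(1)[OF L2_loc_nth[OF L(4)] \<eta>]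
    by (simp add: left_diff_distrib H1_loc_with_grad_def)
qed

text \<open>The test function is \<theta> u, and the field \<open>G\<close> in the proof is its weak
  gradient. The product rule comes from inserting \<theta> \<zeta> as a test function in the
  definition of the weak gradient of u.\<close>

lemma H1_test_orthogonal:
  assumes H1: "H1_loc_with_grad u h" and v: "L2_loc v" "weakly_div_free v" and \<theta>: "test_function \<theta>"
  shows "(\<integral>x. (\<theta> x *\<^sub>R h x + u x *\<^sub>R grad \<theta> x) \<bullet> v x \<partial>lebesgue) = 0"
    "integrable lebesgue (\<lambda>x. (\<theta> x *\<^sub>R h x + u x *\<^sub>R grad \<theta> x) \<bullet> v x)"
proof -
  have u: "L2_loc u" and h: "L2_loc h" using H1 by (auto simp: H1_loc_with_grad_def)
  obtain R where R: "\<And>x. R < norm x \<Longrightarrow> \<theta> x = 0" "\<And>x k. R < norm x \<Longrightarrow> partial_deriv k \<theta> x = 0"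
    using test_function_support[OF \<theta>] by metis
  define G where "G x = \<theta> x *\<^sub>R h x + u x *\<^sub>R grad \<theta> x" for x
  have Gk: "G x $ k = h x $ k * \<theta> x + u x * partial_deriv k \<theta> x" for x k
    by (simp add: G_def grad_def)
  note int_h = integrable_L2_loc_test[OF L2_loc_nth[OF h] \<theta>]
  note int_u = integrable_L2_loc_test[OF u test_function_partial_deriv[OF \<theta>]]
  have Gm: "(\<lambda>x. G x $ k) \<in> borel_measurable lebesgue" for k
    unfolding Gk using int_h(1)[of k] int_u(1)[of k] by (intro borel_measurable_add) auto
  have G2: "integrable lebesgue (\<lambda>x. (G x $ k)\<^sup>2)" for k
  proof (rule Bochner_Integration.integrable_bound)
    show "integrable lebesgue (\<lambda>x. 2 * (h x $ k * \<theta> x)\<^sup>2 + 2 * (u x * partial_deriv k \<theta> x)\<^sup>2)"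
      using int_h(2) int_u(2) by simp
    show "AE x in lebesgue. norm ((G x $ k)\<^sup>2) \<le> norm (2 * (h x $ k * \<theta> x)\<^sup>2 + 2 * (u x * partial_deriv k \<theta> x)\<^sup>2)"
      using square_add_le by (simp add: Gk)
  qed (use Gm in simp)
  have weak: "(\<integral>x. u x * \<theta> x * partial_deriv k \<zeta> x \<partial>lebesgue) = - (\<integral>x. G x $ k * \<zeta> x \<partial>lebesgue)"
    if \<zeta>: "test_function \<zeta>" for \<zeta> k
  proof -
    have \<theta>\<zeta>: "test_function (\<lambda>x. \<theta> x * \<zeta> x)"
      by (rule test_function_mult[OF \<theta> \<zeta>])
    have p: "partial_deriv k (\<lambda>x. \<theta> x * \<zeta> x) x = \<theta> x * partial_deriv k \<zeta> x + partial_deriv k \<theta> x * \<zeta> x" for x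
      by (intro partial_deriv_mult test_functionD \<theta> \<zeta>)
    note i1 = integrable_L2_loc_test(1)[OF u test_function_partial_deriv[OF \<theta>\<zeta>, of k]]
    note i2 = integrable_L2_loc_test(1)[OF u test_function_mult[OF test_function_partial_deriv[OF \<theta>, of k] \<zeta>]]
    note i3 = integrable_L2_loc_test(1)[OF L2_loc_nth[OF h, of k] \<theta>\<zeta>]
    have "(\<integral>x. u x * \<theta> x * partial_deriv k \<zeta> x \<partial>lebesgue) =
        (\<integral>x. u x * partial_deriv k (\<lambda>x. \<theta> x * \<zeta> x) x - u x * (partial_deriv k \<theta> x * \<zeta> x) \<partial>lebesgue)"
      by (simp add: p algebra_simps)
    also have "\<dots> = (\<integral>x. u x * partial_deriv k (\<lambda>x. \<theta> x * \<zeta> x) x \<partial>lebesgue) -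
        (\<integral>x. u x * (partial_deriv k \<theta> x * \<zeta> x) \<partial>lebesgue)"
      by (rule Bochner_Integration.integral_diff[OF i1 i2])
    also have "(\<integral>x. u x * partial_deriv k (\<lambda>x. \<theta> x * \<zeta> x) x \<partial>lebesgue) = - (\<integral>x. h x $ k * (\<theta> x * \<zeta> x) \<partial>lebesgue)"
      using H1 \<theta>\<zeta> by (simp add: H1_loc_with_grad_def)
    also have "- (\<integral>x. h x $ k * (\<theta> x * \<zeta> x) \<partial>lebesgue) - (\<integral>x. u x * (partial_deriv k \<theta> x * \<zeta> x) \<partial>lebesgue) =
        - (\<integral>x. h x $ k * (\<theta> x * \<zeta> x) + u x * (partial_deriv k \<theta> x * \<zeta> x) \<partial>lebesgue)"
      by (subst Bochner_Integration.integral_add[OF i3 i2]) simp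
    also have "\<dots> = - (\<integral>x. G x $ k * \<zeta> x \<partial>lebesgue)"
      by (simp add: Gk algebra_simps)
    finally show ?thesis .
  qed
  note * = weak_grad_orthogonal[OF integrable_L2_loc_test(1)[OF u \<theta>] _ Gm G2 _ weak v, of R]
  have "G x = 0" if "R < norm x" for x
    using R that by (simp add: vec_eq_iff Gk)
  with * R(1) show "(\<integral>x. (\<theta> x *\<^sub>R h x + u x *\<^sub>R grad \<theta> x) \<bullet> v x \<partial>lebesgue) = 0"
    "integrable lebesgue (\<lambda>x. (\<theta> x *\<^sub>R h x + u x *\<^sub>R grad \<theta> x) \<bullet> v x)"
    by (simp_all add: G_def[symmetric])
qed

section \<open>Energy estimates for differences of correctors\<close>

text \<open>Testing with \<eta>^2 u produces a coercive term and a cross term 2 \<eta> u (grad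
  \<eta> \<bullet> v); Young's inequality absorbs half of the coercive term. In the application v is
  the matrix times h, represented here by the two pointwise bounds in \<open>ell\<close>.\<close>

lemma caccioppoli:
  assumes H1: "H1_loc_with_grad u h" and v: "v \<in> borel_measurable lebesgue" "weakly_div_free v"
    and ell: "AE x in lebesgue. lam * (norm (h x))\<^sup>2 \<le> h x \<bullet> v x \<and> norm (v x) \<le> Lam * norm (h x)"
    and lam: "0 < lam" "0 \<le> Lam" and \<eta>: "test_function \<eta>"
  shows "lam\<^sup>2 * (\<integral>x. (\<eta> x)\<^sup>2 * (norm (h x))\<^sup>2 \<partial>lebesgue) \<le>
    4 * Lam\<^sup>2 * (\<integral>x. (norm (grad \<eta> x))\<^sup>2 * (u x)\<^sup>2 \<partial>lebesgue)"
    and "integrable lebesgue (\<lambda>x. (\<eta> x)\<^sup>2 * (norm (h x))\<^sup>2)"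
    and "integrable lebesgue (\<lambda>x. (norm (grad \<eta> x))\<^sup>2 * (u x)\<^sup>2)"
proof -
  have u: "L2_loc u" and h: "L2_loc h" using H1 by (auto simp: H1_loc_with_grad_def)
  have "L2_loc v"
    using ell by (intro L2_loc_bound[OF h v(1) lam(2)]) (auto elim!: eventually_mono)
  note orth = H1_test_orthogonal[OF H1 this v(2) test_function_mult[OF \<eta> \<eta>]]
  have grad: "grad (\<lambda>x. \<eta> x * \<eta> x) x = (2 * \<eta> x) *\<^sub>R grad \<eta> x" for x
    by (simp add: vec_eq_iff grad_def partial_deriv_mult test_functionD[OF \<eta>])
  let ?T = "\<lambda>x. ((\<eta> x * \<eta> x) *\<^sub>R h x + u x *\<^sub>R grad (\<lambda>x. \<eta> x * \<eta> x) x) \<bullet> v x"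
  obtain R where R: "\<And>x. R < norm x \<Longrightarrow> \<eta> x = 0" "\<And>x k. R < norm x \<Longrightarrow> partial_deriv k \<eta> x = 0"
    using test_function_support[OF \<eta>] by metis
  obtain C where C: "\<And>x. \<bar>\<eta> x\<bar> \<le> C" using test_function_bounded[OF \<eta>] by metis
  obtain M where M: "\<And>x. norm (grad \<eta> x) \<le> M" using test_function_grad_bounded[OF \<eta>] by metis
  have "integrable lebesgue (\<lambda>x. (\<eta> x)\<^sup>2 * (norm (h x))\<^sup>2)"
  proof (rule L2_loc_bounded_weight[OF h])
    show "\<bar>(\<eta> x)\<^sup>2\<bar> \<le> C\<^sup>2" for x
      using power_mono[OF C abs_ge_zero, of x 2] by simp
  qed (use R borel_measurable_test_function[OF \<eta>] in auto)
  then show i1: "integrable lebesgue (\<lambda>x. (\<eta> x)\<^sup>2 * (norm (h x))\<^sup>2)" .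
  have "integrable lebesgue (\<lambda>x. (norm (grad \<eta> x))\<^sup>2 * (norm (u x))\<^sup>2)"
  proof (rule L2_loc_bounded_weight[OF u])
    show "\<bar>(norm (grad \<eta> x))\<^sup>2\<bar> \<le> M\<^sup>2" for x
      using power_mono[OF M norm_ge_zero, of x 2] by simp
    have "(\<lambda>x. (norm (grad \<eta> x))\<^sup>2) = (\<lambda>x. \<Sum>k\<in>UNIV. partial_deriv k \<eta> x * partial_deriv k \<eta> x)"
      by (simp add: power2_norm_eq_inner inner_vec_def grad_def)
    then show "(\<lambda>x. (norm (grad \<eta> x))\<^sup>2) \<in> borel_measurable borel"
      using borel_measurable_test_function[OF test_function_partial_deriv[OF \<eta>]] by simp
    show "(norm (grad \<eta> x))\<^sup>2 = 0" if "R < norm x" for x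
      using R(2)[OF that] by (simp add: grad_def vec_eq_iff)
  qed
  then show i2: "integrable lebesgue (\<lambda>x. (norm (grad \<eta> x))\<^sup>2 * (u x)\<^sup>2)" by simp
  have "(\<integral>x. lam / 2 * ((\<eta> x)\<^sup>2 * (norm (h x))\<^sup>2) \<partial>lebesgue) \<le>
      (\<integral>x. ?T x + 2 * Lam\<^sup>2 / lam * ((norm (grad \<eta> x))\<^sup>2 * (u x)\<^sup>2) \<partial>lebesgue)"
  proof (rule integral_mono_AE)
    show "AE x in lebesgue. lam / 2 * ((\<eta> x)\<^sup>2 * (norm (h x))\<^sup>2) \<le>
      ?T x + 2 * Lam\<^sup>2 / lam * ((norm (grad \<eta> x))\<^sup>2 * (u x)\<^sup>2)"
      using ell
    proof eventually_elim
      case (elim x)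
      define a b where "a = \<bar>\<eta> x\<bar> * norm (h x)" and "b = norm (grad \<eta> x) * \<bar>u x\<bar>"
      have ab: "a\<^sup>2 = (\<eta> x)\<^sup>2 * (norm (h x))\<^sup>2" "b\<^sup>2 = (norm (grad \<eta> x))\<^sup>2 * (u x)\<^sup>2"
        by (simp_all add: a_def b_def power_mult_distrib)
      have T: "?T x = (\<eta> x)\<^sup>2 * (h x \<bullet> v x) + 2 * \<eta> x * u x * (grad \<eta> x \<bullet> v x)"
        by (simp add: grad inner_add_left power2_eq_square)
      have "lam * a\<^sup>2 \<le> (\<eta> x)\<^sup>2 * (h x \<bullet> v x)"
        using mult_left_mono[OF conjunct1[OF elim], of "(\<eta> x)\<^sup>2"] by (simp add: ab mult_ac)
      moreover have "\<bar>2 * \<eta> x * u x * (grad \<eta> x \<bullet> v x)\<bar> \<le> 2 * Lam * a * b"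
      proof -
        have "\<bar>grad \<eta> x \<bullet> v x\<bar> \<le> norm (grad \<eta> x) * (Lam * norm (h x))"
          using Cauchy_Schwarz_ineq2[of "grad \<eta> x" "v x"] mult_left_mono[OF conjunct2[OF elim], of "norm (grad \<eta> x)"]
          by simp
        then have "2 * \<bar>\<eta> x\<bar> * \<bar>u x\<bar> * \<bar>grad \<eta> x \<bullet> v x\<bar> \<le> 2 * \<bar>\<eta> x\<bar> * \<bar>u x\<bar> * (norm (grad \<eta> x) * (Lam * norm (h x)))"
          by (intro mult_left_mono) auto
        then show ?thesis
          by (simp add: abs_mult a_def b_def mult_ac)
      qed
      moreover have "2 * Lam * a * b \<le> lam / 2 * a\<^sup>2 + 2 * Lam\<^sup>2 / lam * b\<^sup>2"
      proof -
        \<comment> \<open>Expanding this square is Young's inequality with the weights that keep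
          exactly \<open>lam / 2\<close> of the coercive term.\<close>
        have "0 \<le> (lam * a - 2 * Lam * b)\<^sup>2 / (2 * lam)" using lam(1) by simp
        also have "\<dots> = lam / 2 * a\<^sup>2 + 2 * Lam\<^sup>2 / lam * b\<^sup>2 - 2 * Lam * a * b"
          using lam(1) by (simp add: field_simps power2_eq_square)
        finally show ?thesis by simp
      qed
      ultimately show ?case
        unfolding T ab[symmetric] by linarith
    qed
  qed (use i1 i2 orth(2) in simp_all)
  \<comment> \<open>The integral of \<open>?T\<close> vanishes by orthogonality, so only the term
    with the gradient of the cut-off remains. Multiplying by 2 lam then produces the factor
    4.\<close>
  also have "\<dots> = 2 * Lam\<^sup>2 / lam * (\<integral>x. (norm (grad \<eta> x))\<^sup>2 * (u x)\<^sup>2 \<partial>lebesgue)"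
    using i2 orth by simp
  finally show "lam\<^sup>2 * (\<integral>x. (\<eta> x)\<^sup>2 * (norm (h x))\<^sup>2 \<partial>lebesgue) \<le>
    4 * Lam\<^sup>2 * (\<integral>x. (norm (grad \<eta> x))\<^sup>2 * (u x)\<^sup>2 \<partial>lebesgue)"
    using lam(1) by (simp add: field_simps power2_eq_square)
qed

text \<open>Ellipticity bounds only the quadratic form; symmetry upgrades this to a norm bound. With
  \<xi> the image of \<zeta>, nonnegativity of the form at \<zeta> - \<xi> / Lam, in which symmetry
  turns both cross terms into \<xi> \<bullet> \<xi>, gives \<bar>\<xi>\<bar>^2 / Lam \<le> Lam
  \<bar>\<zeta>\<bar>^2.\<close>

lemma norm_matrix_vector_le:
  fixes a :: "real^'d^'d"
  assumes sym: "transpose a = a" and lam: "0 < lam" "lam \<le> Lam"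
    and ell: "\<And>\<zeta>. lam * (norm \<zeta>)\<^sup>2 \<le> \<zeta> \<bullet> (a *v \<zeta>) \<and> \<zeta> \<bullet> (a *v \<zeta>) \<le> Lam * (norm \<zeta>)\<^sup>2"
  shows "norm (a *v \<zeta>) \<le> Lam * norm \<zeta>"
proof -
  have "0 < Lam" using lam by simp
  define \<xi> where "\<xi> = a *v \<zeta>"
  have swap: "\<zeta> \<bullet> (a *v \<xi>) = \<xi> \<bullet> \<xi>"
    using dot_lmul_matrix[of \<zeta> a \<xi>] sym by (simp add: \<xi>_def vector_transpose_matrix[symmetric])
  have "0 \<le> (\<zeta> - (1 / Lam) *\<^sub>R \<xi>) \<bullet> (a *v (\<zeta> - (1 / Lam) *\<^sub>R \<xi>))"
    using ell[of "\<zeta> - (1 / Lam) *\<^sub>R \<xi>"] lam(1) by (smt (verit) mult_nonneg_nonneg zero_le_power2)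
  also have "\<dots> = \<zeta> \<bullet> \<xi> - 2 / Lam * (\<xi> \<bullet> \<xi>) + (1 / Lam)\<^sup>2 * (\<xi> \<bullet> (a *v \<xi>))"
    by (simp add: matrix_vector_mult_diff_distrib matrix_vector_mult_scaleR inner_diff_left inner_diff_right
        swap \<xi>_def[symmetric] power2_eq_square algebra_simps)
  also have "\<dots> \<le> Lam * (norm \<zeta>)\<^sup>2 - 2 / Lam * (norm \<xi>)\<^sup>2 + (1 / Lam)\<^sup>2 * (Lam * (norm \<xi>)\<^sup>2)"
    using ell[of \<zeta>] ell[of \<xi>] by (intro add_mono diff_mono mult_left_mono) (use \<open>0 < Lam\<close> in \<open>auto simp: \<xi>_def power2_norm_eq_inner\<close>)
  also have "\<dots> = Lam * (norm \<zeta>)\<^sup>2 - (norm \<xi>)\<^sup>2 / Lam"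
    using \<open>0 < Lam\<close> by (simp add: field_simps power2_eq_square)
  finally have "(norm \<xi>)\<^sup>2 \<le> (Lam * norm \<zeta>)\<^sup>2"
    using \<open>0 < Lam\<close> by (simp add: field_simps power2_eq_square)
  then show ?thesis
    unfolding \<xi>_def by (rule power2_le_imp_le) (use \<open>0 < Lam\<close> in simp)
qed

lemma borel_measurable_matrix_vector_mult:
  fixes a :: "'a \<Rightarrow> real^'d^'n"
  assumes "a \<in> borel_measurable M" "h \<in> borel_measurable M"
  shows "(\<lambda>x. a x *v h x) \<in> borel_measurable M"
proof (rule borel_measurable_continuous_Pair[OF assms])
  show "continuous_on UNIV (\<lambda>p. (fst p :: real^'d^'n) *v snd p)"
    unfolding matrix_vector_mult_def by (intro continuous_intros)
qed

lemma weakly_div_free_diff: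
  assumes "weakly_div_free v" "weakly_div_free v'" "L2_loc v" "L2_loc v'"
  shows "weakly_div_free (\<lambda>x. v x - v' x)"
  unfolding weakly_div_free_def
proof (intro allI impI)
  fix \<eta> :: "real^'a \<Rightarrow> real" assume \<eta>: "test_function \<eta>"
  have int: "integrable lebesgue (\<lambda>x. grad \<eta> x \<bullet> v x)" if "L2_loc v" for v
    using integrable_L2_loc_test(1)[OF L2_loc_nth[OF that] test_function_partial_deriv[OF \<eta>]]
    by (simp add: inner_vec_def grad_def mult.commute)
  show "(\<integral>x. grad \<eta> x \<bullet> (v x - v' x) \<partial>lebesgue) = 0"
    using assms \<eta> int by (simp add: inner_diff_right weakly_div_free_def)
qed

lemma integrable_L2_loc_ball:
  fixes f :: "real^'d \<Rightarrow> 'b::euclidean_space"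
  assumes "L2_loc f"
  shows "integrable lebesgue (\<lambda>x. indicator (ball 0 R) x * (norm (f x))\<^sup>2)"
  by (rule L2_loc_bounded_weight[OF assms, where C=1 and R=R]) (auto simp: indicator_def)

text \<open>The Caccioppoli inequality at scale R, with C independent of R. The rescaled cut-off is
  bounded below on the ball of radius R/4 and vanishes beyond R/2, and its gradient is of order 1/R,
  which produces the normalization by R^2 found in the sublinearity condition.\<close>

lemma sublinear_gradient_estimate:
  fixes u u' :: "real^'d \<Rightarrow> real"
  assumes H: "H1_loc_with_grad u g" "H1_loc_with_grad u' g'"
    and v: "v \<in> borel_measurable lebesgue" "weakly_div_free v"
    and ell: "AE x in lebesgue. lam * (norm (g x - g' x))\<^sup>2 \<le> (g x - g' x) \<bullet> v x \<and> norm (v x) \<le> Lam * norm (g x - g' x)"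
    and lam: "0 < lam" "0 \<le> Lam"
  obtains C where "0 \<le> C" "\<And>R. 0 < R \<Longrightarrow>
      (\<integral>x. indicator (ball 0 (R / 4)) x * (norm (g x - g' x))\<^sup>2 \<partial>lebesgue) / measure lebesgue (ball (0::real^'d) R) \<le>
      C * (ball_avg R (\<lambda>x. (u x - ball_avg R u)\<^sup>2) / R\<^sup>2 + ball_avg R (\<lambda>x. (u' x - ball_avg R u')\<^sup>2) / R\<^sup>2)"
proof -
  obtain M where M: "0 < M" "\<And>x::real^'d. norm (grad bump x) \<le> M"
    using test_function_grad_bounded[OF test_function_bump] by metis
  define \<gamma> :: real where "\<gamma> = (exp (- 2))\<^sup>2"
  have "0 < \<gamma>" by (simp add: \<gamma>_def)
  \<comment> \<open>The factor 32 is 4 from the Caccioppoli inequality, 4 from the squared slope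
    2M/R of the cut-off, and 2 from splitting the square of a difference; \<gamma> is the lower
    bound of the squared cut-off on the inner ball.\<close>
  define C where "C = 32 * Lam\<^sup>2 * M\<^sup>2 / (lam\<^sup>2 * \<gamma>)"
  show thesis
  proof (rule that[of C])
    show "0 \<le> C" using lam \<open>0 < \<gamma>\<close> by (simp add: C_def)
    fix R :: real assume "0 < R"
    define B where "B = ball (0::real^'d) R"
    define V where "V = measure lebesgue B"
    have "0 < V" using \<open>0 < R\<close> content_ball_pos[of R "0::real^'d"] by (simp add: V_def B_def)
    define X where "X = (\<integral>x. indicator (ball 0 (R / 4)) x * (norm (g x - g' x))\<^sup>2 \<partial>lebesgue)"
    define I where "I = (\<integral>x. indicator B x * (u x - ball_avg R u)\<^sup>2 \<partial>lebesgue)"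
    define I' where "I' = (\<integral>x. indicator B x * (u' x - ball_avg R u')\<^sup>2 \<partial>lebesgue)"
    \<comment> \<open>With this constant u - u' - c is the difference of the two functions, each
      centred by its own average, so each contribution is controlled by its own
      sublinearity.\<close>
    define c where "c = ball_avg R u - ball_avg R u'"
    define \<eta> :: "real^'d \<Rightarrow> real" where "\<eta> x = bump (0 + (2 / R) *\<^sub>R x)" for x
    have \<eta>: "test_function \<eta>"
      unfolding \<eta>_def[abs_def] using \<open>0 < R\<close> by (intro test_function_affine test_function_bump) simp
    have H': "H1_loc_with_grad (\<lambda>x. u x - u' x - c) (\<lambda>x. g x - g' x)"
      by (intro H1_loc_with_grad_diff_const H1_loc_with_grad_diff H)
    note cacc = caccioppoli[OF H' v ell lam \<eta>]
    have L2: "L2_loc (\<lambda>x. g x - g' x)" "L2_loc (\<lambda>x. u x - u' x - c)"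
        "L2_loc (\<lambda>x. u x - ball_avg R u)" "L2_loc (\<lambda>x. u' x - ball_avg R u')"
      using H' H by (auto simp: H1_loc_with_grad_def intro!: L2_loc_diff L2_loc_const)
    have "\<gamma> * X \<le> (\<integral>x. (\<eta> x)\<^sup>2 * (norm (g x - g' x))\<^sup>2 \<partial>lebesgue)"
      unfolding X_def
    proof (subst integral_mult_right_zero[symmetric], rule integral_mono)
      show "integrable lebesgue (\<lambda>x. \<gamma> * (indicator (ball 0 (R / 4)) x * (norm (g x - g' x))\<^sup>2))"
        using integrable_L2_loc_ball[OF L2(1)] by simp
      show "\<gamma> * (indicator (ball 0 (R / 4)) x * (norm (g x - g' x))\<^sup>2) \<le> (\<eta> x)\<^sup>2 * (norm (g x - g' x))\<^sup>2" for x
      proof (cases "x \<in> ball 0 (R / 4)")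
        case True
        then have "exp (- 2) \<le> \<eta> x"
          unfolding \<eta>_def using \<open>0 < R\<close> by (intro bump_ge) (simp add: field_simps)
        then have "\<gamma> \<le> (\<eta> x)\<^sup>2"
          unfolding \<gamma>_def by (intro power_mono) auto
        then show ?thesis using True by (simp add: mult_right_mono)
      qed simp
    qed (rule cacc(2))
    moreover have "(\<integral>x. (norm (grad \<eta> x))\<^sup>2 * (u x - u' x - c)\<^sup>2 \<partial>lebesgue) \<le>
        (\<integral>x. (2 * M / R)\<^sup>2 * (2 * (indicator B x * (u x - ball_avg R u)\<^sup>2) +
          2 * (indicator B x * (u' x - ball_avg R u')\<^sup>2)) \<partial>lebesgue)"
    proof (rule integral_mono[OF cacc(3)])
      show "integrable lebesgue (\<lambda>x. (2 * M / R)\<^sup>2 * (2 * (indicator B x * (u x - ball_avg R u)\<^sup>2) +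
          2 * (indicator B x * (u' x - ball_avg R u')\<^sup>2)))"
        using integrable_L2_loc_ball[OF L2(3), of R] integrable_L2_loc_ball[OF L2(4), of R]
        by (intro integrable_mult_right Bochner_Integration.integrable_add) (simp_all add: B_def)
      show "(norm (grad \<eta> x))\<^sup>2 * (u x - u' x - c)\<^sup>2 \<le> (2 * M / R)\<^sup>2 * (2 * (indicator B x * (u x - ball_avg R u)\<^sup>2) +
          2 * (indicator B x * (u' x - ball_avg R u')\<^sup>2))" for x
      proof (cases "x \<in> B")
        case True
        have "grad \<eta> x = (2 / R) *\<^sub>R grad bump (0 + (2 / R) *\<^sub>R x)"
          unfolding \<eta>_def[abs_def] grad_def vec_eq_iff
          by (simp only: partial_deriv_affine[OF test_functionD(1)[OF test_function_bump]]) simp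
        then have "norm (grad \<eta> x) \<le> 2 * M / R"
          using M(2)[of "0 + (2 / R) *\<^sub>R x"] \<open>0 < R\<close> by (simp add: field_simps)
        then have "(norm (grad \<eta> x))\<^sup>2 \<le> (2 * M / R)\<^sup>2"
          by (intro power_mono) auto
        moreover have "(u x - u' x - c)\<^sup>2 \<le> 2 * (u x - ball_avg R u)\<^sup>2 + 2 * (u' x - ball_avg R u')\<^sup>2"
          using square_add_le[of "u x - ball_avg R u" "- (u' x - ball_avg R u')"]
          by (simp add: c_def power2_commute algebra_simps)
        ultimately show ?thesis
          using True by (simp add: mult_mono)
      next
        case False
        then have "R / 2 < norm x" using \<open>0 < R\<close> by (simp add: B_def)
        moreover have "\<eta> y = 0" if "R / 2 < norm y" for y
          unfolding \<eta>_def using that \<open>0 < R\<close> by (intro bump_eq_0) (simp add: field_simps)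
        ultimately have "grad \<eta> x = 0"
          using partial_deriv_eq_0_outside[of "R / 2" \<eta> x] by (simp add: grad_def vec_eq_iff)
        then show ?thesis using False by simp
      qed
    qed
    moreover have "\<dots> = (2 * M / R)\<^sup>2 * (2 * I + 2 * I')"
      using integrable_L2_loc_ball[OF L2(3), of R] integrable_L2_loc_ball[OF L2(4), of R]
      by (simp add: I_def I'_def B_def)
    ultimately have "lam\<^sup>2 * (\<gamma> * X) \<le> 4 * Lam\<^sup>2 * ((2 * M / R)\<^sup>2 * (2 * I + 2 * I'))"
      using cacc(1) by (smt (verit) mult_left_mono zero_le_power2)
    then have "X \<le> C * (I + I') / R\<^sup>2"
      using lam(1) \<open>0 < \<gamma>\<close> \<open>0 < R\<close> by (simp add: C_def field_simps power2_eq_square)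
    then have "X / V \<le> C * (I + I') / R\<^sup>2 / V"
      using \<open>0 < V\<close> by (intro divide_right_mono) auto
    moreover have "ball_avg R (\<lambda>x. (u x - ball_avg R u)\<^sup>2) = I / V" "ball_avg R (\<lambda>x. (u' x - ball_avg R u')\<^sup>2) = I' / V"
      unfolding ball_avg_def[of R "\<lambda>x. (u x - ball_avg R u)\<^sup>2"] ball_avg_def[of R "\<lambda>x. (u' x - ball_avg R u')\<^sup>2"]
      by (simp_all add: I_def I'_def V_def B_def set_lebesgue_integral_def)
    moreover have "C * (I + I') / R\<^sup>2 / V = C * (I / V / R\<^sup>2 + I' / V / R\<^sup>2)"
      using \<open>0 < V\<close> \<open>0 < R\<close> by (simp add: field_simps)
    ultimately show "(\<integral>x. indicator (ball 0 (R / 4)) x * (norm (g x - g' x))\<^sup>2 \<partial>lebesgue) / measure lebesgue (ball (0::real^'d) R) \<le>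
      C * (ball_avg R (\<lambda>x. (u x - ball_avg R u)\<^sup>2) / R\<^sup>2 + ball_avg R (\<lambda>x. (u' x - ball_avg R u')\<^sup>2) / R\<^sup>2)"
      by (simp add: X_def[symmetric] B_def[symmetric] V_def[symmetric])
  qed
qed

text \<open>By linearity the common vector e cancels from the two equations, so the flux a (g - g')
  of the difference is divergence free and inherits ellipticity; sublinearity then makes the
  right-hand side of the gradient estimate tend to 0.\<close>

lemma sublinear_gradient_vanishes:
  fixes a :: "real^'d \<Rightarrow> real^'d^'d"
  assumes a: "a \<in> borel_measurable lebesgue" "\<And>x. transpose (a x) = a x"
    and lam: "0 < lam" "lam \<le> Lam"
    and ell: "AE x in lebesgue. \<forall>\<zeta>. lam * (norm \<zeta>)\<^sup>2 \<le> \<zeta> \<bullet> (a x *v \<zeta>) \<and> \<zeta> \<bullet> (a x *v \<zeta>) \<le> Lam * (norm \<zeta>)\<^sup>2"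
    and H: "H1_loc_with_grad u g" "H1_loc_with_grad u' g'"
    and div: "weakly_div_free (\<lambda>x. a x *v (g x + e))" "weakly_div_free (\<lambda>x. a x *v (g' x + e))"
    and sub: "((\<lambda>R. ball_avg R (\<lambda>x. (u x - ball_avg R u)\<^sup>2) / R\<^sup>2) \<longlongrightarrow> 0) at_top"
      "((\<lambda>R. ball_avg R (\<lambda>x. (u' x - ball_avg R u')\<^sup>2) / R\<^sup>2) \<longlongrightarrow> 0) at_top"
  shows "((\<lambda>R. (\<integral>x. indicator (ball 0 (R / 4)) x * (norm (g x - g' x))\<^sup>2 \<partial>lebesgue) /
    measure lebesgue (ball (0::real^'d) R)) \<longlongrightarrow> 0) at_top"
proof -
  have le: "AE x in lebesgue. norm (a x *v \<zeta> x) \<le> Lam * norm (\<zeta> x)" for \<zeta>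
    using ell by eventually_elim (rule norm_matrix_vector_le[OF a(2) lam], blast)
  have L2: "L2_loc g" "L2_loc g'" using H by (auto simp: H1_loc_with_grad_def)
  have flux: "L2_loc (\<lambda>x. a x *v (g x + e))" if "L2_loc g" for g
  proof (rule L2_loc_bound[OF L2_loc_add[OF that L2_loc_const] _ _ le])
    show "(\<lambda>x. a x *v (g x + e)) \<in> borel_measurable lebesgue"
      using that by (intro borel_measurable_matrix_vector_mult a borel_measurable_add) (auto simp: L2_loc_def)
  qed (use lam in auto)
  have v: "weakly_div_free (\<lambda>x. a x *v (g x - g' x))"
    using weakly_div_free_diff[OF div flux[OF L2(1)] flux[OF L2(2)]]
    by (simp flip: matrix_vector_mult_diff_distrib)
  have vm: "(\<lambda>x. a x *v (g x - g' x)) \<in> borel_measurable lebesgue"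
    using L2 by (intro borel_measurable_matrix_vector_mult a borel_measurable_diff) (auto simp: L2_loc_def)
  have ell': "AE x in lebesgue. lam * (norm (g x - g' x))\<^sup>2 \<le> (g x - g' x) \<bullet> (a x *v (g x - g' x)) \<and>
      norm (a x *v (g x - g' x)) \<le> Lam * norm (g x - g' x)"
    using ell le[of "\<lambda>x. g x - g' x"] by eventually_elim blast
  have "0 \<le> Lam" using lam by simp
  obtain C where C: "0 \<le> C" "\<And>R. 0 < R \<Longrightarrow>
      (\<integral>x. indicator (ball 0 (R / 4)) x * (norm (g x - g' x))\<^sup>2 \<partial>lebesgue) / measure lebesgue (ball (0::real^'d) R) \<le>
      C * (ball_avg R (\<lambda>x. (u x - ball_avg R u)\<^sup>2) / R\<^sup>2 + ball_avg R (\<lambda>x. (u' x - ball_avg R u')\<^sup>2) / R\<^sup>2)"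
    using sublinear_gradient_estimate[OF H vm v ell' lam(1) \<open>0 \<le> Lam\<close>] by blast
  show ?thesis
  proof (rule tendsto_sandwich[OF _ _ tendsto_const])
    show "((\<lambda>R. C * (ball_avg R (\<lambda>x. (u x - ball_avg R u)\<^sup>2) / R\<^sup>2 +
        ball_avg R (\<lambda>x. (u' x - ball_avg R u')\<^sup>2) / R\<^sup>2)) \<longlongrightarrow> 0) at_top"
      using tendsto_mult_left[OF tendsto_add[OF sub], of C] by simp
    show "\<forall>\<^sub>F R in at_top. (\<integral>x. indicator (ball 0 (R / 4)) x * (norm (g x - g' x))\<^sup>2 \<partial>lebesgue) /
        measure lebesgue (ball (0::real^'d) R) \<le> C * (ball_avg R (\<lambda>x. (u x - ball_avg R u)\<^sup>2) / R\<^sup>2 +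
        ball_avg R (\<lambda>x. (u' x - ball_avg R u')\<^sup>2) / R\<^sup>2)"
      using eventually_gt_at_top[of 0] by eventually_elim (rule C(2))
    show "\<forall>\<^sub>F R in at_top. 0 \<le> (\<integral>x. indicator (ball 0 (R / 4)) x * (norm (g x - g' x))\<^sup>2 \<partial>lebesgue) /
        measure lebesgue (ball (0::real^'d) R)"
      by (intro eventuallyI divide_nonneg_nonneg Bochner_Integration.integral_nonneg) auto
  qed
qed

section \<open>Stationary environments and the ergodic decomposition\<close>

text \<open>The action is jointly measurable with respect to Lebesgue sets, so Fubini is applied to
  the completed measure, whose sigma-finiteness comes from the cover for
  \<open>lborel\<close>.\<close>

lemma sigma_finite_lebesgue: "sigma_finite_measure (lebesgue :: 'a::euclidean_space measure)"
proof
  obtain A :: "'a set set" where "countable A" "A \<subseteq> sets lborel" "\<Union>A = space lborel"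
    "\<forall>a\<in>A. emeasure lborel a \<noteq> \<infinity>"
    using lborel.sigma_finite_countable by blast
  then show "\<exists>A. countable A \<and> A \<subseteq> sets lebesgue \<and> \<Union>A = space (lebesgue :: 'a measure) \<and>
      (\<forall>a\<in>A. emeasure lebesgue a \<noteq> \<infinity>)"
    by (intro exI[of _ A]) (auto simp: subset_iff)
qed

lemma
  assumes "measure_action Q \<tau>"
  shows measurable_action_pair: "(\<lambda>(\<omega>, x). \<tau> x \<omega>) \<in> measurable (Q \<Otimes>\<^sub>M lebesgue) Q"
    and measurable_action: "\<tau> x \<in> measurable Q Q"
    and measurable_orbit: "\<omega> \<in> space Q \<Longrightarrow> (\<lambda>x. \<tau> x \<omega>) \<in> measurable lebesgue Q"
proof -
  have m: "(\<lambda>(x, \<omega>). \<tau> x \<omega>) \<in> measurable (lebesgue \<Otimes>\<^sub>M Q) Q"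
    using assms by (simp add: measure_action_def)
  show "(\<lambda>(\<omega>, x). \<tau> x \<omega>) \<in> measurable (Q \<Otimes>\<^sub>M lebesgue) Q"
    using m by (subst measurable_pair_swap_iff) (simp add: split_def)
  show "\<tau> x \<in> measurable Q Q"
    using measurable_Pair2[OF m, of x] by simp
  show "\<omega> \<in> space Q \<Longrightarrow> (\<lambda>x. \<tau> x \<omega>) \<in> measurable lebesgue Q"
    using measurable_Pair1[OF m] by simp
qed

section \<open>Expectations of averages along orbits\<close>

text \<open>Stationarity is stated for images of sets, whereas a change of variables needs
  preimages. The group law identifies the preimage under the shift by x with the image under the
  shift by -x.\<close>

lemma nn_integral_stationary:
  assumes act: "measure_action Q \<tau>" and stat: "stationary \<tau> Q" and F: "F \<in> borel_measurable Q"
  shows "(\<integral>\<^sup>+\<omega>. F (\<tau> x \<omega>) \<partial>Q) = (\<integral>\<^sup>+\<omega>. F \<omega> \<partial>Q)"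
proof -
  note \<tau> = measurable_action[OF act]
  have zero: "\<tau> 0 \<omega> = \<omega>" and add: "\<tau> (x + y) \<omega> = \<tau> x (\<tau> y \<omega>)" if "\<omega> \<in> space Q" for \<omega> x y
    using act that unfolding measure_action_def by blast+
  have "distr Q Q (\<tau> x) = Q"
  proof (rule measure_eqI)
    fix B assume "B \<in> sets (distr Q Q (\<tau> x))"
    then have B: "B \<in> sets Q" by simp
    have "\<tau> x -` B \<inter> space Q = \<tau> (- x) ` B"
    proof (intro equalityI subsetI)
      fix \<omega> assume \<omega>: "\<omega> \<in> \<tau> x -` B \<inter> space Q"
      then have "\<tau> (- x) (\<tau> x \<omega>) = \<omega>"
        using add[of \<omega> "- x" x] zero by simp
      then show "\<omega> \<in> \<tau> (- x) ` B" using \<omega> by (metis IntD1 imageI vimageD)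
    next
      fix \<omega> assume "\<omega> \<in> \<tau> (- x) ` B"
      then obtain \<omega>' where \<omega>': "\<omega>' \<in> B" "\<omega> = \<tau> (- x) \<omega>'" by blast
      then have "\<omega>' \<in> space Q" using B sets.sets_into_space by blast
      then have "\<tau> x \<omega> = \<omega>'"
        using add[of \<omega>' x "- x"] zero \<omega>'(2) by simp
      then show "\<omega> \<in> \<tau> x -` B \<inter> space Q"
        using act \<omega>' \<open>\<omega>' \<in> space Q\<close> by (simp add: measure_action_def)
    qed
    then have "emeasure (distr Q Q (\<tau> x)) B = emeasure Q (\<tau> (- x) ` B)"
      using B \<tau> by (simp add: emeasure_distr)
    also have "\<dots> = emeasure Q B"
      using stat B unfolding stationary_def by blast
    finally show "emeasure (distr Q Q (\<tau> x)) B = emeasure Q B" .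
  qed simp
  moreover have "F \<in> borel_measurable (distr Q Q (\<tau> x))"
    using F by simp
  ultimately show ?thesis
    using nn_integral_distr[OF \<tau>[of x], of F] by simp
qed

text \<open>Fubini, followed by stationarity at each fixed x. A weighted average over an orbit thus
  has an expectation that depends on the weight only through its total mass.\<close>

lemma nn_integral_action_swap:
  fixes \<tau> :: "real^'d \<Rightarrow> 'w \<Rightarrow> 'w"
  assumes prob: "prob_space Q" and act: "measure_action Q \<tau>" and stat: "stationary \<tau> Q"
    and F: "F \<in> borel_measurable Q" and w: "w \<in> borel_measurable lebesgue"
  shows "(\<integral>\<^sup>+\<omega>. (\<integral>\<^sup>+x. w x * F (\<tau> x \<omega>) \<partial>lebesgue) \<partial>Q) = (\<integral>\<^sup>+x. w x \<partial>lebesgue) * (\<integral>\<^sup>+\<omega>. F \<omega> \<partial>Q)"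
proof -
  interpret Q: prob_space Q by (rule prob)
  interpret L: sigma_finite_measure "lebesgue :: (real^'d) measure" by (rule sigma_finite_lebesgue)
  interpret pair_sigma_finite "lebesgue :: (real^'d) measure" Q ..
  have m: "(\<lambda>(x, \<omega>). \<tau> x \<omega>) \<in> measurable (lebesgue \<Otimes>\<^sub>M Q) Q"
    using act by (simp add: measure_action_def)
  have "(\<lambda>(x, \<omega>). w x * F (\<tau> x \<omega>)) \<in> borel_measurable (lebesgue \<Otimes>\<^sub>M Q)"
    using measurable_compose[OF m F] unfolding split_def
    by (intro borel_measurable_times_ennreal measurable_compose[OF measurable_fst w])
  from Fubini'[OF this]
  have "(\<integral>\<^sup>+\<omega>. (\<integral>\<^sup>+x. w x * F (\<tau> x \<omega>) \<partial>lebesgue) \<partial>Q) = (\<integral>\<^sup>+x. (\<integral>\<^sup>+\<omega>. w x * F (\<tau> x \<omega>) \<partial>Q) \<partial>lebesgue)" .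
  also have "\<dots> = (\<integral>\<^sup>+x. w x * (\<integral>\<^sup>+\<omega>. F \<omega> \<partial>Q) \<partial>lebesgue)"
    using measurable_compose[OF measurable_action[OF act] F]
    by (simp add: nn_integral_cmult nn_integral_stationary[OF act stat F])
  finally show ?thesis
    using w by (simp add: nn_integral_multc)
qed

text \<open>The exceptional set sits in a measurable null set N, and the expected Lebesgue measure
  of the times an orbit spends in N is zero.\<close>

lemma AE_orbit:
  fixes \<tau> :: "real^'d \<Rightarrow> 'w \<Rightarrow> 'w"
  assumes prob: "prob_space Q" and act: "measure_action Q \<tau>" and stat: "stationary \<tau> Q"
    and ae: "AE \<omega> in Q. S \<omega>"
  shows "AE \<omega> in Q. AE x in lebesgue. S (\<tau> x \<omega>)"
proof -
  interpret L: sigma_finite_measure "lebesgue :: (real^'d) measure" by (rule sigma_finite_lebesgue)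
  obtain N where N: "N \<in> sets Q" "emeasure Q N = 0" "{\<omega> \<in> space Q. \<not> S \<omega>} \<subseteq> N"
    using ae by (auto elim: AE_E)
  have iN: "indicator N \<in> borel_measurable Q" using N(1) by simp
  \<comment> \<open>The weight 1 has infinite mass; the product with the zero measure of N is still
    0 in \<open>ennreal\<close>.\<close>
  have "(\<integral>\<^sup>+\<omega>. (\<integral>\<^sup>+x. 1 * indicator N (\<tau> x \<omega>) \<partial>lebesgue) \<partial>Q) = 0"
    using nn_integral_action_swap[OF prob act stat iN, of "\<lambda>_. 1"] N(1,2) by simp
  moreover have "(\<lambda>(\<omega>, x). indicator N (\<tau> x \<omega>) :: ennreal) \<in> borel_measurable (Q \<Otimes>\<^sub>M lebesgue)"
    using measurable_compose[OF measurable_action_pair[OF act] iN] by (simp add: split_def)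
  then have "(\<lambda>\<omega>. \<integral>\<^sup>+x. indicator N (\<tau> x \<omega>) \<partial>lebesgue) \<in> borel_measurable Q"
    by (rule L.borel_measurable_nn_integral)
  ultimately have "AE \<omega> in Q. (\<integral>\<^sup>+x. indicator N (\<tau> x \<omega>) \<partial>lebesgue) = 0"
    by (simp add: nn_integral_0_iff_AE)
  then show ?thesis
  proof (rule AE_mp[OF _ AE_I2], intro impI)
    fix \<omega> assume \<omega>: "\<omega> \<in> space Q" and "(\<integral>\<^sup>+x. indicator N (\<tau> x \<omega>) \<partial>lebesgue) = 0"
    then have "AE x in lebesgue. (indicator N (\<tau> x \<omega>) :: ennreal) = 0"
      using nn_integral_0_iff_AE[OF measurable_compose[OF measurable_orbit[OF act \<omega>] iN]] by blast
    then show "AE x in lebesgue. S (\<tau> x \<omega>)"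
    proof eventually_elim
      case (elim x)
      have "\<tau> x \<omega> \<in> space Q" using act \<omega> by (simp add: measure_action_def)
      then show ?case using elim N(3) by (auto simp: indicator_def split: if_splits)
    qed
  qed
qed

section \<open>Uniqueness of corrector gradients and of the matrix of a component\<close>

lemma corrector_gradient_unique:
  fixes \<tau> :: "real^'d \<Rightarrow> 'w \<Rightarrow> 'w" and A :: "'w \<Rightarrow> real^'d^'d"
  assumes prob: "prob_space Q" and act: "measure_action Q \<tau>" and stat: "stationary \<tau> Q"
    and A: "A \<in> borel_measurable Q" "\<And>\<omega>. \<omega> \<in> space Q \<Longrightarrow> transpose (A \<omega>) = A \<omega>"
    and lam: "0 < lam" "lam \<le> Lam"
    and ell: "AE \<omega> in Q. \<forall>\<zeta>. lam * (norm \<zeta>)\<^sup>2 \<le> \<zeta> \<bullet> (A \<omega> *v \<zeta>) \<and> \<zeta> \<bullet> (A \<omega> *v \<zeta>) \<le> Lam * (norm \<zeta>)\<^sup>2"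
    and c: "correctors \<tau> A Q \<phi> g" and c': "correctors \<tau> A Q \<phi>' g'"
  shows "AE \<omega> in Q. g i \<omega> = g' i \<omega>"
proof -
  interpret Q: prob_space Q by (rule prob)
  interpret L: sigma_finite_measure "lebesgue :: (real^'d) measure" by (rule sigma_finite_lebesgue)
  have gm: "g i \<in> borel_measurable Q" "g' i \<in> borel_measurable Q"
    using c c' by (auto simp: correctors_def)
  define q where "q \<omega> = (norm (g i \<omega> - g' i \<omega>))\<^sup>2" for \<omega>
  define m where "m \<omega> = min 1 (q \<omega>)" for \<omega>
  have qm: "q \<in> borel_measurable Q" "m \<in> borel_measurable Q"
    unfolding q_def[abs_def] m_def[abs_def] using gm by measurable
  have m01: "0 \<le> m \<omega>" "m \<omega> \<le> 1" "m \<omega> \<le> q \<omega>" for \<omega>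
    by (auto simp: m_def q_def)
  \<comment> \<open>The quotient of the gradient estimate: integration over radius n/4 but division
    by the volume for radius n. The mass is therefore (1/4)^d for n > 0, while for n = 0 the weight
    is identically zero.\<close>
  define w :: "nat \<Rightarrow> real^'d \<Rightarrow> real" where
    "w n x = indicator (ball 0 (real n / 4)) x / measure lebesgue (ball (0::real^'d) (real n))" for n x
  have wm: "w n \<in> borel_measurable lebesgue" for n
    unfolding w_def by (intro borel_measurable_divide borel_measurable_indicator) auto
  have w0: "0 \<le> w n x" for n x
    by (simp add: w_def)
  have wi: "integrable lebesgue (w n)" for n
  proof -
    have "ball (0::real^'d) (real n / 4) \<in> lmeasurable" by simp
    then show ?thesis
      unfolding w_def by (intro integrable_divide) (simp add: fmeasurable_def)
  qed
  have wI: "(\<integral>x. w n x \<partial>lebesgue) = (1 / 4) ^ CARD('d)" if "0 < n" for n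
    using that by (simp add: w_def content_ball power_divide less_imp_neq[OF unit_ball_vol_pos, symmetric])
  define F where "F n \<omega> = (\<integral>x. w n x * m (\<tau> x \<omega>) \<partial>lebesgue)" for n \<omega>
  have mo: "(\<lambda>x. m (\<tau> x \<omega>)) \<in> borel_measurable lebesgue" if "\<omega> \<in> space Q" for \<omega>
    by (rule measurable_compose[OF measurable_orbit[OF act that] qm(2)])
  have Fi: "integrable lebesgue (\<lambda>x. w n x * m (\<tau> x \<omega>))" if "\<omega> \<in> space Q" for n \<omega>
    by (rule integrable_mult_bounded[where C=1, OF wi mo[OF that]]) (use m01 in simp)
  have Fm: "F n \<in> borel_measurable Q" for n
    unfolding F_def
  proof (rule L.borel_measurable_lebesgue_integral)
    show "(\<lambda>(\<omega>, x). w n x * m (\<tau> x \<omega>)) \<in> borel_measurable (Q \<Otimes>\<^sub>M lebesgue)"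
      using measurable_compose[OF measurable_action_pair[OF act] qm(2)]
      unfolding split_def by (intro borel_measurable_times measurable_compose[OF measurable_snd wm])
  qed
  have FI: "(\<integral>\<^sup>+\<omega>. ennreal (F n \<omega>) \<partial>Q) = ennreal ((1 / 4) ^ CARD('d)) * (\<integral>\<^sup>+\<omega>. ennreal (m \<omega>) \<partial>Q)" if "0 < n" for n
  proof -
    have "(\<integral>\<^sup>+\<omega>. ennreal (F n \<omega>) \<partial>Q) = (\<integral>\<^sup>+\<omega>. (\<integral>\<^sup>+x. ennreal (w n x) * ennreal (m (\<tau> x \<omega>)) \<partial>lebesgue) \<partial>Q)"
      using Fi w0 m01 unfolding F_def
      by (intro nn_integral_cong) (simp add: nn_integral_eq_integral flip: ennreal_mult)
    also have "\<dots> = (\<integral>\<^sup>+x. ennreal (w n x) \<partial>lebesgue) * (\<integral>\<^sup>+\<omega>. ennreal (m \<omega>) \<partial>Q)"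
      using qm wm by (intro nn_integral_action_swap prob act stat) auto
    finally show ?thesis
      using wi w0 wI[OF that] by (simp add: nn_integral_eq_integral)
  qed
  have "AE \<omega> in Q. (\<lambda>n. F n \<omega>) \<longlonglongrightarrow> 0"
  proof -
    have props: "AE \<omega> in Q. H1_loc_with_grad (\<phi> i \<omega>) (\<lambda>x. g i (\<tau> x \<omega>)) \<and>
             weakly_div_free (\<lambda>x. A (\<tau> x \<omega>) *v (g i (\<tau> x \<omega>) + axis i 1)) \<and>
             ((\<lambda>R. ball_avg R (\<lambda>x. (\<phi> i \<omega> x - ball_avg R (\<phi> i \<omega>))\<^sup>2) / R\<^sup>2) \<longlongrightarrow> 0) at_top"
      if "correctors \<tau> A Q \<phi> g" for \<phi> g
      using that unfolding correctors_def by blast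
    \<comment> \<open>The corrector properties already concern whole fields at fixed \<omega>.
      Ellipticity is a statement at single environments and has to be carried along the
      orbit.\<close>
    show ?thesis
      using AE_space AE_orbit[OF prob act stat ell] props[OF c] props[OF c']
    proof eventually_elim
      case (elim \<omega>)
      note \<omega> = elim(1)
      have am: "(\<lambda>x. A (\<tau> x \<omega>)) \<in> borel_measurable lebesgue"
        by (rule measurable_compose[OF measurable_orbit[OF act \<omega>] A(1)])
      have as: "transpose (A (\<tau> x \<omega>)) = A (\<tau> x \<omega>)" for x
        using act \<omega> A(2) by (simp add: measure_action_def)
      have "((\<lambda>R. (\<integral>x. indicator (ball 0 (R / 4)) x * (norm (g i (\<tau> x \<omega>) - g' i (\<tau> x \<omega>)))\<^sup>2 \<partial>lebesgue) /
          measure lebesgue (ball (0::real^'d) R)) \<longlongrightarrow> 0) at_top"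
        using elim by (intro sublinear_gradient_vanishes[OF am as lam elim(2)]) auto
      from filterlim_compose[OF this filterlim_real_sequentially]
      have lim: "(\<lambda>n. \<integral>x. w n x * q (\<tau> x \<omega>) \<partial>lebesgue) \<longlonglongrightarrow> 0"
        by (simp add: w_def q_def)
      have L2: "L2_loc (\<lambda>x. g i (\<tau> x \<omega>) - g' i (\<tau> x \<omega>))"
        using elim(3,4) by (intro L2_loc_diff) (auto simp: H1_loc_with_grad_def)
      have "F n \<omega> \<le> (\<integral>x. w n x * q (\<tau> x \<omega>) \<partial>lebesgue)" for n
        unfolding F_def
      proof (rule integral_mono[OF Fi[OF \<omega>]])
        show "integrable lebesgue (\<lambda>x. w n x * q (\<tau> x \<omega>))"
          using integrable_L2_loc_ball[OF L2, of "real n / 4"] by (simp add: w_def q_def)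
      qed (use m01 w0 in \<open>auto intro: mult_left_mono\<close>)
      moreover have "0 \<le> F n \<omega>" for n
        unfolding F_def using m01 w0 by (intro Bochner_Integration.integral_nonneg) simp
      ultimately show ?case
        by (intro tendsto_sandwich[OF _ _ tendsto_const lim]) auto
    qed
  qed
  moreover have "F n \<omega> \<le> (1 / 4) ^ CARD('d) + 1" if "\<omega> \<in> space Q" for n \<omega>
  proof (cases "n = 0")
    case False
    have "F n \<omega> \<le> (\<integral>x. w n x \<partial>lebesgue)"
      unfolding F_def using m01 w0 by (intro integral_mono[OF Fi[OF that] wi]) (simp add: mult_left_le)
    then show ?thesis using wI False by simp
  qed (simp add: F_def w_def)
  ultimately have "(\<lambda>n. \<integral>\<^sup>+\<omega>. ennreal (F n \<omega>) \<partial>Q) \<longlonglongrightarrow> 0"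
    using Fm by (intro nn_integral_tendsto_0[where w="\<lambda>_. (1 / 4) ^ CARD('d) + 1"]) (auto simp: Q.emeasure_space_1)
  \<comment> \<open>Passing to \<open>Suc n\<close> avoids the degenerate index 0; by
    \<open>FI\<close> the sequence is then constant, so its value equals its limit 0.\<close>
  then have "(\<lambda>n. \<integral>\<^sup>+\<omega>. ennreal (F (Suc n) \<omega>) \<partial>Q) \<longlonglongrightarrow> 0"
    by (rule LIMSEQ_Suc)
  then have "ennreal ((1 / 4) ^ CARD('d)) * (\<integral>\<^sup>+\<omega>. ennreal (m \<omega>) \<partial>Q) = 0"
    by (simp add: FI LIMSEQ_const_iff)
  then have "(\<integral>\<^sup>+\<omega>. ennreal (m \<omega>) \<partial>Q) = 0"
    by simp
  then have "AE \<omega> in Q. ennreal (m \<omega>) = 0"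
    using qm by (simp add: nn_integral_0_iff_AE)
  then show ?thesis
  proof eventually_elim
    case (elim \<omega>)
    then have "m \<omega> \<le> 0" by (simp add: ennreal_eq_0_iff)
    then have "min 1 (q \<omega>) \<le> 0" by (simp only: m_def)
    then show ?case by (simp add: q_def min_le_iff_disj)
  qed
qed

text \<open>Almost sure equality of gradients gives equality of the energy integrals, so the
  description under \<open>THE\<close> has one value and any available family of correctors computes
  it.\<close>

lemma homogenized_matrix_eqI:
  fixes \<tau> :: "real^'d \<Rightarrow> 'w \<Rightarrow> 'w" and A :: "'w \<Rightarrow> real^'d^'d"
  assumes prob: "prob_space Q" and act: "measure_action Q \<tau>" and stat: "stationary \<tau> Q"
    and A: "A \<in> borel_measurable Q" "\<And>\<omega>. \<omega> \<in> space Q \<Longrightarrow> transpose (A \<omega>) = A \<omega>"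
    and lam: "0 < lam" "lam \<le> Lam"
    and ell: "AE \<omega> in Q. \<forall>\<zeta>. lam * (norm \<zeta>)\<^sup>2 \<le> \<zeta> \<bullet> (A \<omega> *v \<zeta>) \<and> \<zeta> \<bullet> (A \<omega> *v \<zeta>) \<le> Lam * (norm \<zeta>)\<^sup>2"
    and c: "correctors \<tau> A Q \<phi> g"
  shows "homogenized_matrix \<tau> A Q = (\<chi> i j. \<integral>\<omega>. energy_density A g i j \<omega> \<partial>Q)"
  unfolding homogenized_matrix_def
proof (rule the_equality)
  show "\<exists>\<phi> g'. correctors \<tau> A Q \<phi> g' \<and>
      (\<chi> i j. \<integral>\<omega>. energy_density A g i j \<omega> \<partial>Q) = (\<chi> i j. \<integral>\<omega>. energy_density A g' i j \<omega> \<partial>Q)"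
    using c by blast
next
  fix a assume "\<exists>\<phi> g'. correctors \<tau> A Q \<phi> g' \<and> a = (\<chi> i j. \<integral>\<omega>. energy_density A g' i j \<omega> \<partial>Q)"
  then obtain \<phi>' g' where c': "correctors \<tau> A Q \<phi>' g'" and a: "a = (\<chi> i j. \<integral>\<omega>. energy_density A g' i j \<omega> \<partial>Q)"
    by blast
  have em: "energy_density A g i j \<in> borel_measurable Q" if "correctors \<tau> A Q \<phi> g" for i j \<phi> g
  proof -
    have "g i \<in> borel_measurable Q" "g j \<in> borel_measurable Q"
      using that by (auto simp: correctors_def)
    then show ?thesis
      unfolding energy_density_def[abs_def]
      by (intro borel_measurable_inner borel_measurable_matrix_vector_mult A borel_measurable_add) auto
  qed
  have unique: "AE \<omega> in Q. g' i \<omega> = g i \<omega>" for i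
    by (rule corrector_gradient_unique[OF prob act stat A(1) _ lam ell c' c]) (rule A(2))
  have "(\<integral>\<omega>. energy_density A g' i j \<omega> \<partial>Q) = (\<integral>\<omega>. energy_density A g i j \<omega> \<partial>Q)" for i j
  proof (rule integral_cong_AE[OF em[OF c'] em[OF c]])
    show "AE \<omega> in Q. energy_density A g' i j \<omega> = energy_density A g i j \<omega>"
      using unique[of i] unique[of j] by eventually_elim (simp add: energy_density_def)
  qed
  then show "a = (\<chi> i j. \<integral>\<omega>. energy_density A g i j \<omega> \<partial>Q)"
    by (simp add: a)
qed

section \<open>Passing from the environment to its components\<close>

lemma energy_density_measurable:
  fixes A :: "'w \<Rightarrow> real^'d^'d"
  assumes "A \<in> borel_measurable M" "\<And>i. g i \<in> borel_measurable M"
  shows "energy_density A g i j \<in> borel_measurable M"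
  unfolding energy_density_def[abs_def]
  by (intro borel_measurable_inner borel_measurable_matrix_vector_mult borel_measurable_add assms) auto

lemma measurable_vec_lambda2:
  fixes f :: "'d::finite \<Rightarrow> 'd \<Rightarrow> 'a \<Rightarrow> real"
  assumes "\<And>i j. f i j \<in> borel_measurable M"
  shows "(\<lambda>x. (\<chi> i j. f i j x) :: real^'d^'d) \<in> borel_measurable M"
proof (subst borel_measurable_euclidean_space, intro ballI)
  fix b :: "real^'d^'d" assume "b \<in> Basis"
  have "(\<lambda>x. \<Sum>i\<in>UNIV. \<Sum>j\<in>UNIV. f i j x * b $ i $ j) \<in> borel_measurable M"
    by (intro borel_measurable_sum borel_measurable_times assms borel_measurable_const)
  then show "(\<lambda>x. (\<chi> i j. f i j x) \<bullet> b) \<in> borel_measurable M"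
    by (simp add: inner_vec_def)
qed

text \<open>Recasts the decomposition as a probability kernel and \<open>P\<close> as its mixture,
  so that null sets and integrals can be disintegrated by the rules for \<open>bind\<close>. The
  integral identity, applied to indicators, gives equality of the measures.\<close>

lemma ergodic_decomposition_kernel:
  assumes "ergodic_decomposition \<tau> P P\<^sub>0 K p" and P: "prob_space P"
  shows "K \<in> measurable P\<^sub>0 (subprob_algebra P)" "P = P\<^sub>0 \<bind> K"
proof -
  interpret P: prob_space P by (rule P)
  have prob: "prob_space (K \<xi>)" and sets: "sets (K \<xi>) = sets P" if "\<xi> \<in> space P\<^sub>0" for \<xi>
    using assms(1) that unfolding ergodic_decomposition_def by blast+
  have space: "space (K \<xi>) = space P" if "\<xi> \<in> space P\<^sub>0" for \<xi>
    by (rule sets_eq_imp_space_eq[OF sets[OF that]])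
  have "prob_space P\<^sub>0"
    using assms(1) unfolding ergodic_decomposition_def by blast
  then interpret P\<^sub>0: prob_space P\<^sub>0 .
  have meas: "(\<lambda>\<xi>. measure (K \<xi>) B) \<in> borel_measurable P\<^sub>0" if "B \<in> sets P" for B
    using assms(1) that unfolding ergodic_decomposition_def by blast
  have em: "emeasure (K \<xi>) B = ennreal (measure (K \<xi>) B)" if "\<xi> \<in> space P\<^sub>0" for \<xi> B
  proof -
    interpret K: prob_space "K \<xi>" by (rule prob[OF that])
    show ?thesis by (rule K.emeasure_eq_measure)
  qed
  show K: "K \<in> measurable P\<^sub>0 (subprob_algebra P)"
  proof (rule measurable_subprob_algebra)
    show "(\<lambda>\<xi>. emeasure (K \<xi>) B) \<in> borel_measurable P\<^sub>0" if "B \<in> sets P" for B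
      using meas[OF that] by (simp add: em cong: measurable_cong)
  qed (use prob sets prob_space_imp_subprob_space in auto)
  show "P = P\<^sub>0 \<bind> K"
  proof (rule measure_eqI)
    show "sets P = sets (P\<^sub>0 \<bind> K)"
      using sets P\<^sub>0.not_empty by simp
    fix B assume B: "B \<in> sets P"
    have "integrable P (indicator B :: _ \<Rightarrow> real)"
      by (rule integrable_real_indicator[OF B]) (simp add: P.emeasure_eq_measure)
    then have "(\<integral>\<omega>. indicator B \<omega> \<partial>P) = (\<integral>\<xi>. (\<integral>\<omega>. indicator B \<omega> \<partial>K \<xi>) \<partial>P\<^sub>0 :: real)"
      using assms(1) unfolding ergodic_decomposition_def by blast
    then have "measure P B = (\<integral>\<xi>. measure (K \<xi>) B \<partial>P\<^sub>0)"
      using sets.sets_into_space[OF B]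
      by (simp add: space Int_absorb2 cong: Bochner_Integration.integral_cong)
    then have "emeasure P B = ennreal (\<integral>\<xi>. measure (K \<xi>) B \<partial>P\<^sub>0)"
      by (simp add: P.emeasure_eq_measure)
    also have "\<dots> = (\<integral>\<^sup>+\<xi>. ennreal (measure (K \<xi>) B) \<partial>P\<^sub>0)"
    proof (rule nn_integral_eq_integral[symmetric])
      show "integrable P\<^sub>0 (\<lambda>\<xi>. measure (K \<xi>) B)"
        using prob prob_space.prob_le_1
        by (intro P\<^sub>0.integrable_const_bound[where B=1] meas B AE_I2) auto
    qed simp
    also have "\<dots> = (\<integral>\<^sup>+\<xi>. emeasure (K \<xi>) B \<partial>P\<^sub>0)"
      by (rule nn_integral_cong) (simp add: em)
    also have "\<dots> = emeasure (P\<^sub>0 \<bind> K) B"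
      by (rule emeasure_bind[symmetric, OF P\<^sub>0.not_empty K B])
    finally show "emeasure P B = emeasure (P\<^sub>0 \<bind> K) B" .
  qed
qed

text \<open>The property S may fail to be measurable, as the corrector conditions might. It is
  therefore replaced by avoidance of a measurable null set E, to which disintegration
  applies.\<close>

lemma AE_kernel:
  assumes K: "K \<in> measurable M (subprob_algebra N)" and N: "N = M \<bind> K" and ae: "AE \<omega> in N. S \<omega>"
  shows "AE \<xi> in M. AE \<omega> in K \<xi>. S \<omega>"
proof -
  obtain E where E: "E \<in> sets N" "emeasure N E = 0" "{\<omega> \<in> space N. \<not> S \<omega>} \<subseteq> E"
    using ae by (auto elim: AE_E)
  have "AE \<omega> in N. \<omega> \<notin> E"
    using E by (intro AE_not_in) (auto simp: null_sets_def)
  then have "AE \<omega> in M \<bind> K. \<omega> \<notin> E"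
    unfolding N[symmetric] .
  moreover have "Measurable.pred N (\<lambda>\<omega>. \<omega> \<notin> E)"
    using E(1) by measurable
  ultimately have "AE \<xi> in M. AE \<omega> in K \<xi>. \<omega> \<notin> E"
    using AE_bind[OF K] by blast
  then show ?thesis
    using AE_space
  proof eventually_elim
    case (elim \<xi>)
    have "space (K \<xi>) = space N"
      using measurable_space[OF K elim(2)] by (intro sets_eq_imp_space_eq) (simp add: space_subprob_algebra)
    with elim(1) show ?case
      using E(3) by (intro AE_mp[OF elim(1) AE_I2]) auto
  qed
qed

lemma measure_action_cong:
  fixes \<tau> :: "real^'d \<Rightarrow> 'w \<Rightarrow> 'w"
  assumes "measure_action M \<tau>" "sets N = sets M"
  shows "measure_action N \<tau>"
proof -
  have "space N = space M"
    using assms(2) by (rule sets_eq_imp_space_eq)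
  moreover have "measurable ((lebesgue :: (real^'d) measure) \<Otimes>\<^sub>M N) N = measurable (lebesgue \<Otimes>\<^sub>M M) M"
    by (intro measurable_cong_sets sets_pair_measure_cong refl assms(2))
  ultimately show ?thesis
    using assms(1) by (simp add: measure_action_def)
qed

text \<open>The same \<open>\<phi>\<close> and \<open>g\<close> serve in almost every component:
  measurability depends on the sets alone, the conditions on fields are almost sure, and a finite
  integral over the mixture is finite in almost every component. The finitely many directions share
  one exceptional set of indices.\<close>

lemma correctors_kernel:
  fixes \<tau> :: "real^'d \<Rightarrow> 'w \<Rightarrow> 'w"
  assumes K: "K \<in> measurable M (subprob_algebra N)" and N: "N = M \<bind> K" and c: "correctors \<tau> A N \<phi> g"
  shows "AE \<xi> in M. correctors \<tau> A (K \<xi>) \<phi> g"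
proof -
  have sets: "sets (K \<xi>) = sets N" if "\<xi> \<in> space M" for \<xi>
    using measurable_space[OF K that] by (simp add: space_subprob_algebra)
  have "AE \<xi> in M. \<forall>i. integrable (K \<xi>) (\<lambda>\<omega>. (norm (g i \<omega>))\<^sup>2)"
  proof (subst AE_all_countable, intro allI)
    fix i
    have gm: "(\<lambda>\<omega>. (norm (g i \<omega>))\<^sup>2) \<in> borel_measurable N" and gi: "integrable N (\<lambda>\<omega>. (norm (g i \<omega>))\<^sup>2)"
      using c unfolding correctors_def by (auto dest: borel_measurable_integrable)
    have "(\<integral>\<^sup>+\<xi>. (\<integral>\<^sup>+\<omega>. ennreal ((norm (g i \<omega>))\<^sup>2) \<partial>K \<xi>) \<partial>M) = (\<integral>\<^sup>+\<omega>. ennreal ((norm (g i \<omega>))\<^sup>2) \<partial>N)"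
      unfolding N using gm by (subst nn_integral_bind[OF _ K]) auto
    also have "\<dots> \<noteq> \<infinity>"
      using gi by (simp add: nn_integral_eq_integral)
    finally have "AE \<xi> in M. (\<integral>\<^sup>+\<omega>. ennreal ((norm (g i \<omega>))\<^sup>2) \<partial>K \<xi>) \<noteq> \<infinity>"
      using gm by (intro nn_integral_PInf_AE measurable_compose[OF K nn_integral_measurable_subprob_algebra]) auto
    then show "AE \<xi> in M. integrable (K \<xi>) (\<lambda>\<omega>. (norm (g i \<omega>))\<^sup>2)"
      using AE_space
    proof eventually_elim
      case (elim \<xi>)
      then show ?case
        using gm by (intro integrableI_nonneg) (auto simp: less_top cong: measurable_cong_sets[OF sets refl])
    qed
  qed
  moreover have "AE \<xi> in M. \<forall>i. AE \<omega> in K \<xi>.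
      H1_loc_with_grad (\<phi> i \<omega>) (\<lambda>x. g i (\<tau> x \<omega>)) \<and>
      weakly_div_free (\<lambda>x. A (\<tau> x \<omega>) *v (g i (\<tau> x \<omega>) + axis i 1)) \<and>
      ((\<lambda>R. ball_avg R (\<lambda>x. (\<phi> i \<omega> x - ball_avg R (\<phi> i \<omega>))\<^sup>2) / R\<^sup>2) \<longlongrightarrow> 0) at_top"
    using c unfolding correctors_def by (subst AE_all_countable) (blast intro: AE_kernel[OF K N])
  ultimately show ?thesis
    using AE_space
  proof eventually_elim
    case (elim \<xi>)
    have "sets (K \<xi> \<Otimes>\<^sub>M (lebesgue :: (real^'d) measure)) = sets (N \<Otimes>\<^sub>M lebesgue)"
      by (rule sets_pair_measure_cong[OF sets[OF elim(3)] refl])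
    then have "measurable (K \<xi> \<Otimes>\<^sub>M (lebesgue :: (real^'d) measure)) borel = measurable (N \<Otimes>\<^sub>M lebesgue) (borel :: real measure)"
      by (intro measurable_cong_sets refl)
    moreover have "measurable (K \<xi>) borel = measurable N (borel :: (real^'d) measure)"
      by (intro measurable_cong_sets refl sets[OF elim(3)])
    ultimately show ?case
      using elim c unfolding correctors_def by blast
  qed
qed

section \<open>Agreement of the homogenized matrices and of their laws\<close>

theorem corollary2p3:
  fixes P :: "'w measure"
    and \<tau> :: "real^'d \<Rightarrow> 'w \<Rightarrow> 'w"
    and A :: "'w \<Rightarrow> real^'d^'d"
    and lam Lam :: real
    and P\<^sub>0 :: "'x measure"
    and K :: "'x \<Rightarrow> 'w measure"
    and p :: "'w \<Rightarrow> 'x"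
    and \<phi> :: "'d \<Rightarrow> 'w \<Rightarrow> real^'d \<Rightarrow> real"
    and g :: "'d \<Rightarrow> 'w \<Rightarrow> real^'d"
  assumes "CARD('d) \<ge> 2"
    and "prob_space P"
    and "measure_action P \<tau>"
    and "stationary \<tau> P"
    and "countably_generated P"
    and "stochastically_continuous \<tau> P"
    and "A \<in> borel_measurable P"
    and "\<forall>\<omega>\<in>space P. transpose (A \<omega>) = A \<omega>"
    and "0 < lam" and "lam \<le> Lam"
    and "AE \<omega> in P. \<forall>\<zeta>. lam * (norm \<zeta>)\<^sup>2 \<le> \<zeta> \<bullet> (A \<omega> *v \<zeta>) \<and> \<zeta> \<bullet> (A \<omega> *v \<zeta>) \<le> Lam * (norm \<zeta>)\<^sup>2"
    and "ergodic_decomposition \<tau> P P\<^sub>0 K p"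
    and "correctors \<tau> A P \<phi> g"
  shows "(AE \<xi> in P\<^sub>0. \<forall>\<omega>\<in>space P. p \<omega> = \<xi> \<longrightarrow>
            random_homogenized_matrix K p A g \<omega> = homogenized_matrix \<tau> A (K \<xi>)) \<and>
         (\<forall>B \<in> sets borel. B \<subseteq> {M. transpose M = M} \<longrightarrow>
            measure P {\<omega> \<in> space P. random_homogenized_matrix K p A g \<omega> \<in> B} =
            measure (completion P\<^sub>0) {\<xi> \<in> space P\<^sub>0. homogenized_matrix \<tau> A (K \<xi>) \<in> B})"
proof -
  note kernel = ergodic_decomposition_kernel[OF assms(12,2)]
  have comp: "prob_space (K \<xi>)" "sets (K \<xi>) = sets P" "stationary \<tau> (K \<xi>)" if "\<xi> \<in> space P\<^sub>0" for \<xi>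
    using assms(12) that unfolding ergodic_decomposition_def by blast+
  \<comment> \<open>A measurable version of the map from an index to its homogenized matrix: the
    energies of the restricted correctors of \<open>P\<close>, defined for every index.\<close>
  define h where "h \<xi> = (\<chi> i j. \<integral>\<omega>. energy_density A g i j \<omega> \<partial>K \<xi>)" for \<xi>
  \<comment> \<open>The chosen version of the conditional expectation makes this an identity for
    every \<omega>, so the first claim holds on entire fibres of \<open>p\<close>, with exceptions
    only among the indices.\<close>
  have random: "random_homogenized_matrix K p A g \<omega> = h (p \<omega>)" for \<omega>
    by (simp add: random_homogenized_matrix_def inv_cond_exp_def h_def)
  have hom: "AE \<xi> in P\<^sub>0. homogenized_matrix \<tau> A (K \<xi>) = h \<xi>"
    using correctors_kernel[OF kernel assms(13)] AE_kernel[OF kernel assms(11)] AE_space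
  proof eventually_elim
    case (elim \<xi>)
    note \<xi> = comp[OF elim(3)]
    have A: "A \<in> borel_measurable (K \<xi>)"
      using assms(7) by (simp cong: measurable_cong_sets[OF \<xi>(2) refl])
    have "transpose (A \<omega>) = A \<omega>" if "\<omega> \<in> space (K \<xi>)" for \<omega>
      using assms(8) that sets_eq_imp_space_eq[OF \<xi>(2)] by simp
    from homogenized_matrix_eqI[OF \<xi>(1) measure_action_cong[OF assms(3) \<xi>(2)] \<xi>(3) A this assms(9,10) elim(2,1)]
    show ?case by (simp add: h_def)
  qed
  have h: "h \<in> borel_measurable P\<^sub>0"
  proof -
    have "g i \<in> borel_measurable P" for i
      using assms(13) by (simp add: correctors_def)
    then show ?thesis
      unfolding h_def[abs_def]
      by (intro measurable_vec_lambda2 measurable_compose[OF kernel(1) integral_measurable_subprob_algebra]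
          energy_density_measurable assms(7))
  qed
  \<comment> \<open>Measurability is given for the invariant sets; these are measurable for
    \<open>P\<close>, so \<open>p\<close> can be used to push \<open>P\<close> forward.\<close>
  have p: "p \<in> measurable P P\<^sub>0" and dist: "distr P P\<^sub>0 p = P\<^sub>0"
  proof -
    have "sets (invariant_algebra \<tau> P) \<subseteq> sets P"
      unfolding invariant_algebra_def invariant_sets_def
      by (subst sets_measure_of) (auto intro!: sets.sigma_sets_subset dest: sets.sets_into_space)
    moreover have "space (invariant_algebra \<tau> P) = space P"
      by (simp add: invariant_algebra_def invariant_sets_def space_measure_of_conv)
    moreover have "p \<in> measurable (invariant_algebra \<tau> P) P\<^sub>0"
      using assms(12) unfolding ergodic_decomposition_def by blast
    ultimately show "p \<in> measurable P P\<^sub>0"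
      by (auto simp: measurable_def)
    show "distr P P\<^sub>0 p = P\<^sub>0"
      using assms(12) unfolding ergodic_decomposition_def by blast
  qed
  show ?thesis
  proof (intro conjI ballI impI)
    show "AE \<xi> in P\<^sub>0. \<forall>\<omega>\<in>space P. p \<omega> = \<xi> \<longrightarrow>
        random_homogenized_matrix K p A g \<omega> = homogenized_matrix \<tau> A (K \<xi>)"
      using hom by eventually_elim (simp add: random)
    fix B :: "(real^'d^'d) set" assume B: "B \<in> sets borel"
    let ?S = "{\<xi> \<in> space P\<^sub>0. h \<xi> \<in> B}"
    have S: "?S \<in> sets P\<^sub>0"
      using measurable_sets[OF h B] by (simp add: vimage_def Int_def conj_commute)
    have "{\<omega> \<in> space P. random_homogenized_matrix K p A g \<omega> \<in> B} = p -` ?S \<inter> space P"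
      using measurable_space[OF p] by (auto simp: random)
    then have "measure P {\<omega> \<in> space P. random_homogenized_matrix K p A g \<omega> \<in> B} = measure (distr P P\<^sub>0 p) ?S"
      using measure_distr[OF p S] by simp
    also have "\<dots> = measure (completion P\<^sub>0) ?S"
      using S by (simp add: dist measure_completion)
    \<comment> \<open>The set on the right differs from the measurable set \<open>?S\<close> only
      inside a null set, so it is measurable for the completion and has the same measure
      there.\<close>
    also have "\<dots> = measure (completion P\<^sub>0) {\<xi> \<in> space P\<^sub>0. homogenized_matrix \<tau> A (K \<xi>) \<in> B}"
    proof -
      have ae: "AE \<xi> in completion P\<^sub>0. \<xi> \<in> ?S \<longleftrightarrow> \<xi> \<in> {\<xi> \<in> space P\<^sub>0. homogenized_matrix \<tau> A (K \<xi>) \<in> B}"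
        using AE_completion[OF hom] by eventually_elim auto
      have S': "?S \<in> sets (completion P\<^sub>0)" using S by simp
      have "{\<xi> \<in> space P\<^sub>0. homogenized_matrix \<tau> A (K \<xi>) \<in> B} \<in> sets (completion P\<^sub>0)"
        by (rule completion.in_sets_AE[OF ae S']) auto
      with ae S' show ?thesis
        by (intro measure_eq_AE)
    qed
    finally show "measure P {\<omega> \<in> space P. random_homogenized_matrix K p A g \<omega> \<in> B} =
        measure (completion P\<^sub>0) {\<xi> \<in> space P\<^sub>0. homogenized_matrix \<tau> A (K \<xi>) \<in> B}" .
  qed
qed

end
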